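(* Suppose $P_1$, $P_2$, and $P_3$ are pairwise disjoint and non-parallel planes in $\mathbb{H}^3$, and $B_4$ is a horoball defined by a positive light-like vector $\mathbf{x}_4$ not in the ideal boundary of any $P_i$, such that for each $i<4$, a single half-space $H_i$ bounded by $P_i$ contains $P_j$ for all $j\ne i$, $j<4$, and contains $\mathbf{x}_4$ in its ideal boundary. Let $\Delta$ be the partially truncated tetrahedron determined by the $P_i$ and $B_4$. For any $i<j\in\{1,2,3\}$, let $\tilde\lambda_{ij}$ be the geodesic intersecting $P_i$ and $P_j$ at right angles; and for $i<4$ let $\tilde\lambda_{i4}$ be the perpendicular geodesic to $P_i$ in the direction of $\mathbf{x}_4$. Fix such $i<j\le 3$ and let $k$ be the element of $\{1,2,3\}-\{i,j\}$, and fix parametrizations $\tilde\lambda_{ij}(s)$ and $\tilde\lambda_{k4}(t)$ by arclength. Then: \begin{enumerate} \item the function $D(s,t)$ that records the hyperbolic cosine of the distance from $\tilde\lambda_{ij}(s)$ to $\tilde\lambda_{k4}(t)$ has a unique critical point $(s_0,t_0)$ in $\mathbb{R}^2$, at which it attains an absolute minimum; \item the absolute minimum value $D(s_0,t_0)$ depends only on the pairwise distances $\ell_{i'j'}$ between $P_{i'}$ and $P_{j'}$ ($i'\neq j'\in\{1,2,3\}$) and the signed distances $h_{k'4}$ from $P_{k'}$ to $B_4$ ($k'\in\{1,2,3\}$); \item the points $\tilde\lambda_{ij}(s_0)$ and $\tilde\lambda_{k4}(t_0)$ lie in $\Delta$, so $D(s_0,t_0)$ is the hyperbolic cosine of a transversal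 length of $\Delta$; and \item written as $T_1(x,y;a,b;c,d)$, where $x=\cosh\ell_{ij}$, $y=e^{h_{k4}}$, $a=\cosh\ell_{ik}$ and $b=\cosh\ell_{jk}$ are the hyperbolic cosines of the other internal edge lengths, and $c=e^{h_{i4}}$ and $d=e^{h_{j4}}$, this transversal length is invariant under the involution that swaps its inputs $a$ with $b$ and $c$ with $d$, and increasing in each of $a$, $b$, $c$, $d$ individually. \end{enumerate}
   Context: Hyperboloid model. On $\mathbb{R}^{4}$ put $\mathbf{x}\circ\mathbf{y}=-x_1y_1+x_2y_2+x_3y_3+x_4y_4$. A nonzero vector $\mathbf{x}$ is light-like if $\mathbf{x}\circ\mathbf{x}=0$, and time-like if $\mathbf{x}\circ\mathbf{x}<0$; such a vector is positive if its first entry is positive. $\mathbb{H}^3$ is the set of positive $\mathbf{x}$ with $\mathbf{x}\circ\mathbf{x}=-1$, with $\cosh d_H(\mathbf{u},\mathbf{v})=-\mathbf{u}\circ\mathbf{v}$. Ideal points of $\mathbb{H}^3$ are projective classes $[\mathbf{x}]$ of positive light-like vectors. A positive light-like $\mathbf{x}$ determines the horosphere $S=\{\mathbf{v}\in\mathbb{H}^3: \mathbf{v}\circ\mathbf{x}=-1\}$ and the horoball $B=\{\mathbf{v}\in\mathbb{H}^3:\mathbf{v}\circ\mathbf{x}\ge -1\}$, with ideal point $[\mathbf{x}]$. A plane is $P=V\cap\mathbb{H}^3$ for a 3-dimensional subspace $V$ containing a time-like vector; a half-space is the closure of a component of $\mathbb{H}^3-P$. The ideal boundary of $P$ (resp.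 of a half-space $H$ bounded by $P$) is the intersection of the set of positive light-like vectors with $V$ (resp. with the closure of the component of $\mathbb{R}^4-V$ containing the interior of $H$). Two disjoint planes are parallel if their ideal boundaries intersect. The geodesic perpendicular to $P$ in the direction of $\mathbf{x}$ is the geodesic meeting $P$ at a right angle and having $[\mathbf{x}]$ as an ideal endpoint. The signed distance from a point to a horoball $B$ is the distance to $\partial B$, positive outside $B$ and negative inside. The signed distance from a plane $P$ to $B$ is the minimum over points of $P$ of the signed distance to $B$. Partially truncated tetrahedron (three planes, one horoball). With $P_1,P_2,P_3,\mathbf{x}_4$ and $H_i$ as in the claim: for $i\le 3$ there is a unique plane $\widehat P_i$ meeting $P_j$ at right angles for each $j\le 3$, $j\neq i$, and having $\mathbf{x}_4$ in its ideal boundary; and there is a unique plane $\widehat P_4$ meeting $P_1,P_2,P_3$ at right angles. If $\widehat P_1$ does not meet $P_1$ orthogonally, then $\Delta=\left(\bigcap_{i=1}^3H_i\right)\cap\left(\bigcap_{i=1}^4\widehat H_i\right)$, where for $i\le 3$, $\widehat H_i$ is the half-space bounded by $\widehat P_i$ that contains the shortest arc from $P_j$ to $P_i$ for each $j\le 3$, $j\ne i$, and the geodesic ray from $P_i$, perpendicular to $P_i$, in the direction of $\mathbf{x}_4$; and $\widehat H_4$ is the half-space bounded by $\widehat P_4$ that contains the geodesics perpendicular to $P_j$ in the direction of $\mathbf{x}_4$, $j\le 3$. If $\widehat P_1$ meets $P_1$ orthogonally, then all $\widehat P_i$ equal a single plane $\widehat P$; after renumbering $P_1,P_2,P_3$ so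 that the perpendicular geodesic to $P_1$ and $P_3$ separates $P_2\cap\widehat P$ from $\mathbf{x}_4$, the (degenerate) $\Delta$ is $\widehat P\cap\left(\bigcap_{i=1}^3H_i\right)\cap h_{12}\cap h_{23}\cap h_{34}\cap h_{14}$, where $h_{12}$ is the half-plane of $\widehat P$ bounded by the perpendicular geodesic to $P_1$ and $P_2$ that contains $P_3\cap\widehat P$ and has $\mathbf{x}_4$ in its ideal boundary, and the other $h$'s are defined analogously (using, for index $4$, geodesics perpendicular to $P_i$ in the direction of $\mathbf{x}_4$). Edges: for $i'\neq j'\le 3$, $\lambda_{i'j'}$ is the shortest arc joining $P_{i'}$ to $P_{j'}$, of length $\ell_{i'j'}=\ell_{j'i'}$; for $i'\le3$, $\lambda_{i'4}$ is the geodesic ray perpendicular to $P_{i'}$ (starting at $P_{i'}$) in the direction of $\mathbf{x}_4$. The transversal of $\Delta$ joining $\lambda_{ij}$ to its opposite edge $\lambda_{k4}$ is the shortest geodesic arc with one endpoint on each edge, or their point of intersection if they intersect. $T_1$ is a function on the tuples realized by such configurations. *)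

theory Defs
  imports "HOL-Analysis.Analysis"
begin

section \<open>The hyperboloid model\<close>

definition lor :: "real^4 \<Rightarrow> real^4 \<Rightarrow> real" where
  "lor x y = - (x$1 * y$1) + x$2 * y$2 + x$3 * y$3 + x$4 * y$4"

definition time_like :: "real^4 \<Rightarrow> bool" where
  "time_like x \<longleftrightarrow> lor x x < 0"

definition light_like :: "real^4 \<Rightarrow> bool" where
  "light_like x \<longleftrightarrow> x \<noteq> 0 \<and> lor x x = 0"

definition hyp3 :: "(real^4) set" where
  "hyp3 = {x. x$1 > 0 \<and> lor x x = -1}"

definition dH :: "real^4 \<Rightarrow> real^4 \<Rightarrow> real" where
  "dH u v = arcosh (- lor u v)"

text \<open>An ideal point is represented by any positive light-like vector in its projective class;
  all notions below that describe ideal points are invariant under positive rescaling.\<close>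

definition pos_light :: "(real^4) set" where
  "pos_light = {x. light_like x \<and> x$1 > 0}"

definition horosphere :: "real^4 \<Rightarrow> (real^4) set" where
  "horosphere x = {v \<in> hyp3. lor v x = -1}"

definition horoball :: "real^4 \<Rightarrow> (real^4) set" where
  "horoball x = {v \<in> hyp3. lor v x \<ge> -1}"


section \<open>Planes, geodesics and half-spaces\<close>

definition is_plane :: "(real^4) set \<Rightarrow> bool" where
  "is_plane P \<longleftrightarrow>
     (\<exists>V. subspace V \<and> dim V = 3 \<and> (\<exists>v\<in>V. time_like v) \<and> P = V \<inter> hyp3)"

definition is_geodesic :: "(real^4) set \<Rightarrow> bool" where
  "is_geodesic L \<longleftrightarrow>
     (\<exists>U. subspace U \<and> dim U = 2 \<and> (\<exists>v\<in>U. time_like v) \<and> L = U \<inter> hyp3)"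

text \<open>The subspace \<open>V\<close> underlying a plane or geodesic \<open>M = V \<inter> hyp3\<close> is recovered as
  \<open>span M\<close>, because \<open>V\<close> contains a time-like vector; likewise \<open>span hyp3 = UNIV\<close>.\<close>

definition ideal_boundary :: "(real^4) set \<Rightarrow> (real^4) set" where
  "ideal_boundary M = pos_light \<inter> span M"

definition parallel_planes :: "(real^4) set \<Rightarrow> (real^4) set \<Rightarrow> bool" where
  "parallel_planes P Q \<longleftrightarrow> P \<inter> Q = {} \<and> ideal_boundary P \<inter> ideal_boundary Q \<noteq> {}"

text \<open>The next two definitions are used with \<open>M = hyp3\<close> and \<open>N\<close> a plane (half-spaces), and
  with \<open>M\<close> a plane and \<open>N\<close> a geodesic in it (half-planes). The interior of a half \<open>H\<close>
  bounded by \<open>N\<close> is \<open>H - N\<close>.\<close>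

definition half_of :: "(real^4) set \<Rightarrow> (real^4) set \<Rightarrow> (real^4) set \<Rightarrow> bool" where
  "half_of M N H \<longleftrightarrow> (\<exists>C \<in> components (M - N). H = closure C)"

definition half_ideal_boundary ::
    "(real^4) set \<Rightarrow> (real^4) set \<Rightarrow> (real^4) set \<Rightarrow> (real^4) set" where
  "half_ideal_boundary M N H =
     {x \<in> pos_light. \<exists>C \<in> components (span M - span N). H - N \<subseteq> C \<and> x \<in> closure C}"

text \<open>For \<open>p \<in> M = V \<inter> hyp3\<close>, the tangent space of \<open>M\<close> at \<open>p\<close> consists of the
  \<open>u \<in> V\<close> with \<open>lor u p = 0\<close>.\<close>

definition geodesic_perp_plane :: "(real^4) set \<Rightarrow> (real^4) set \<Rightarrow> bool" where
  "geodesic_perp_plane L P \<longleftrightarrow>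
     (\<exists>p \<in> L \<inter> P. \<forall>u \<in> span L. \<forall>w \<in> span P.
        lor u p = 0 \<longrightarrow> lor w p = 0 \<longrightarrow> lor u w = 0)"

text \<open>For every \<open>p \<in> P\<close>, the vectors orthogonal to \<open>P\<close> form the normal line of \<open>P\<close> in
  the tangent space of \<open>hyp3\<close> at \<open>p\<close>.\<close>

definition normals :: "(real^4) set \<Rightarrow> (real^4) set" where
  "normals P = {n. \<forall>v\<in>P. lor n v = 0}"

definition planes_perp :: "(real^4) set \<Rightarrow> (real^4) set \<Rightarrow> bool" where
  "planes_perp P Q \<longleftrightarrow> P \<inter> Q \<noteq> {} \<and> (\<forall>n \<in> normals P. \<forall>m \<in> normals Q. lor n m = 0)"

definition common_perp :: "(real^4) set \<Rightarrow> (real^4) set \<Rightarrow> (real^4) set" where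
  "common_perp P Q =
     (THE L. is_geodesic L \<and> geodesic_perp_plane L P \<and> geodesic_perp_plane L Q)"

definition perp_toward :: "(real^4) set \<Rightarrow> real^4 \<Rightarrow> (real^4) set" where
  "perp_toward P x =
     (THE L. is_geodesic L \<and> geodesic_perp_plane L P \<and> x \<in> ideal_boundary L)"

text \<open>For \<open>p \<in> hyp3\<close>: the geodesic arc from \<open>p\<close> to \<open>q\<close> if \<open>q \<in> hyp3\<close>, and the
  geodesic ray from \<open>p\<close> with ideal endpoint represented by \<open>q\<close> if \<open>q \<in> pos_light\<close>.\<close>

definition arc_or_ray :: "real^4 \<Rightarrow> real^4 \<Rightarrow> (real^4) set" where
  "arc_or_ray p q = {v \<in> hyp3. \<exists>a\<ge>0. \<exists>b\<ge>0. v = a *\<^sub>R p + b *\<^sub>R q}"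

definition perp_ray_toward :: "(real^4) set \<Rightarrow> real^4 \<Rightarrow> (real^4) set" where
  "perp_ray_toward P x = (\<Union>p \<in> perp_toward P x \<inter> P. arc_or_ray p x)"

definition arclength_param :: "(real \<Rightarrow> real^4) \<Rightarrow> (real^4) set \<Rightarrow> bool" where
  "arclength_param g L \<longleftrightarrow> range g = L \<and> (\<forall>s t. dH (g s) (g t) = \<bar>s - t\<bar>)"


section \<open>Distances\<close>

definition nearest_points ::
    "(real^4) set \<Rightarrow> (real^4) set \<Rightarrow> real^4 \<Rightarrow> real^4 \<Rightarrow> bool" where
  "nearest_points X Y p q \<longleftrightarrow>
     p \<in> X \<and> q \<in> Y \<and> (\<forall>p'\<in>X. \<forall>q'\<in>Y. dH p q \<le> dH p' q')"

text \<open>If \<open>X\<close> and \<open>Y\<close> meet in one point, the shortest arc is that point, of length 0.\<close>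

definition shortest_arc :: "(real^4) set \<Rightarrow> (real^4) set \<Rightarrow> (real^4) set" where
  "shortest_arc X Y = (THE A. \<exists>p q. nearest_points X Y p q \<and> A = arc_or_ray p q)"

definition shortest_arc_length :: "(real^4) set \<Rightarrow> (real^4) set \<Rightarrow> real" where
  "shortest_arc_length X Y = (THE l. \<exists>p q. nearest_points X Y p q \<and> l = dH p q)"

definition signed_dist_point :: "real^4 \<Rightarrow> real^4 \<Rightarrow> real" where
  "signed_dist_point x v =
     (if v \<in> horoball x then - (INF u \<in> horosphere x. dH v u)
      else (INF u \<in> horosphere x. dH v u))"

definition signed_dist_plane :: "real^4 \<Rightarrow> (real^4) set \<Rightarrow> real" where
  "signed_dist_plane x P = (LEAST r. \<exists>v\<in>P. r = signed_dist_point x v)"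


section \<open>Partially truncated tetrahedra with three planes and one horoball\<close>

text \<open>Planes \<open>P i\<close> and half-spaces \<open>H i\<close> are indexed by \<open>i \<in> {1,2,3}\<close>; values at other
  indices are irrelevant. The vector \<open>x\<close> defines the horoball with index 4.\<close>

definition admissible ::
    "(nat \<Rightarrow> (real^4) set) \<Rightarrow> (nat \<Rightarrow> (real^4) set) \<Rightarrow> real^4 \<Rightarrow> bool" where
  "admissible P H x \<longleftrightarrow>
     (\<forall>i\<in>{1,2,3}. is_plane (P i)) \<and>
     (\<forall>i\<in>{1,2,3}. \<forall>j\<in>{1,2,3}. i \<noteq> j \<longrightarrow>
        P i \<inter> P j = {} \<and> \<not> parallel_planes (P i) (P j)) \<and>
     x \<in> pos_light \<and>
     (\<forall>i\<in>{1,2,3}. x \<notin> ideal_boundary (P i)) \<and>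
     (\<forall>i\<in>{1,2,3}. half_of hyp3 (P i) (H i) \<and>
        (\<forall>j\<in>{1,2,3}. j \<noteq> i \<longrightarrow> P j \<subseteq> H i) \<and>
        x \<in> half_ideal_boundary hyp3 (P i) (H i))"

definition trunc_plane :: "(nat \<Rightarrow> (real^4) set) \<Rightarrow> real^4 \<Rightarrow> nat \<Rightarrow> (real^4) set" where
  "trunc_plane P x i =
     (THE Q. is_plane Q \<and> (\<forall>j\<in>{1,2,3}. j \<noteq> i \<longrightarrow> planes_perp Q (P j)) \<and>
             x \<in> ideal_boundary Q)"

definition trunc_plane4 :: "(nat \<Rightarrow> (real^4) set) \<Rightarrow> (real^4) set" where
  "trunc_plane4 P = (THE Q. is_plane Q \<and> (\<forall>j\<in>{1,2,3}. planes_perp Q (P j)))"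

definition trunc_half :: "(nat \<Rightarrow> (real^4) set) \<Rightarrow> real^4 \<Rightarrow> nat \<Rightarrow> (real^4) set" where
  "trunc_half P x i =
     (THE K. half_of hyp3 (trunc_plane P x i) K \<and>
             (\<forall>j\<in>{1,2,3}. j \<noteq> i \<longrightarrow> shortest_arc (P j) (P i) \<subseteq> K) \<and>
             perp_ray_toward (P i) x \<subseteq> K)"

definition trunc_half4 :: "(nat \<Rightarrow> (real^4) set) \<Rightarrow> real^4 \<Rightarrow> (real^4) set" where
  "trunc_half4 P x =
     (THE K. half_of hyp3 (trunc_plane4 P) K \<and>
             (\<forall>j\<in>{1,2,3}. perp_toward (P j) x \<subseteq> K))"

text \<open>The degenerate case. Here \<open>Q\<close> is the plane containing the tetrahedron, and for the
  renumbering \<open>(p,q,r)\<close> of \<open>(1,2,3)\<close> the half-planes written \<open>h\<^sub>1\<^sub>2\<close>, \<open>h\<^sub>2\<^sub>3\<close>,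
  \<open>h\<^sub>3\<^sub>4\<close>, \<open>h\<^sub>1\<^sub>4\<close> after renumbering are, in this order,
  \<open>side_half P x Q p q r\<close>, \<open>side_half P x Q q r p\<close>,
  \<open>side_half4 P x Q r p q\<close> and \<open>side_half4 P x Q p q r\<close>.\<close>

definition side_half ::
    "(nat \<Rightarrow> (real^4) set) \<Rightarrow> real^4 \<Rightarrow> (real^4) set \<Rightarrow> nat \<Rightarrow> nat \<Rightarrow> nat \<Rightarrow> (real^4) set" where
  "side_half P x Q a b c =
     (THE h. half_of Q (common_perp (P a) (P b)) h \<and> P c \<inter> Q \<subseteq> h \<and>
             x \<in> half_ideal_boundary Q (common_perp (P a) (P b)) h)"

definition side_half4 ::
    "(nat \<Rightarrow> (real^4) set) \<Rightarrow> real^4 \<Rightarrow> (real^4) set \<Rightarrow> nat \<Rightarrow> nat \<Rightarrow> nat \<Rightarrow> (real^4) set" where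
  "side_half4 P x Q a b c =
     (THE h. half_of Q (perp_toward (P a) x) h \<and> P b \<inter> Q \<subseteq> h \<and> P c \<inter> Q \<subseteq> h)"

definition diagonal_separates ::
    "(nat \<Rightarrow> (real^4) set) \<Rightarrow> real^4 \<Rightarrow> (real^4) set \<Rightarrow> nat \<Rightarrow> nat \<Rightarrow> nat \<Rightarrow> bool" where
  "diagonal_separates P x Q p q r \<longleftrightarrow>
     (\<exists>h h'. half_of Q (common_perp (P p) (P r)) h \<and>
             half_of Q (common_perp (P p) (P r)) h' \<and> h \<noteq> h' \<and>
             P q \<inter> Q \<subseteq> h \<and>
             x \<in> half_ideal_boundary Q (common_perp (P p) (P r)) h')"

definition degenerate_tet ::
    "(nat \<Rightarrow> (real^4) set) \<Rightarrow> (nat \<Rightarrow> (real^4) set) \<Rightarrow> real^4 \<Rightarrow> (real^4) set \<Rightarrow> (real^4) set" where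
  "degenerate_tet P H x Q =
     {v. \<exists>p q r. {p, q, r} = {1, 2, 3} \<and> diagonal_separates P x Q p q r \<and>
         v \<in> Q \<inter> (\<Inter>i\<in>{1,2,3}. H i) \<inter>
             side_half P x Q p q r \<inter> side_half P x Q q r p \<inter>
             side_half4 P x Q r p q \<inter> side_half4 P x Q p q r}"

definition truncated_tet ::
    "(nat \<Rightarrow> (real^4) set) \<Rightarrow> (nat \<Rightarrow> (real^4) set) \<Rightarrow> real^4 \<Rightarrow> (real^4) set" where
  "truncated_tet P H x =
     (if planes_perp (trunc_plane P x 1) (P 1)
      then degenerate_tet P H x (trunc_plane P x 1)
      else (\<Inter>i\<in>{1,2,3}. H i) \<inter> (\<Inter>i\<in>{1,2,3}. trunc_half P x i) \<inter> trunc_half4 P x)"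


section \<open>Transversals\<close>

definition opposite_indices :: "nat \<Rightarrow> nat \<Rightarrow> nat \<Rightarrow> bool" where
  "opposite_indices i j k \<longleftrightarrow> i < j \<and> {i, j, k} = {1, 2, 3}"

definition transversal_length ::
    "(nat \<Rightarrow> (real^4) set) \<Rightarrow> real^4 \<Rightarrow> nat \<Rightarrow> nat \<Rightarrow> nat \<Rightarrow> real" where
  "transversal_length P x i j k =
     shortest_arc_length (shortest_arc (P i) (P j)) (perp_ray_toward (P k) x)"

definition cosh_dist_fun ::
    "(real \<Rightarrow> real^4) \<Rightarrow> (real \<Rightarrow> real^4) \<Rightarrow> real \<times> real \<Rightarrow> real" where
  "cosh_dist_fun lam mu = (\<lambda>(s, t). cosh (dH (lam s) (mu t)))"

definition critical_point :: "(real \<times> real \<Rightarrow> real) \<Rightarrow> real \<times> real \<Rightarrow> bool" where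
  "critical_point f z \<longleftrightarrow> (f has_derivative (\<lambda>_. 0)) (at z)"

definition edge_params ::
    "(nat \<Rightarrow> (real^4) set) \<Rightarrow> real^4 \<Rightarrow> nat \<Rightarrow> nat \<Rightarrow> nat \<Rightarrow>
     (real \<Rightarrow> real^4) \<Rightarrow> (real \<Rightarrow> real^4) \<Rightarrow> bool" where
  "edge_params P x i j k lam mu \<longleftrightarrow>
     arclength_param lam (common_perp (P i) (P j)) \<and>
     arclength_param mu (perp_toward (P k) x)"

text \<open>The tuple \<open>(x, y, a, b, c, d)\<close> of arguments of \<open>T\<^sub>1\<close>.\<close>

definition T1_args ::
    "(nat \<Rightarrow> (real^4) set) \<Rightarrow> real^4 \<Rightarrow> nat \<Rightarrow> nat \<Rightarrow> nat \<Rightarrow>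
     real \<times> real \<times> real \<times> real \<times> real \<times> real" where
  "T1_args P x i j k =
     (cosh (shortest_arc_length (P i) (P j)), exp (signed_dist_plane x (P k)),
      cosh (shortest_arc_length (P i) (P k)), cosh (shortest_arc_length (P j) (P k)),
      exp (signed_dist_plane x (P i)), exp (signed_dist_plane x (P j)))"

definition T1_domain :: "(real \<times> real \<times> real \<times> real \<times> real \<times> real) set" where
  "T1_domain =
     {T1_args P x i j k | P H x i j k. admissible P H x \<and> opposite_indices i j k}"

end

theory Submission
  imports Defs
begin

text \<open>
  Let \<open>n\<^sub>i\<close> be the unit normal of \<open>P\<^sub>i\<close> pointing into \<open>H\<^sub>i\<close>. The hypotheses say that
  \<open>lor n\<^sub>i n\<^sub>j = - cosh \<ell>\<^sub>i\<^sub>j < -1\<close> and \<open>lor n\<^sub>i x = exp h\<^sub>i\<^sub>4 > 0\<close>, so all distances are entries of the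
  Gram matrix of \<open>n\<^sub>1, n\<^sub>2, n\<^sub>3, x\<close>.

  Write the two geodesics as \<open>exp S A + exp (-S) A'\<close> and \<open>exp T B + exp (-T) B'\<close> with light-like
  \<open>A, A', B, B'\<close>. Then the cosine of the distance is a combination of \<open>exp (S + T)\<close>, \<open>exp (S - T)\<close>,
  \<open>exp (T - S)\<close>, \<open>exp (- S - T)\<close> with positive coefficients \<open>p, q, p', q'\<close>. In the variables
  \<open>S + T\<close> and \<open>S - T\<close> the problem decouples, and the minimum is \<open>2 sqrt (p q') + 2 sqrt (q p')\<close>. The
  coefficients are visibly increasing in \<open>a, b, c, d\<close>, and comparing them shows that the minimum is
  attained on the edges themselves.

  The edges lie in the truncated tetrahedron because their points are combinations
  \<open>e x - \<Sum> f\<^sub>l n\<^sub>l\<close> with \<open>e, f\<^sub>l \<ge> 0\<close>, on which the functional defining each truncating half-space is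
  non-negative. In the degenerate case \<open>x = \<Sum> \<xi>\<^sub>l n\<^sub>l\<close> with exactly one positive coefficient, and its
  index is the one that the diagonal separates from \<open>x\<close>.
\<close>

section \<open>The Lorentz form\<close>

text \<open>The geometric notions are given by components, closures and definite descriptions, so
  each has to be turned into a linear condition. A plane or geodesic is perpendicular to a plane
  when its linear span contains the normal, a half is the set where a linear functional is
  non-negative, and a definite description is settled by a dimension count or by a choice between
  two opposite functionals.

  The light-like vectors are scaled to pair to \<open>- 1 / 2\<close>, which makes the parameter
  arclength, and the origins are placed on planes: \<open>lor n\<close> and \<open>lor m\<close>
  take the values \<open>sinh (S + \<ell>)\<close> and \<open>- sinh S\<close> on the common
  perpendicular of \<open>n\<close> and \<open>m\<close>, and \<open>lor k\<close> takes the value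
  \<open>sinh T\<close> on the other geodesic. Hence the edges are
  \<open>- \<ell> \<le> S \<le> 0\<close> and \<open>0 \<le> T\<close>, and these three inequalities
  dictate which coefficients are compared.

  The function T1 is a closed formula, so its monotonicity is a direct comparison of the values at
  two points of the domain.\<close>

lemma lor_commute: "lor x y = lor y x"
  by (simp add: lor_def mult.commute)

lemma lor_simps [simp]:
  "lor (x + y) z = lor x z + lor y z" "lor z (x + y) = lor z x + lor z y"
  "lor (x - y) z = lor x z - lor y z" "lor z (x - y) = lor z x - lor z y"
  "lor (c *\<^sub>R x) z = c * lor x z" "lor z (c *\<^sub>R x) = c * lor z x"
  "lor (- x) z = - lor x z" "lor z (- x) = - lor z x"
  "lor 0 z = 0" "lor z 0 = 0"
  by (simp_all add: lor_def algebra_simps)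

text \<open>Turns Lorentz orthogonality into Euclidean orthogonality, for which the dimension
  formula of complements is available.\<close>

definition flip :: "real^4 \<Rightarrow> real^4" where
  "flip x = (\<chi> i. if i = 1 then - (x$1) else x$i)"

lemma lor_eq_inner: "lor x y = flip x \<bullet> y"
  by (simp add: lor_def flip_def inner_vec_def sum_4)

lemma flip_flip [simp]: "flip (flip x) = x"
  by (simp add: flip_def vec_eq_iff)

lemma linear_flip: "linear flip"
  by (rule linearI) (simp_all add: flip_def vec_eq_iff)

lemma linear_lor: "linear (lor x)"
  by (rule linearI) simp_all

lemma continuous_on_lor [continuous_intros]:
  "continuous_on S f \<Longrightarrow> continuous_on S (\<lambda>v. lor x (f v))"
  unfolding lor_def by (intro continuous_intros)

lemma subspace_perp: "subspace {v \<in> V. lor n v = 0}" if "subspace V"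
  using that by (auto simp: subspace_def)

lemma vec4_eq_0_iff: "(x::real^4) = 0 \<longleftrightarrow> x$1 = 0 \<and> x$2 = 0 \<and> x$3 = 0 \<and> x$4 = 0"
  by (simp add: vec_eq_iff forall_4)

text \<open>Lagrange's identity: the two sides differ by the sum of the squared 2 by 2
  minors.\<close>

lemma cauchy_schwarz_3:
  fixes a b c :: real
  shows "(a * x + b * y + c * z)\<^sup>2 \<le> (a\<^sup>2 + b\<^sup>2 + c\<^sup>2) * (x\<^sup>2 + y\<^sup>2 + z\<^sup>2)"
proof -
  have "(a\<^sup>2 + b\<^sup>2 + c\<^sup>2) * (x\<^sup>2 + y\<^sup>2 + z\<^sup>2) - (a * x + b * y + c * z)\<^sup>2 =
    (a * y - b * x)\<^sup>2 + (a * z - c * x)\<^sup>2 + (b * z - c * y)\<^sup>2"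
    by (simp add: power2_eq_square algebra_simps)
  then show ?thesis
    by (smt (verit) zero_le_power2)
qed

lemma lor_self: "lor x x = - (x$1)\<^sup>2 + ((x$2)\<^sup>2 + (x$3)\<^sup>2 + (x$4)\<^sup>2)"
  by (simp add: lor_def power2_eq_square)

text \<open>The first entry of \<open>p\<close> dominates its spatial part, and orthogonality
  equates \<open>p$1 * z$1\<close> with the spatial inner product. Euclidean Cauchy-Schwarz then
  makes the spatial part of \<open>z\<close> dominate \<open>z$1\<close>. Light-like
  \<open>p\<close> is included for the estimates on horospheres.\<close>

lemma lor_orth_causal_nonneg:
  assumes "lor p p \<le> 0" "p \<noteq> 0" "lor p z = 0"
  shows "lor z z \<ge> 0"
proof -
  define P where "P = (p$2)\<^sup>2 + (p$3)\<^sup>2 + (p$4)\<^sup>2"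
  define Z where "Z = (z$2)\<^sup>2 + (z$3)\<^sup>2 + (z$4)\<^sup>2"
  have P: "P \<le> (p$1)\<^sup>2" "P \<ge> 0" and Z: "Z \<ge> 0"
    using assms(1) by (auto simp: P_def Z_def lor_self)
  have p1: "(p$1)\<^sup>2 > 0"
  proof (rule ccontr)
    assume "\<not> ?thesis"
    with P have "P = 0" "p$1 = 0" by auto
    then have "p = 0"
      by (auto simp: P_def vec4_eq_0_iff add_nonneg_eq_0_iff)
    with assms(2) show False by simp
  qed
  have "p$1 * z$1 = p$2 * z$2 + p$3 * z$3 + p$4 * z$4"
    using assms(3) by (simp add: lor_def)
  then have "(p$1)\<^sup>2 * (z$1)\<^sup>2 = (p$2 * z$2 + p$3 * z$3 + p$4 * z$4)\<^sup>2"
    by (metis power_mult_distrib)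
  also have "\<dots> \<le> P * Z"
    unfolding P_def Z_def by (rule cauchy_schwarz_3)
  also have "\<dots> \<le> (p$1)\<^sup>2 * Z"
    using P Z by (simp add: mult_right_mono)
  finally have "(z$1)\<^sup>2 \<le> Z"
    using p1 by simp
  then show ?thesis
    by (simp add: lor_self Z_def)
qed

text \<open>The previous lemma with the roles exchanged: a nonzero causal \<open>z\<close>
  orthogonal to \<open>p\<close> would force \<open>lor p p \<ge> 0\<close>.\<close>

lemma lor_orth_timelike_pos:
  assumes "lor p p < 0" "lor p z = 0" "z \<noteq> 0"
  shows "lor z z > 0"
proof (rule ccontr)
  assume "\<not> ?thesis"
  then have "lor p p \<ge> 0"
    using lor_orth_causal_nonneg[of z p] assms by (simp add: lor_commute)
  with assms show False by simp
qed

lemma lor_causal_nonpos: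
  assumes "lor u u \<le> 0" "lor v v \<le> 0" "u$1 \<ge> 0" "v$1 \<ge> 0"
  shows "lor u v \<le> 0"
proof -
  have "(u$2 * v$2 + u$3 * v$3 + u$4 * v$4)\<^sup>2
      \<le> ((u$2)\<^sup>2 + (u$3)\<^sup>2 + (u$4)\<^sup>2) * ((v$2)\<^sup>2 + (v$3)\<^sup>2 + (v$4)\<^sup>2)"
    by (rule cauchy_schwarz_3)
  also have "\<dots> \<le> (u$1)\<^sup>2 * (v$1)\<^sup>2"
    using assms(1,2) by (intro mult_mono) (auto simp: lor_self)
  finally have "u$2 * v$2 + u$3 * v$3 + u$4 * v$4 \<le> u$1 * v$1"
    using assms(3,4) by (simp add: power_mult_distrib[symmetric] abs_le_square_iff[symmetric])
  then show ?thesis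
    by (simp add: lor_def)
qed

lemma lor_causal_neg:
  assumes "lor u u \<le> 0" "lor v v < 0" "u$1 > 0" "v$1 > 0"
  shows "lor u v < 0"
proof -
  have "u \<noteq> 0" using assms(3) by auto
  then have "lor v u \<noteq> 0"
    using lor_orth_timelike_pos[of v u] assms by force
  moreover have "lor u v \<le> 0"
    by (rule lor_causal_nonpos) (use assms in auto)
  ultimately show ?thesis
    by (simp add: lor_commute)
qed

text \<open>Decides between the two sheets of the cone by a pairing, so that later memberships in
  \<open>hyp3\<close> and \<open>pos_light\<close> are checked without coordinates.\<close>

lemma causal_positiveI:
  assumes "lor v v \<le> 0" "lor v x < 0" "lor x x \<le> 0" "x$1 > 0"
  shows "v$1 > 0"
proof (rule ccontr)
  assume "\<not> ?thesis"
  then have "(- v)$1 \<ge> 0"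
    by simp
  then have "lor (- v) x \<le> 0"
    by - (rule lor_causal_nonpos, use assms in auto)
  with assms show False by simp
qed

lemma pos_light_iff: "x \<in> pos_light \<longleftrightarrow> lor x x = 0 \<and> x$1 > 0"
  by (auto simp: pos_light_def light_like_def)

lemma lor_hyp3_light: "u \<in> hyp3 \<Longrightarrow> x \<in> pos_light \<Longrightarrow> lor u x < 0"
  using lor_causal_neg[of x u] by (simp add: hyp3_def pos_light_iff lor_commute)

text \<open>The part of \<open>v\<close> orthogonal to \<open>u\<close> is
  \<open>v + lor u v *\<^sub>R u\<close>, and its norm \<open>(lor u v)\<^sup>2 - 1\<close> cannot
  be negative.\<close>

lemma lor_hyp3_le:
  assumes "u \<in> hyp3" "v \<in> hyp3"
  shows "lor u v \<le> -1"
proof -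
  have "lor (v + lor u v *\<^sub>R u) (v + lor u v *\<^sub>R u) \<ge> 0"
    by (rule lor_orth_causal_nonneg[of u]) (use assms in \<open>auto simp: hyp3_def\<close>)
  then have "1 \<le> (lor u v)\<^sup>2"
    using assms by (simp add: hyp3_def lor_commute power2_eq_square)
  moreover have "lor u v < 0"
    by (rule lor_causal_neg) (use assms in \<open>auto simp: hyp3_def\<close>)
  ultimately show ?thesis
    using power2_le_imp_le[of 1 "- lor u v"] by simp
qed

lemma lor_hyp3_eq:
  assumes "u \<in> hyp3" "v \<in> hyp3" "lor u v = -1"
  shows "u = v"
proof (rule ccontr)
  assume "u \<noteq> v"
  moreover have "lor u u < 0" "lor u (v - u) = 0"
    using assms by (auto simp: hyp3_def)
  ultimately have "lor (v - u) (v - u) > 0"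
    using lor_orth_timelike_pos[of u "v - u"] by simp
  with assms show False
    by (simp add: hyp3_def lor_commute[of v u])
qed

lemma hyp3I_light:
  assumes "lor v v = -1" "lor v x < 0" "x \<in> pos_light"
  shows "v \<in> hyp3"
  using causal_positiveI[of v x] assms by (simp add: hyp3_def pos_light_iff)

lemma hyp3I_hyp3:
  assumes "lor v v = -1" "lor v x < 0" "x \<in> hyp3"
  shows "v \<in> hyp3"
  using causal_positiveI[of v x] assms by (simp add: hyp3_def)

lemma normalize_timelike:
  assumes "lor v v < 0" "v$1 > 0"
  shows "(1 / sqrt (- lor v v)) *\<^sub>R v \<in> hyp3"
  using assms by (simp add: hyp3_def real_sqrt_mult[symmetric] field_simps)

lemma timelike_multiple_in_hyp3:
  assumes "lor v v < 0"
  obtains c where "c \<noteq> 0" "c *\<^sub>R v \<in> hyp3"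
proof -
  have "v$1 \<noteq> 0"
    using assms by (auto simp: lor_self) (smt (verit) zero_le_power2)
  then consider "v$1 > 0" | "(- v)$1 > 0" by fastforce
  then show thesis
  proof cases
    case 1
    then show thesis
      using that[OF _ normalize_timelike[of v]] assms by auto
  next
    case 2
    then show thesis
      using that[of "- (1 / sqrt (- lor v v))"] normalize_timelike[of "- v"] assms by auto
  qed
qed

lemma closed_hyp3: "closed hyp3"
proof -
  \<comment> \<open>The strict condition on the first entry may be relaxed to a closed one, since
    \<open>lor x x = -1\<close> excludes a vanishing first entry.\<close>
  have eq: "hyp3 = {x. 0 \<le> x$1} \<inter> {x. lor x x = -1}"
    by (auto simp: hyp3_def lor_self order.order_iff_strict) (smt (verit) zero_le_power2)
  show ?thesis
    unfolding eq lor_def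
    by (intro closed_Int closed_Collect_le closed_Collect_eq continuous_intros)
qed

text \<open>The form is positive definite on the orthogonal complement of a time-like vector, so the
  usual proof of Cauchy-Schwarz applies there.\<close>

lemma lor_spacelike_cauchy_schwarz:
  assumes "lor p p < 0" "lor p y = 0" "lor p z = 0"
  shows "(lor y z)\<^sup>2 \<le> lor y y * lor z z"
proof (cases "z = 0")
  case False
  then have pos: "lor z z > 0"
    using assms lor_orth_timelike_pos by blast
  let ?w = "lor z z *\<^sub>R y - lor y z *\<^sub>R z"
  have "0 \<le> lor ?w ?w"
    by (rule lor_orth_causal_nonneg[of p]) (use assms False in auto)
  also have "\<dots> = lor z z * (lor y y * lor z z - (lor y z)\<^sup>2)"
    by (simp add: lor_commute power2_eq_square algebra_simps)
  finally show ?thesis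
    using pos by (simp add: zero_le_mult_iff)
qed simp

lemma lor_orth_unit_timelike:
  assumes "lor n n = 1" "lor p p < 0"
  shows "lor (p - lor n p *\<^sub>R n) (p - lor n p *\<^sub>R n) < 0" "lor n (p - lor n p *\<^sub>R n) = 0"
  using assms by (simp_all add: lor_commute algebra_simps) (smt (verit) zero_le_square)

section \<open>Subspaces and their traces on the hyperboloid\<close>

text \<open>Being positive and time-like is an open condition: for \<open>w\<close> in
  \<open>V\<close> and a small \<open>e > 0\<close> the vector \<open>p + e *\<^sub>R w\<close> is
  still a multiple of a point of \<open>V \<inter> hyp3\<close>, and \<open>w\<close> is recovered
  from it and \<open>p\<close>.\<close>

lemma span_hyp3:
  assumes V: "subspace V" "v \<in> V" "lor v v < 0"
  shows "span (V \<inter> hyp3) = V"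
proof
  show "span (V \<inter> hyp3) \<subseteq> V"
    using V(1) by (intro span_minimal) auto
  show "V \<subseteq> span (V \<inter> hyp3)"
  proof
    fix w assume "w \<in> V"
    obtain c where c: "c \<noteq> 0" "c *\<^sub>R v \<in> hyp3"
      using timelike_multiple_in_hyp3[OF V(3)] by blast
    define p where "p = c *\<^sub>R v"
    have p: "p \<in> V \<inter> hyp3"
      using V c by (auto simp: p_def subspace_scale)
    have "((\<lambda>e. lor (p + e *\<^sub>R w) (p + e *\<^sub>R w)) \<longlongrightarrow> lor (p + 0 *\<^sub>R w) (p + 0 *\<^sub>R w)) (at_right 0)"
      "((\<lambda>e. (p + e *\<^sub>R w)$1) \<longlongrightarrow> (p + 0 *\<^sub>R w)$1) (at_right 0)"
      unfolding lor_def by (intro tendsto_intros)+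
    then have "\<forall>\<^sub>F e in at_right 0. lor (p + e *\<^sub>R w) (p + e *\<^sub>R w) < 0"
      "\<forall>\<^sub>F e in at_right 0. (p + e *\<^sub>R w)$1 > 0"
      using p by (auto simp: hyp3_def order_tendsto_iff)
    moreover have "\<forall>\<^sub>F e in at_right 0. e > (0::real)"
      by (simp add: eventually_at_right_less)
    ultimately have "\<forall>\<^sub>F e in at_right 0. lor (p + e *\<^sub>R w) (p + e *\<^sub>R w) < 0
        \<and> (p + e *\<^sub>R w)$1 > 0 \<and> e > 0"
      by eventually_elim auto
    then obtain e where e: "e > 0" "lor (p + e *\<^sub>R w) (p + e *\<^sub>R w) < 0" "(p + e *\<^sub>R w)$1 > 0"
      by (auto dest!: eventually_happens)
    define q where "q = p + e *\<^sub>R w"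
    have "q \<in> V"
      using p V \<open>w \<in> V\<close> by (auto simp: q_def subspace_add subspace_scale)
    then have "(1 / sqrt (- lor q q)) *\<^sub>R q \<in> V \<inter> hyp3"
      using normalize_timelike[of q] e V by (auto simp: q_def[symmetric] subspace_scale)
    then have "sqrt (- lor q q) *\<^sub>R (1 / sqrt (- lor q q)) *\<^sub>R q \<in> span (V \<inter> hyp3)"
      by (intro span_scale span_base)
    then have "q \<in> span (V \<inter> hyp3)"
      using e by (simp add: q_def[symmetric])
    then have "(1 / e) *\<^sub>R (q - p) \<in> span (V \<inter> hyp3)"
      using p by (intro span_scale span_diff) (auto intro: span_base)
    then show "w \<in> span (V \<inter> hyp3)"
      using e by (simp add: q_def)
  qed
qed

text \<open>The Lorentz complement of \<open>U\<close> has dimension \<open>4 - dim U\<close>, too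
  large to meet \<open>V\<close> only in 0. A nonzero common vector is orthogonal to the time-like
  \<open>p\<close>, hence space-like, and can be normalized. The ambient \<open>V\<close> varies:
  the whole space for planes, the span of a plane for geodesics in it, the span of a geodesic for
  its points.\<close>

lemma codim1_normal:
  assumes U: "subspace U" "p \<in> U" "lor p p < 0" and V: "subspace V" "U \<subseteq> V"
    and dim: "dim V = Suc (dim U)"
  obtains n where "n \<in> V" "lor n n = 1" "U = {v \<in> V. lor n v = 0}"
proof -
  \<comment> \<open>The Lorentz complement of \<open>U\<close>, written as a Euclidean complement so
    that its dimension is known.\<close>
  let ?W = "{y \<in> UNIV. \<forall>x\<in>flip ` U. orthogonal x y}"
  have W: "?W = {y. \<forall>u\<in>U. lor u y = 0}"
    by (auto simp: orthogonal_def lor_eq_inner)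
  have sW: "subspace ?W"
    unfolding W by (auto simp: subspace_def)
  have "inj flip"
    by (metis flip_flip injI)
  then have "dim (flip ` U) = dim U"
    by (rule dim_image_eq[OF linear_flip inj_on_subset]) simp
  then have dW: "dim ?W + dim U = 4"
    using dim_subspace_orthogonal_to_vectors[of "flip ` U" UNIV] U(1)
      linear_subspace_image[OF linear_flip] by simp
  have "dim {x + y |x y. x \<in> V \<and> y \<in> ?W} + dim (V \<inter> ?W) = dim V + dim ?W"
    by (rule dim_sums_Int[OF V(1) sW])
  moreover have "dim {x + y |x y. x \<in> V \<and> y \<in> ?W} \<le> 4"
    using dim_subset_UNIV[of "{x + y |x y. x \<in> V \<and> y \<in> ?W}"] by simp
  ultimately have "dim (V \<inter> ?W) \<noteq> 0"
    using dW dim by linarith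
  then have "\<not> V \<inter> ?W \<subseteq> {0}"
    by (simp only: dim_eq_0 not_False_eq_True)
  then obtain z where z: "z \<in> V" "z \<noteq> 0" "\<forall>u\<in>U. lor u z = 0"
    unfolding W by blast
  then have zz: "lor z z > 0"
    using U lor_orth_timelike_pos by blast
  define n where "n = (1 / sqrt (lor z z)) *\<^sub>R z"
  have n: "n \<in> V" "lor n n = 1" "\<forall>u\<in>U. lor n u = 0"
    using z zz V by (auto simp: n_def subspace_scale lor_commute real_sqrt_mult[symmetric] field_simps)
  let ?N = "{v \<in> V. lor n v = 0}"
  have sub: "U \<subseteq> ?N" and N: "subspace ?N"
    using n V by (auto intro: subspace_perp)
  have "n \<notin> ?N"
    using n by simp
  then have "?N \<noteq> V"
    using n(1) by blast
  then have "dim ?N < dim V"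
    using subspace_dim_equal[OF N V(1)] by (metis (no_types, lifting) mem_Collect_eq not_le subsetI)
  then have "U = ?N"
    using subspace_dim_equal[OF U(1) N sub] dim by simp
  then show thesis
    using that n by blast
qed

section \<open>Half-spaces and half-planes\<close>

text \<open>The ambient subspace is a parameter so that one theory covers both half-spaces, with
  \<open>V = UNIV\<close>, and half-planes, with \<open>V\<close> the span of a plane.\<close>

definition wall :: "(real^4) set \<Rightarrow> real^4 \<Rightarrow> (real^4) set" where
  "wall V n = {v \<in> V \<inter> hyp3. lor n v = 0}"

definition half :: "(real^4) set \<Rightarrow> real^4 \<Rightarrow> (real^4) set" where
  "half V n = {v \<in> V \<inter> hyp3. lor n v \<ge> 0}"

text \<open>A continuous function without zeros on a connected set has constant sign there. The
  lemma serves for traces on the hyperboloid as well as for the linear spaces that define ideal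
  boundaries of halves.\<close>

lemma components_sign:
  fixes f :: "'a::topological_space \<Rightarrow> real"
  assumes cont: "continuous_on S f"
    and pos: "connected {v \<in> S. f v > 0}" "{v \<in> S. f v > 0} \<noteq> {}"
    and neg: "connected {v \<in> S. f v < 0}" "{v \<in> S. f v < 0} \<noteq> {}"
  shows "components (S - {v \<in> S. f v = 0}) = {{v \<in> S. f v > 0}, {v \<in> S. f v < 0}}"
proof -
  let ?T = "S - {v \<in> S. f v = 0}"
  have same_sign: "f x > 0 \<longleftrightarrow> f y > 0" if D: "connected D" "D \<subseteq> ?T" "x \<in> D" "y \<in> D" for D x y
  proof -
    have "connected (f ` D)"
      using D cont by (intro connected_continuous_image) (auto intro: continuous_on_subset)
    then have "f x \<le> 0 \<Longrightarrow> 0 \<le> f y \<Longrightarrow> 0 \<in> f ` D" "f y \<le> 0 \<Longrightarrow> 0 \<le> f x \<Longrightarrow> 0 \<in> f ` D"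
      using D unfolding connected_iff_interval by blast+
    moreover have "0 \<notin> f ` D"
      using D by auto
    ultimately show ?thesis
      by linarith
  qed
  have in_T: "x \<in> ?T \<longleftrightarrow> x \<in> S \<and> (f x > 0 \<or> f x < 0)" for x
    by auto
  have 1: "{v \<in> S. f v > 0} \<in> components ?T"
    unfolding in_components_maximal
  proof (intro conjI allI impI)
    fix D assume "D \<noteq> {} \<and> {v \<in> S. f v > 0} \<subseteq> D \<and> D \<subseteq> ?T \<and> connected D"
    then show "D = {v \<in> S. f v > 0}"
      using same_sign pos(2) by blast
  qed (use pos in auto)
  have 2: "{v \<in> S. f v < 0} \<in> components ?T"
    unfolding in_components_maximal
  proof (intro conjI allI impI)
    fix D assume D: "D \<noteq> {} \<and> {v \<in> S. f v < 0} \<subseteq> D \<and> D \<subseteq> ?T \<and> connected D"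
    obtain y where y: "y \<in> S" "f y < 0"
      using neg(2) by auto
    have "f x < 0" if "x \<in> D" for x
      using same_sign[of D x y] that D y in_T[of x] by (smt (verit) mem_Collect_eq subset_iff)
    then show "D = {v \<in> S. f v < 0}"
      using D by auto
  qed (use neg in auto)
  have "C = {v \<in> S. f v > 0} \<or> C = {v \<in> S. f v < 0}" if C: "C \<in> components ?T" for C
  proof -
    obtain x where "x \<in> C" "x \<in> ?T"
      using in_components_nonempty[OF C] in_components_subset[OF C] by blast
    then have "C \<inter> {v \<in> S. f v > 0} \<noteq> {} \<or> C \<inter> {v \<in> S. f v < 0} \<noteq> {}"
      using in_T by blast
    then show ?thesis
      using components_eq[OF C 1] components_eq[OF C 2] by blast
  qed
  with 1 2 show ?thesis
    by blast
qed

text \<open>The set is the radial projection of a cone of positive time-like vectors. That cone is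
  convex because two of its vectors pair negatively.\<close>

lemma connected_half_interior:
  assumes "subspace V"
  shows "connected {v \<in> V \<inter> hyp3. lor n v > 0}"
proof -
  define C where "C = {v \<in> V. v$1 > 0 \<and> lor v v < 0 \<and> lor n v > 0}"
  define h where "h v = (1 / sqrt (- lor v v)) *\<^sub>R v" for v
  have "convex C"
  proof (rule convexI)
    fix u v and a b :: real
    assume uv: "u \<in> C" "v \<in> C" and ab: "a \<ge> 0" "b \<ge> 0" "a + b = 1"
    show "a *\<^sub>R u + b *\<^sub>R v \<in> C"
    proof (cases "a = 0 \<or> b = 0")
      case True
      with uv ab show ?thesis by auto
    next
      case False
      with ab have pos: "a > 0" "b > 0" by auto
      have neg: "lor u v < 0"
        by (rule lor_causal_neg) (use uv in \<open>auto simp: C_def\<close>)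
      have "a\<^sup>2 * lor u u + 2 * (a * b) * lor u v + b\<^sup>2 * lor v v < 0"
        using pos uv neg by (intro add_neg_neg mult_pos_neg) (auto simp: C_def)
      moreover have "lor (a *\<^sub>R u + b *\<^sub>R v) (a *\<^sub>R u + b *\<^sub>R v)
          = a\<^sup>2 * lor u u + 2 * (a * b) * lor u v + b\<^sup>2 * lor v v"
        by (simp add: lor_commute[of v u] power2_eq_square algebra_simps)
      ultimately show ?thesis
        using uv pos assms by (auto simp: C_def subspace_add subspace_scale add_pos_pos)
    qed
  qed
  moreover have "continuous_on C h"
    unfolding h_def lor_def
    by (intro continuous_intros) (auto simp: C_def lor_def)
  moreover have "h ` C = {v \<in> V \<inter> hyp3. lor n v > 0}"
  proof (intro equalityI subsetI)
    fix v assume "v \<in> h ` C"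
    then show "v \<in> {v \<in> V \<inter> hyp3. lor n v > 0}"
      using normalize_timelike assms by (auto simp: C_def h_def subspace_scale)
  next
    fix v assume v: "v \<in> {v \<in> V \<inter> hyp3. lor n v > 0}"
    then have "h v = v" "v \<in> C"
      by (auto simp: h_def hyp3_def C_def)
    then show "v \<in> h ` C"
      by force
  qed
  ultimately show ?thesis
    by (metis connected_continuous_image convex_connected)
qed

lemma hyp3_point_on_wall:
  assumes V: "subspace V" "V \<inter> hyp3 \<noteq> {}" "n \<in> V" and n: "lor n n = 1"
  obtains p where "p \<in> wall V n"
proof -
  obtain q where q: "q \<in> V" "q \<in> hyp3"
    using V by auto
  let ?p = "q - lor n q *\<^sub>R n"
  have "lor ?p ?p < 0" "lor n ?p = 0"
    using lor_orth_unit_timelike[OF n, of q] q by (auto simp: hyp3_def)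
  moreover obtain c where "c *\<^sub>R ?p \<in> hyp3"
    using timelike_multiple_in_hyp3 calculation by blast
  moreover have "?p \<in> V"
    using V q by (simp add: subspace_diff subspace_scale)
  ultimately have "c *\<^sub>R ?p \<in> wall V n"
    using V by (simp add: wall_def subspace_scale)
  then show thesis
    using that by blast
qed

text \<open>The unit-speed geodesic leaving the wall at \<open>p\<close> in the normal direction. It
  shows that both sides are inhabited and that the wall lies in their closures.\<close>

lemma geodesic_from_wall:
  assumes V: "subspace V" "n \<in> V" and n: "lor n n = 1" and p: "p \<in> wall V n"
  shows "cosh e *\<^sub>R p + sinh e *\<^sub>R n \<in> V \<inter> hyp3"
    "lor n (cosh e *\<^sub>R p + sinh e *\<^sub>R n) = sinh e"
proof -
  have p': "p \<in> V" "p \<in> hyp3" "lor n p = 0" "lor p p = -1" "lor p n = 0"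
    using p by (auto simp: wall_def hyp3_def lor_commute)
  have "lor (cosh e *\<^sub>R p + sinh e *\<^sub>R n) (cosh e *\<^sub>R p + sinh e *\<^sub>R n) = -1"
    using p' n cosh_square_eq[of e] by (simp add: power2_eq_square)
  moreover have "lor (cosh e *\<^sub>R p + sinh e *\<^sub>R n) p < 0"
    using p' by simp
  ultimately have "cosh e *\<^sub>R p + sinh e *\<^sub>R n \<in> hyp3"
    using p'(2) by (rule hyp3I_hyp3)
  then show "cosh e *\<^sub>R p + sinh e *\<^sub>R n \<in> V \<inter> hyp3"
    using p'(1) V by (simp add: subspace_add subspace_scale)
  show "lor n (cosh e *\<^sub>R p + sinh e *\<^sub>R n) = sinh e"
    using p' n by simp
qed

lemma half_interior_nonempty:
  assumes "subspace V" "V \<inter> hyp3 \<noteq> {}" "n \<in> V" "lor n n = 1"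
  shows "{v \<in> V \<inter> hyp3. lor n v > 0} \<noteq> {}" "{v \<in> V \<inter> hyp3. lor n v < 0} \<noteq> {}"
proof -
  obtain p where p: "p \<in> wall V n"
    using hyp3_point_on_wall assms by blast
  show "{v \<in> V \<inter> hyp3. lor n v > 0} \<noteq> {}" "{v \<in> V \<inter> hyp3. lor n v < 0} \<noteq> {}"
    using geodesic_from_wall[OF assms(1,3,4) p, of 1] geodesic_from_wall[OF assms(1,3,4) p, of "-1"]
    by fastforce+
qed

lemma closed_half: "subspace V \<Longrightarrow> closed (half V n)"
proof -
  assume "subspace V"
  moreover have "half V n = V \<inter> (hyp3 \<inter> {v. 0 \<le> lor n v})"
    by (auto simp: half_def)
  ultimately show ?thesis
    by (simp only:) (intro closed_Int closed_subspace closed_hyp3 closed_Collect_le continuous_intros)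
qed

lemma closure_half_interior:
  assumes V: "subspace V" "n \<in> V" and n: "lor n n = 1"
  shows "closure {v \<in> V \<inter> hyp3. lor n v > 0} = half V n"
proof
  show "closure {v \<in> V \<inter> hyp3. lor n v > 0} \<subseteq> half V n"
    using V by (intro closure_minimal closed_half) (auto simp: half_def)
  show "half V n \<subseteq> closure {v \<in> V \<inter> hyp3. lor n v > 0}"
  proof
    fix v assume v: "v \<in> half V n"
    show "v \<in> closure {v \<in> V \<inter> hyp3. lor n v > 0}"
    proof (cases "lor n v = 0")
      case False
      with v show ?thesis
        by (intro subsetD[OF closure_subset]) (auto simp: half_def)
    next
      case True
      with v have w: "v \<in> wall V n"
        by (auto simp: half_def wall_def)
      \<comment> \<open>A point of the wall is approached from the positive side along the
        perpendicular geodesic through it.\<close>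
      have "((\<lambda>e. cosh e *\<^sub>R v + sinh e *\<^sub>R n) \<longlongrightarrow> cosh 0 *\<^sub>R v + sinh 0 *\<^sub>R n) (at_right (0::real))"
        by (intro tendsto_intros)
      then have "((\<lambda>e. cosh e *\<^sub>R v + sinh e *\<^sub>R n) \<longlongrightarrow> v) (at_right (0::real))"
        by simp
      moreover have "\<forall>\<^sub>F e in at_right (0::real).
          cosh e *\<^sub>R v + sinh e *\<^sub>R n \<in> closure {v \<in> V \<inter> hyp3. lor n v > 0}"
        using eventually_at_right_less[of "0::real"]
      proof eventually_elim
        case (elim e)
        then show ?case
          using geodesic_from_wall[OF V n w, of e]
          by (intro subsetD[OF closure_subset]) auto
      qed
      ultimately show ?thesis
        by (intro Lim_in_closed_set[where F = "at_right (0::real)"]) auto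
    qed
  qed
qed

lemma wall_minus [simp]: "wall V (- n) = wall V n"
  by (simp add: wall_def)

lemma half_of_iff:
  assumes V: "subspace V" "V \<inter> hyp3 \<noteq> {}" "n \<in> V" and n: "lor n n = 1"
  shows "half_of (V \<inter> hyp3) (wall V n) K \<longleftrightarrow> K = half V n \<or> K = half V (- n)"
proof -
  let ?S = "V \<inter> hyp3"
  have neg: "{v \<in> ?S. lor n v < 0} = {v \<in> ?S. lor (- n) v > 0}"
    by auto
  have "components (?S - {v \<in> ?S. lor n v = 0}) = {{v \<in> ?S. lor n v > 0}, {v \<in> ?S. lor n v < 0}}"
  proof (rule components_sign)
    show "connected {v \<in> ?S. lor n v < 0}" "connected {v \<in> ?S. lor n v > 0}"
      unfolding neg using V by (auto simp only: connected_half_interior)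
  qed (use half_interior_nonempty[OF assms] in \<open>auto intro: continuous_intros\<close>)
  moreover have "closure {v \<in> ?S. lor n v < 0} = half V (- n)"
    unfolding neg using V n by (intro closure_half_interior) (auto simp: subspace_neg)
  moreover have "closure {v \<in> ?S. lor n v > 0} = half V n"
    using V n by (intro closure_half_interior) auto
  ultimately show ?thesis
    by (auto simp: half_of_def wall_def)
qed

lemma span_wall:
  assumes V: "subspace V" "V \<inter> hyp3 \<noteq> {}" "n \<in> V" and n: "lor n n = 1"
  shows "span (wall V n) = {v \<in> V. lor n v = 0}"
proof -
  obtain p where p: "p \<in> wall V n"
    using hyp3_point_on_wall[OF assms] by blast
  have "span ({v \<in> V. lor n v = 0} \<inter> hyp3) = {v \<in> V. lor n v = 0}"
    by (rule span_hyp3[where v = p])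
      (use p in \<open>auto simp: subspace_perp V wall_def hyp3_def\<close>)
  moreover have "{v \<in> V. lor n v = 0} \<inter> hyp3 = wall V n"
    by (auto simp: wall_def)
  ultimately show ?thesis
    by simp
qed

text \<open>The components are now those of the linear space minus a hyperplane, that is, two open
  linear half-spaces. The interior of the half is nonempty and positive, so it selects the positive
  one.\<close>

lemma half_ideal_boundary_half:
  assumes V: "subspace V" "V \<inter> hyp3 \<noteq> {}" "n \<in> V" and n: "lor n n = 1"
  shows "half_ideal_boundary (V \<inter> hyp3) (wall V n) (half V n) = {x \<in> pos_light \<inter> V. lor n x \<ge> 0}"
proof -
  let ?P = "{v \<in> V. lor n v > 0}" and ?N = "{v \<in> V. lor n v < 0}"
  obtain q where q: "q \<in> V" "q \<in> hyp3"
    using V by blast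
  then have span: "span (V \<inter> hyp3) = V"
    using span_hyp3[OF V(1), of q] by (simp add: hyp3_def)
  have comps: "components (V - {v \<in> V. lor n v = 0}) = {?P, ?N}"
  proof (rule components_sign)
    have P: "?P = V \<inter> lor n -` {0<..}" and N: "?N = V \<inter> lor n -` {..<0}"
      by auto
    show "connected ?P" "connected ?N"
      unfolding P N
      by (intro convex_connected convex_Int subspace_imp_convex[OF V(1)] convex_linear_vimage
          linear_lor convex_real_interval)+
    show "?P \<noteq> {}"
      using V n by (auto intro!: exI[of _ n])
    show "?N \<noteq> {}"
      using V n by (auto intro!: exI[of _ "- n"] simp: subspace_neg)
  qed (auto intro: continuous_intros)
  have diff: "half V n - wall V n = {v \<in> V \<inter> hyp3. lor n v > 0}"
    by (auto simp: half_def wall_def)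
  have sub: "{v \<in> V \<inter> hyp3. lor n v > 0} \<subseteq> ?P"
    by auto
  have not_sub: "\<not> {v \<in> V \<inter> hyp3. lor n v > 0} \<subseteq> ?N"
    using half_interior_nonempty[OF assms] by fastforce
  have clo: "closure ?P = {v \<in> V. lor n v \<ge> 0}"
  proof
    have "{v \<in> V. lor n v \<ge> 0} = V \<inter> {v. 0 \<le> lor n v}"
      by auto
    then have "closed {v \<in> V. lor n v \<ge> 0}"
      by (simp only:) (intro closed_Int closed_subspace[OF V(1)] closed_Collect_le continuous_intros)
    then show "closure ?P \<subseteq> {v \<in> V. lor n v \<ge> 0}"
      by (intro closure_minimal) auto
    show "{v \<in> V. lor n v \<ge> 0} \<subseteq> closure ?P"
    proof
      fix v assume v: "v \<in> {v \<in> V. lor n v \<ge> 0}"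
      \<comment> \<open>Vectors on the hyperplane are limits of their translates along the
        normal.\<close>
      have "((\<lambda>e. v + e *\<^sub>R n) \<longlongrightarrow> v + 0 *\<^sub>R n) (at_right (0::real))"
        by (intro tendsto_intros)
      then have lim: "((\<lambda>e. v + e *\<^sub>R n) \<longlongrightarrow> v) (at_right (0::real))"
        by simp
      have ev: "\<forall>\<^sub>F e in at_right (0::real). v + e *\<^sub>R n \<in> closure ?P"
        using eventually_at_right_less[of "0::real"]
      proof eventually_elim
        case (elim e)
        then have "v + e *\<^sub>R n \<in> ?P"
          using v V n by (simp add: subspace_add subspace_scale)
        then show ?case
          by (rule subsetD[OF closure_subset])
      qed
      show "v \<in> closure ?P"
        by (rule Lim_in_closed_set[OF closed_closure ev trivial_limit_at_right_real lim])
    qed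
  qed
  have one_side: "(\<exists>C\<in>{A, B}. D \<subseteq> C \<and> x \<in> closure C) \<longleftrightarrow> x \<in> closure A"
    if "D \<subseteq> A" "\<not> D \<subseteq> B" for A B D :: "(real^4) set" and x
    using that by auto
  show ?thesis
    unfolding half_ideal_boundary_def span span_wall[OF assms] comps diff one_side[OF sub not_sub] clo
    by blast
qed

section \<open>Planes and perpendiculars\<close>

lemma hyp3_nonempty: "UNIV \<inter> hyp3 \<noteq> {}"
proof -
  have "axis 1 1 \<in> hyp3"
    by (simp add: hyp3_def lor_def axis_def)
  then show ?thesis by blast
qed

lemma wall_UNIV_nonempty: "lor n n = 1 \<Longrightarrow> wall UNIV n \<noteq> {}"
  using hyp3_point_on_wall[OF subspace_UNIV hyp3_nonempty UNIV_I, of n] by blast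

lemma span_wall_UNIV: "lor n n = 1 \<Longrightarrow> span (wall UNIV n) = {v. lor n v = 0}"
  using span_wall[OF subspace_UNIV hyp3_nonempty UNIV_I, of n] by simp

lemma dim3_normal:
  assumes "subspace V" "dim V = 3" "v \<in> V" "lor v v < 0"
  obtains n where "lor n n = 1" "V = {v. lor n v = 0}"
  using codim1_normal[OF assms(1,3,4) subspace_UNIV, of thesis] assms(2) by auto

lemma is_plane_imp_wall:
  assumes "is_plane P"
  obtains n where "lor n n = 1" "P = wall UNIV n"
proof -
  obtain V v where V: "subspace V" "dim V = 3" "v \<in> V" "lor v v < 0" "P = V \<inter> hyp3"
    using assms by (auto simp: is_plane_def time_like_def)
  obtain n where "lor n n = 1" "V = {v. lor n v = 0}"
    using dim3_normal[OF V(1-4)] by blast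
  with V that show thesis
    by (simp add: wall_def Int_def conj_commute)
qed

text \<open>The part \<open>z\<close> of \<open>u\<close> orthogonal to \<open>n\<close> is
  orthogonal to itself and to a time-like point of the plane, hence zero.\<close>

lemma normals_wall:
  assumes n: "lor n n = 1" and u: "u \<in> normals (wall UNIV n)"
  obtains c where "u = c *\<^sub>R n"
proof -
  obtain p where p: "p \<in> wall UNIV n"
    using wall_UNIV_nonempty[OF n] by blast
  have orth: "lor u w = 0" if "lor n w = 0" for w
  proof -
    have "w \<in> span (wall UNIV n)"
      using span_wall_UNIV[OF n] that by simp
    then show ?thesis
      by (induction rule: span_induct_alt) (use u in \<open>auto simp: normals_def\<close>)
  qed
  define z where "z = u - lor u n *\<^sub>R n"
  have nz: "lor n z = 0"
    using n by (simp add: z_def lor_commute)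
  have "lor z w = lor u w - lor u n * lor n w" for w
    by (simp add: z_def)
  then have "lor z z = 0"
    using orth nz by simp
  moreover have "lor p z = 0" "lor p p < 0"
    using p orth[of p] by (auto simp: z_def wall_def hyp3_def lor_commute)
  ultimately have "z = 0"
    using lor_orth_timelike_pos[of p z] by force
  then show thesis
    using that by (simp add: z_def)
qed

lemma timelike_imp_hyp3_nonempty:
  assumes "subspace V" "v \<in> V" "lor v v < 0"
  shows "V \<inter> hyp3 \<noteq> {}"
proof -
  obtain c where "c *\<^sub>R v \<in> hyp3"
    using timelike_multiple_in_hyp3[OF assms(3)] by metis
  moreover have "c *\<^sub>R v \<in> V"
    by (rule subspace_scale[OF assms(1,2)])
  ultimately show ?thesis
    by blast
qed

text \<open>Perpendicularity becomes membership in a subspace, which reduces existence and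
  uniqueness of truncating planes to spans and dimensions. In the backward direction a common point
  is found by working inside \<open>V\<close> with \<open>n\<close> as a normal.\<close>

lemma planes_perp_wall_iff:
  assumes V: "subspace V" "dim V = 3" "v \<in> V" "lor v v < 0" and n: "lor n n = 1"
  shows "planes_perp (V \<inter> hyp3) (wall UNIV n) \<longleftrightarrow> n \<in> V"
proof
  obtain m where m: "lor m m = 1" "V = {v. lor m v = 0}"
    using dim3_normal[OF V] by blast
  have "m \<in> normals (V \<inter> hyp3)" "n \<in> normals (wall UNIV n)"
    by (auto simp: normals_def m wall_def)
  then show "n \<in> V" if "planes_perp (V \<inter> hyp3) (wall UNIV n)"
    using that m(2) by (auto simp: planes_perp_def)
next
  assume nV: "n \<in> V"
  have ne: "V \<inter> hyp3 \<noteq> {}"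
    by (rule timelike_imp_hyp3_nonempty[OF V(1,3,4)])
  have "wall V n = (V \<inter> hyp3) \<inter> wall UNIV n"
    by (auto simp: wall_def)
  then have "(V \<inter> hyp3) \<inter> wall UNIV n \<noteq> {}"
    using hyp3_point_on_wall[OF V(1) ne nV n] by blast
  moreover have "lor a b = 0" if a: "a \<in> normals (V \<inter> hyp3)" and b: "b \<in> normals (wall UNIV n)" for a b
  proof -
    obtain c where c: "b = c *\<^sub>R n"
      using normals_wall[OF n b] by blast
    have "n \<in> span (V \<inter> hyp3)"
      using span_hyp3[OF V(1,3,4)] nV by simp
    then have "lor a n = 0"
      by (induction rule: span_induct_alt) (use a in \<open>auto simp: normals_def\<close>)
    then show ?thesis
      by (simp add: c)
  qed
  ultimately show "planes_perp (V \<inter> hyp3) (wall UNIV n)"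
    by (simp add: planes_perp_def)
qed

lemma dim_span_pair: "b \<noteq> 0 \<Longrightarrow> a \<notin> span {b} \<Longrightarrow> dim (span {a, b}) = 2"
  for a b :: "'a::euclidean_space"
  by (simp add: dim_insert)

lemma in_span_singleton: "v \<in> span {a} \<longleftrightarrow> (\<exists>\<alpha>. v = \<alpha> *\<^sub>R a)"
  by (auto simp: span_singleton)

lemma in_span_pair: "v \<in> span {a, b} \<longleftrightarrow> (\<exists>\<alpha> \<beta>. v = \<alpha> *\<^sub>R a + \<beta> *\<^sub>R b)"
  by (simp add: span_breakdown_eq in_span_singleton) (metis add.commute diff_add_cancel add_diff_cancel)

lemma in_span_triple:
  "v \<in> span {a, b, c} \<longleftrightarrow> (\<exists>\<alpha> \<beta> \<gamma>. v = \<alpha> *\<^sub>R a + \<beta> *\<^sub>R b + \<gamma> *\<^sub>R c)"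
  (is "?L = ?R")
proof -
  have "?L \<longleftrightarrow> (\<exists>\<alpha> \<beta> \<gamma>. v - \<alpha> *\<^sub>R a = \<beta> *\<^sub>R b + \<gamma> *\<^sub>R c)"
    unfolding span_breakdown_eq[of v a] in_span_pair ..
  also have "\<dots> \<longleftrightarrow> ?R"
    by (simp add: diff_eq_eq algebra_simps)
  finally show ?thesis .
qed

lemma span_eqI_dim:
  fixes U :: "'a::euclidean_space set"
  assumes "subspace U" "S \<subseteq> U" "dim (span S) = dim U"
  shows "U = span S"
  using subspace_dim_equal[OF subspace_span assms(1) span_minimal[OF assms(2,1)]] assms(3) by simp

text \<open>For the forward direction let \<open>u\<close> be the unit tangent of the geodesic at
  the common point \<open>p\<close>. Its part orthogonal to \<open>n\<close> is tangent to the
  plane, so perpendicularity makes it light-like or zero. It is also orthogonal to \<open>p\<close>,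
  hence zero, and \<open>u\<close> is a multiple of \<open>n\<close>.\<close>

lemma geodesic_perp_wall_iff:
  assumes U: "subspace U" "dim U = 2" "v \<in> U" "lor v v < 0" and n: "lor n n = 1"
  shows "geodesic_perp_plane (U \<inter> hyp3) (wall UNIV n) \<longleftrightarrow> n \<in> U"
proof
  assume "geodesic_perp_plane (U \<inter> hyp3) (wall UNIV n)"
  then obtain p where p: "p \<in> U" "p \<in> hyp3" "lor n p = 0"
    and perp: "\<And>u w. u \<in> U \<Longrightarrow> lor n w = 0 \<Longrightarrow> lor u p = 0 \<Longrightarrow> lor w p = 0 \<Longrightarrow> lor u w = 0"
    unfolding geodesic_perp_plane_def span_hyp3[OF U(1,3,4)] span_wall_UNIV[OF n]
    by (auto simp: wall_def)
  have pp: "lor p p < 0" "p \<noteq> 0"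
    using p by (auto simp: hyp3_def)
  have "dim U = Suc (dim (span {p}))"
    using U(2) pp by (simp add: dim_insert)
  moreover have "span {p} \<subseteq> U"
    using p U(1) by (simp add: span_minimal)
  ultimately obtain u where u: "u \<in> U" "lor u u = 1" "span {p} = {v \<in> U. lor u v = 0}"
    using codim1_normal[OF subspace_span[of "{p}"] span_base[of p "{p}"] pp(1) U(1)] by blast
  have up: "lor u p = 0"
    using u(3) span_base[of p "{p}"] by blast
  define z where "z = u - lor u n *\<^sub>R n"
  have nz: "lor n z = 0" and zp: "lor z p = 0"
    using n p up by (simp_all add: z_def lor_commute)
  then have uz: "lor u z = 0"
    using perp u(1) up by blast
  have "lor z w = lor u w - lor u n * lor n w" for w
    by (simp add: z_def)
  then have "lor z z = 0"
    using uz nz by simp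
  then have "z = 0"
    using lor_orth_timelike_pos[OF pp(1), of z] zp by (force simp: lor_commute)
  then have un: "u = lor u n *\<^sub>R n"
    by (simp add: z_def)
  then have "lor u n \<noteq> 0"
    using u(2) by auto
  then have "n = (1 / lor u n) *\<^sub>R u"
    by (subst un) simp
  then show "n \<in> U"
    using u(1) U(1) subspace_scale by metis
next
  assume nU: "n \<in> U"
  have ne: "U \<inter> hyp3 \<noteq> {}"
    by (rule timelike_imp_hyp3_nonempty[OF U(1,3,4)])
  obtain p where "p \<in> wall U n"
    using hyp3_point_on_wall[OF U(1) ne nU n] by blast
  then have p: "p \<in> U" "p \<in> hyp3" "lor n p = 0" "lor p p = -1"
    by (auto simp: wall_def hyp3_def)
  have "n \<notin> span {p}"
    using p n by (auto simp: in_span_singleton)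
  moreover have "p \<noteq> 0"
    using p by auto
  ultimately have U_eq: "U = span {n, p}"
    using U(1,2) nU p dim_span_pair[of p n] by (intro span_eqI_dim) auto
  have "lor u w = 0" if u: "u \<in> U" "lor n w = 0" "lor u p = 0" for u w
  proof -
    obtain a b where "u = a *\<^sub>R n + b *\<^sub>R p"
      using u(1) in_span_pair unfolding U_eq by blast
    with u p show ?thesis
      by simp
  qed
  then show "geodesic_perp_plane (U \<inter> hyp3) (wall UNIV n)"
    unfolding geodesic_perp_plane_def span_hyp3[OF U(1,3,4)] span_wall_UNIV[OF n]
    using p by (intro bexI[of _ p]) (auto simp: wall_def)
qed

lemma is_geodesic_span:
  assumes "b \<noteq> 0" "a \<notin> span {b}" "v \<in> span {a, b}" "lor v v < 0"
  shows "is_geodesic (span {a, b} \<inter> hyp3)"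
  unfolding is_geodesic_def time_like_def
  using assms dim_span_pair[OF assms(1,2)] subspace_span by blast

lemma is_geodesicE:
  assumes "is_geodesic L"
  obtains U v where "subspace U" "dim U = 2" "v \<in> U" "lor v v < 0" "L = U \<inter> hyp3"
  using assms by (auto simp: is_geodesic_def time_like_def)

section \<open>Distances expressed by the Lorentz form\<close>

lemma cosh_dH: "u \<in> hyp3 \<Longrightarrow> v \<in> hyp3 \<Longrightarrow> cosh (dH u v) = - lor u v"
  using lor_hyp3_le[of u v] by (simp add: dH_def)

lemma dH_nonneg: "u \<in> hyp3 \<Longrightarrow> v \<in> hyp3 \<Longrightarrow> dH u v \<ge> 0"
  using lor_hyp3_le[of u v] by (simp add: dH_def)

lemma dH_le_iff:
  assumes "u \<in> hyp3" "v \<in> hyp3" "u' \<in> hyp3" "v' \<in> hyp3"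
  shows "dH u v \<le> dH u' v' \<longleftrightarrow> lor u' v' \<le> lor u v"
proof -
  have "dH u v \<le> dH u' v' \<longleftrightarrow> cosh (dH u v) \<le> cosh (dH u' v')"
    using assms dH_nonneg by (intro cosh_real_nonneg_le_iff[symmetric])
  then show ?thesis
    using assms by (simp add: cosh_dH)
qed

text \<open>All nearest pairs realize the same distance, so exhibiting one of them settles the
  definite description.\<close>

lemma shortest_arc_length_eqI:
  assumes "nearest_points X Y p q"
  shows "shortest_arc_length X Y = dH p q"
  unfolding shortest_arc_length_def
  using assms by (intro the_equality) (auto simp: nearest_points_def intro: order.antisym)

section \<open>Two planes and an ideal point\<close>

text \<open>The inequality \<open>lor n x > 0\<close> says that the ideal point lies on the side
  into which \<open>n\<close> points. The scale of \<open>x\<close> matters: it fixes the horoball,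
  and \<open>lor n x\<close> will be the exponential of its signed distance from the plane.\<close>

locale wall_light =
  fixes n x :: "real^4"
  assumes nn: "lor n n = 1" and x: "x \<in> pos_light" and nx: "lor n x > 0"
begin

lemma xx: "lor x x = 0" "lor x n = lor n x" "x \<noteq> 0"
  using x by (auto simp: pos_light_iff lor_commute)

lemma n_not_span_x: "n \<notin> span {x}"
  using nn xx by (auto simp: in_span_singleton)

text \<open>The point where the perpendicular geodesic toward \<open>x\<close> meets the plane: a
  vector of \<open>span {n, x}\<close> orthogonal to \<open>n\<close>, of norm -1.\<close>

definition "light_foot = (1 / lor n x) *\<^sub>R x - n"

lemma light_foot: "light_foot \<in> hyp3" "lor n light_foot = 0" "light_foot \<in> span {n, x}"
    "lor light_foot x = - lor n x"
proof -
  have "lor light_foot light_foot = -1"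
    using nn xx nx by (simp add: light_foot_def)
  moreover show "lor light_foot x = - lor n x"
    using xx by (simp add: light_foot_def)
  ultimately show "light_foot \<in> hyp3"
    using nx x by (intro hyp3I_light[of _ x]) auto
  show "lor n light_foot = 0"
    using nn nx by (simp add: light_foot_def)
  show "light_foot \<in> span {n, x}"
    unfolding light_foot_def by (intro span_diff span_scale) (auto intro: span_base)
qed

text \<open>A competing geodesic has \<open>n\<close> in its span by perpendicularity and
  \<open>x\<close> by its ideal endpoint, and these two vectors already span a plane.\<close>

lemma perp_toward_eq: "perp_toward (wall UNIV n) x = span {n, x} \<inter> hyp3"
  unfolding perp_toward_def
proof (rule the_equality)
  have t: "light_foot \<in> span {n, x}" "lor light_foot light_foot < 0"
    using light_foot by (auto simp: hyp3_def)
  have d: "dim (span {n, x}) = 2"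
    by (rule dim_span_pair[OF xx(3) n_not_span_x])
  have "x \<in> span {n, x}" "n \<in> span {n, x}"
    by (auto intro: span_base)
  then show "is_geodesic (span {n, x} \<inter> hyp3) \<and>
      geodesic_perp_plane (span {n, x} \<inter> hyp3) (wall UNIV n) \<and>
      x \<in> ideal_boundary (span {n, x} \<inter> hyp3)"
    using is_geodesic_span[OF xx(3) n_not_span_x t] x geodesic_perp_wall_iff[OF subspace_span d t nn]
      span_hyp3[OF subspace_span t]
    by (simp add: ideal_boundary_def)
next
  fix L assume L: "is_geodesic L \<and> geodesic_perp_plane L (wall UNIV n) \<and> x \<in> ideal_boundary L"
  then obtain U v where U: "subspace U" "dim U = 2" "v \<in> U" "lor v v < 0" "L = U \<inter> hyp3"
    using is_geodesicE by blast
  have "n \<in> U" "x \<in> U"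
    using L geodesic_perp_wall_iff[OF U(1-4) nn] span_hyp3[OF U(1,3,4)]
    by (auto simp: U(5) ideal_boundary_def)
  then have "U = span {n, x}"
    using U dim_span_pair[OF xx(3) n_not_span_x] by (intro span_eqI_dim) auto
  then show "L = span {n, x} \<inter> hyp3"
    using U by simp
qed

text \<open>Pairing with \<open>x\<close> fixes the sign of the coefficient of \<open>n\<close>, and
  the norm condition then fixes that of \<open>x\<close>. These signs later place the point in the
  cone contained in every truncating half.\<close>

lemma perp_toward_point:
  assumes "v \<in> span {n, x}" "v \<in> hyp3"
  obtains e f where "e > 0" "f > 0" "v = e *\<^sub>R x - f *\<^sub>R n"
proof -
  obtain a b where v: "v = a *\<^sub>R n + b *\<^sub>R x"
    using assms in_span_pair by blast
  have "lor v x = a * lor n x"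
    using xx by (simp add: v)
  then have a: "a < 0"
    using lor_hyp3_light[OF assms(2) x] nx by (simp add: mult_less_0_iff)
  have "a * (a + 2 * b * lor n x) = -1"
    using assms(2) nn xx by (simp add: v hyp3_def algebra_simps)
  then have "a + 2 * b * lor n x > 0"
    using a by (smt (verit) mult_nonpos_nonpos)
  then have "b * lor n x > 0"
    using a by simp
  then have "b > 0"
    using nx by (simp add: zero_less_mult_iff)
  then show thesis
    using that[of b "- a"] a v by (simp add: algebra_simps)
qed

text \<open>In the basis \<open>light_foot\<close>, \<open>x\<close> the second coordinate of
  \<open>v\<close> is \<open>lor n v / lor n x\<close>, and the first is positive on the whole
  geodesic.\<close>

lemma perp_ray_toward_eq:
  "perp_ray_toward (wall UNIV n) x = {v \<in> span {n, x} \<inter> hyp3. lor n v \<ge> 0}"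
proof -
  have uniq: "v = light_foot" if v: "v \<in> span {n, x}" "v \<in> hyp3" "lor n v = 0" for v
  proof -
    obtain e f where ef: "e > 0" "f > 0" "v = e *\<^sub>R x - f *\<^sub>R n"
      using perp_toward_point v by blast
    have f: "f = e * lor n x"
      using v(3) nn by (simp add: ef(3))
    have "lor v v = - (f * f)"
      using nn xx by (simp add: ef(3) f algebra_simps)
    then have "f * f = 1"
      using v by (simp add: hyp3_def)
    then have "f = 1"
      using ef(2) by (metis abs_of_pos power2_eq_square real_sqrt_abs real_sqrt_one)
    then have "e = 1 / lor n x"
      using f nx by (simp add: field_simps)
    with \<open>f = 1\<close> ef show ?thesis
      by (simp add: light_foot_def)
  qed
  have "light_foot \<in> perp_toward (wall UNIV n) x \<inter> wall UNIV n"
    unfolding perp_toward_eq by (simp add: wall_def light_foot)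
  then have foot: "perp_toward (wall UNIV n) x \<inter> wall UNIV n = {light_foot}"
    unfolding perp_toward_eq using uniq by (auto simp: wall_def)
  show ?thesis
    unfolding perp_ray_toward_def foot
  proof (intro equalityI subsetI)
    fix v assume "v \<in> (\<Union>p\<in>{light_foot}. arc_or_ray p x)"
    then obtain a b where "a \<ge> 0" "b \<ge> 0" "v = a *\<^sub>R light_foot + b *\<^sub>R x" "v \<in> hyp3"
      by (auto simp: arc_or_ray_def)
    then show "v \<in> {v \<in> span {n, x} \<inter> hyp3. lor n v \<ge> 0}"
      using light_foot nx by (auto intro!: span_add span_scale simp: span_base)
  next
    fix v assume v: "v \<in> {v \<in> span {n, x} \<inter> hyp3. lor n v \<ge> 0}"
    then obtain e f where ef: "e > 0" "f > 0" "v = e *\<^sub>R x - f *\<^sub>R n"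
      using perp_toward_point by blast
    have "lor n v = e * lor n x - f"
      using nn by (simp add: ef(3))
    then have "e - f / lor n x \<ge> 0"
      using v nx by (simp add: field_simps)
    moreover have "v = f *\<^sub>R light_foot + (e - f / lor n x) *\<^sub>R x"
      by (simp add: ef(3) light_foot_def algebra_simps)
    ultimately have "\<exists>a\<ge>0. \<exists>b\<ge>0. v = a *\<^sub>R light_foot + b *\<^sub>R x"
      using ef(2) less_imp_le by blast
    then show "v \<in> (\<Union>p\<in>{light_foot}. arc_or_ray p x)"
      using v by (simp add: arc_or_ray_def)
  qed
qed

end

text \<open>The single inequality \<open>lor n m < -1\<close> encodes that the planes are disjoint
  and not parallel and that each normal points toward the other plane.\<close>

locale wall_pair = N: wall_light n x + M: wall_light m x for n m x +
  assumes nm: "lor n m < -1"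
begin

lemma mn: "lor m n = lor n m"
  by (rule lor_commute)

lemma n_not_span_m: "n \<notin> span {m}" "m \<noteq> 0"
proof -
  show "m \<noteq> 0" using M.nn by auto
  show "n \<notin> span {m}"
  proof
    assume "n \<in> span {m}"
    then obtain k where k: "n = k *\<^sub>R m"
      by (auto simp: in_span_singleton)
    then have "k * k = 1" "k < -1"
      using N.nn M.nn nm by auto
    then show False
      using mult_strict_mono[of 1 "- k" 1 "- k"] by simp
  qed
qed

text \<open>The time-like vector that the criteria for geodesics and planes ask for; its norm is
  \<open>2 + 2 * lor n m\<close>.\<close>

lemma timelike_sum: "n + m \<in> span {n, m}" "lor (n + m) (n + m) < 0"
  using N.nn M.nn nm mn by (auto intro: span_add span_base)

lemma common_perp_eq: "common_perp (wall UNIV n) (wall UNIV m) = span {n, m} \<inter> hyp3"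
  unfolding common_perp_def
proof (rule the_equality)
  have d: "dim (span {n, m}) = 2"
    by (rule dim_span_pair[OF n_not_span_m(2,1)])
  have "m \<in> span {n, m}" "n \<in> span {n, m}"
    by (auto intro: span_base)
  then show "is_geodesic (span {n, m} \<inter> hyp3) \<and>
      geodesic_perp_plane (span {n, m} \<inter> hyp3) (wall UNIV n) \<and>
      geodesic_perp_plane (span {n, m} \<inter> hyp3) (wall UNIV m)"
    using is_geodesic_span[OF n_not_span_m(2,1) timelike_sum]
      geodesic_perp_wall_iff[OF subspace_span d timelike_sum] N.nn M.nn
    by simp
next
  fix L assume L: "is_geodesic L \<and> geodesic_perp_plane L (wall UNIV n) \<and>
      geodesic_perp_plane L (wall UNIV m)"
  then obtain U v where U: "subspace U" "dim U = 2" "v \<in> U" "lor v v < 0" "L = U \<inter> hyp3"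
    using is_geodesicE by blast
  have "n \<in> U" "m \<in> U"
    using L geodesic_perp_wall_iff[OF U(1-4)] N.nn M.nn by (auto simp: U(5))
  then have "U = span {n, m}"
    using U dim_span_pair[OF n_not_span_m(2,1)] by (intro span_eqI_dim) auto
  then show "L = span {n, m} \<inter> hyp3"
    using U by simp
qed

text \<open>The norm condition forces the two coefficients to have the same sign, and pairing with
  the ideal point shows that this sign is negative.\<close>

lemma common_perp_point:
  assumes "v \<in> span {n, m}" "v \<in> hyp3"
  obtains e f where "e > 0" "f > 0" "v = - (e *\<^sub>R n + f *\<^sub>R m)"
proof -
  obtain a b where v: "v = a *\<^sub>R n + b *\<^sub>R m"
    using assms in_span_pair by blast
  have "a * a + b * b + 2 * (a * b * lor n m) = -1"
    using assms(2) N.nn M.nn mn by (simp add: v hyp3_def algebra_simps)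
  then have "a * b * lor n m < 0"
    using zero_le_square[of a] zero_le_square[of b] by linarith
  then have ab: "a * b > 0"
    using nm by (simp add: mult_less_0_iff)
  have "a * lor n x + b * lor m x < 0"
    using lor_hyp3_light[OF assms(2) N.x] by (simp add: v)
  then have "a < 0 \<and> b < 0"
    using ab N.nx M.nx by (smt (verit) mult_nonneg_nonneg zero_less_mult_iff)
  then show thesis
    using that[of "- a" "- b"] v by simp
qed

text \<open>A nonzero light-like combination of \<open>n\<close> and \<open>m\<close> has
  coefficients of equal sign. Since \<open>x\<close> pairs positively with both normals,
  \<open>lor x x\<close> could not vanish.\<close>

lemma x_not_span: "x \<notin> span {n, m}"
proof
  assume "x \<in> span {n, m}"
  then obtain a b where xv: "x = a *\<^sub>R n + b *\<^sub>R m"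
    using in_span_pair by blast
  have nx: "lor n x = a + b * lor n m" and mx: "lor m x = a * lor n m + b"
    using N.nn M.nn mn by (simp_all add: xv)
  have "a * lor n x + b * lor m x = lor x x"
    by (subst (3) xv) simp
  then have 0: "a * lor n x + b * lor m x = 0"
    using N.xx by simp
  then have "a * a + b * b + 2 * (a * b) * lor n m = 0"
    unfolding nx mx by (simp add: algebra_simps)
  moreover have "a * a + b * b > 0"
    using N.xx(3) by (auto simp: xv sum_squares_gt_zero_iff)
  ultimately have "(a * b) * lor n m < 0"
    by simp
  then have "a * b > 0"
    using nm by (simp add: mult_less_0_iff)
  then have "a * lor n x + b * lor m x \<noteq> 0"
    using N.nx M.nx
    by (smt (verit) mult_neg_pos mult_pos_pos zero_less_mult_iff)
  with 0 show False by simp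
qed

text \<open>The hyperbolic sine of the distance between the planes, whose hyperbolic cosine is
  \<open>- lor n m\<close>.\<close>

definition "width = sqrt ((lor n m)\<^sup>2 - 1)"

lemma width: "width > 0" "width * width = (lor n m)\<^sup>2 - 1"
proof -
  have "(lor n m)\<^sup>2 > 1"
    using nm power2_less_imp_less by (smt (verit) one_power2 power2_minus power_strict_mono zero_less_numeral)
  then show "width > 0" "width * width = (lor n m)\<^sup>2 - 1"
    by (simp_all add: width_def)
qed

text \<open>The endpoint on the plane of \<open>n\<close> of the common perpendicular: the part of
  \<open>m\<close> orthogonal to \<open>n\<close>, normalized, with the sign that puts it on the
  positive sheet.\<close>

definition "foot = - (1 / width) *\<^sub>R (m - lor n m *\<^sub>R n)"

lemma foot: "foot \<in> hyp3" "lor n foot = 0" "lor m foot = width" "foot \<in> span {n, m}"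
proof -
  show "lor n foot = 0"
    using N.nn by (simp add: foot_def)
  moreover show mf: "lor m foot = width"
    using M.nn width mn by (simp add: foot_def field_simps power2_eq_square)
  moreover have "lor foot v = - (1 / width) * (lor m v - lor n m * lor n v)" for v
    by (simp add: foot_def)
  ultimately have "lor foot foot = -1"
    using width by simp
  moreover have "lor foot x < 0"
    using width N.nx M.nx nm mult_neg_pos[of "lor n m" "lor n x"]
    by (simp add: foot_def divide_less_0_iff)
  ultimately show "foot \<in> hyp3"
    using N.x hyp3I_light by blast
  show "foot \<in> span {n, m}"
    unfolding foot_def by (intro span_diff span_scale) (auto intro: span_base)
qed

end

lemma wall_pair_sym: "wall_pair n m x \<Longrightarrow> wall_pair m n x"
  by (simp add: wall_pair_def wall_pair_axioms_def lor_commute)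

context wall_pair
begin

text \<open>The same pair in the other order, so that \<open>S.foot\<close> is the foot on the plane
  of \<open>m\<close>.\<close>

sublocale S: wall_pair m n x
  by (rule wall_pair_sym) unfold_locales

end

context wall_pair
begin

lemma width_sym: "S.width = width"
  by (simp add: S.width_def width_def mn)

lemma lor_foot: "lor foot v = (lor n m * lor n v - lor m v) / width"
  by (simp add: foot_def diff_divide_distrib)

end

context wall_pair
begin

lemma lor_foot_sym: "lor S.foot v = (lor n m * lor m v - lor n v) / width"
  by (simp add: S.lor_foot width_sym mn)

lemma lor_feet: "lor foot S.foot = lor n m"
  using width S.foot(2,3) by (simp add: lor_foot width_sym)

text \<open>Split off the components along the feet of the common perpendicular and apply
  Cauchy--Schwarz to the rest.\<close>
lemma lor_walls:
  assumes u: "u \<in> wall UNIV n" and v: "v \<in> wall UNIV m"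
  shows "lor u v \<le> lor n m" "lor u v = lor n m \<Longrightarrow> u = foot \<and> v = S.foot"
proof -
  have u': "lor n u = 0" "lor u u = -1" "u \<in> hyp3" and v': "lor m v = 0" "lor v v = -1" "v \<in> hyp3"
    using u v by (auto simp: wall_def hyp3_def)
  note ff = foot(1) S.foot(1)
  have ff1: "lor foot foot = -1" "lor S.foot S.foot = -1"
    using ff by (auto simp: hyp3_def)
  define a where "a = - lor foot u"
  define b where "b = - lor S.foot v"
  have a1: "a \<ge> 1" and b1: "b \<ge> 1"
    using lor_hyp3_le[OF ff(1) u'(3)] lor_hyp3_le[OF ff(2) v'(3)] by (auto simp: a_def b_def)
  define y where "y = u - a *\<^sub>R foot"
  define z where "z = v - b *\<^sub>R S.foot"
  have y0: "lor foot y = 0" "lor n y = 0"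
    using ff1 u' foot(2) by (simp_all add: y_def a_def)
  then have my: "lor m y = 0"
    using width(1) by (simp add: lor_foot)
  have z0: "lor S.foot z = 0" "lor m z = 0"
    using ff1 v' S.foot(2) by (simp_all add: z_def b_def)
  then have nz: "lor n z = 0"
    using width(1) by (simp add: lor_foot_sym)
  have Sy: "lor S.foot y = 0" and fz: "lor foot z = 0"
    using y0 my z0 nz by (simp_all add: lor_foot lor_foot_sym)
  have u_eq: "u = y + a *\<^sub>R foot" and v_eq: "v = z + b *\<^sub>R S.foot"
    by (simp_all add: y_def z_def)
  have "lor u u = lor y y - a * a" "lor v v = lor z z - b * b"
    using y0 z0 ff1 by (simp_all add: u_eq v_eq lor_commute)
  then have yy: "lor y y = a * a - 1" and zz: "lor z z = b * b - 1"
    using u' v' by auto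
  have uv: "lor u v = lor y z + a * b * lor n m"
    using Sy fz lor_feet by (simp add: u_eq v_eq lor_commute)
  have ab1: "a * b \<ge> 1"
    using mult_mono[OF a1 b1] a1 by simp
  have "(lor y z)\<^sup>2 \<le> lor y y * lor z z"
    using lor_spacelike_cauchy_schwarz[of foot y z] ff1 y0 fz by simp
  \<comment> \<open>The gap between \<open>(a * b - 1)\<^sup>2\<close> and
    \<open>(a * a - 1) * (b * b - 1)\<close> is the square of \<open>a - b\<close>.\<close>
  also have "\<dots> \<le> (a * b - 1)\<^sup>2"
    using zero_le_square[of "a - b"] by (simp add: yy zz power2_eq_square algebra_simps)
  finally have yz: "lor y z \<le> a * b - 1"
    by (rule power2_le_imp_le) (use ab1 in simp)
  have "(a * b - 1) * (lor n m + 1) \<le> 0"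
    using ab1 nm by (intro mult_nonneg_nonpos) auto
  then have bound: "lor u v \<le> lor n m + (a * b - 1) * (lor n m + 1)"
    using yz by (simp add: uv algebra_simps)
  with \<open>(a * b - 1) * (lor n m + 1) \<le> 0\<close> show "lor u v \<le> lor n m"
    by linarith
  assume "lor u v = lor n m"
  with bound have "(a * b - 1) * (lor n m + 1) \<ge> 0"
    by linarith
  then have "a * b \<le> 1"
    using nm by (simp add: zero_le_mult_iff)
  moreover have "a \<le> a * b" "b \<le> a * b"
    using mult_left_mono[OF b1, of a] mult_right_mono[OF a1, of b] a1 b1 by auto
  ultimately have "a = 1" "b = 1"
    using a1 b1 by linarith+
  then show "u = foot \<and> v = S.foot"
    using lor_hyp3_eq[OF ff(1) u'(3)] lor_hyp3_eq[OF ff(2) v'(3)] by (simp add: a_def b_def)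
qed

lemma nearest_points_walls:
  "nearest_points (wall UNIV n) (wall UNIV m) p q \<longleftrightarrow> p = foot \<and> q = S.foot"
proof -
  have f: "foot \<in> wall UNIV n" "S.foot \<in> wall UNIV m"
    using foot S.foot by (auto simp: wall_def)
  have sub: "u \<in> hyp3" if "u \<in> wall UNIV k" for u k
    using that by (simp add: wall_def)
  have le: "dH foot S.foot \<le> dH u v" if "u \<in> wall UNIV n" "v \<in> wall UNIV m" for u v
    using that f sub lor_walls(1)[OF that] by (simp add: dH_le_iff lor_feet)
  show ?thesis
  proof
    assume np: "nearest_points (wall UNIV n) (wall UNIV m) p q"
    then have pq: "p \<in> wall UNIV n" "q \<in> wall UNIV m" "dH p q \<le> dH foot S.foot"
      using f by (auto simp: nearest_points_def)
    then have "lor n m \<le> lor p q"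
      using f sub by (simp add: dH_le_iff lor_feet)
    then show "p = foot \<and> q = S.foot"
      using lor_walls[OF pq(1,2)] by simp
  next
    assume "p = foot \<and> q = S.foot"
    then show "nearest_points (wall UNIV n) (wall UNIV m) p q"
      using f le by (simp add: nearest_points_def)
  qed
qed

lemma shortest_arc_length_walls: "shortest_arc_length (wall UNIV n) (wall UNIV m) = arcosh (- lor n m)"
  using shortest_arc_length_eqI[of "wall UNIV n" "wall UNIV m" foot S.foot]
  by (simp add: nearest_points_walls dH_def lor_feet)

lemma cosh_shortest_arc_length_walls:
  "cosh (shortest_arc_length (wall UNIV n) (wall UNIV m)) = - lor n m"
  using nm by (simp add: shortest_arc_length_walls)

lemma shortest_arc_walls_feet: "shortest_arc (wall UNIV n) (wall UNIV m) = arc_or_ray foot S.foot"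
  unfolding shortest_arc_def nearest_points_walls by simp

text \<open>Up to the factor \<open>width\<close>, the feet form the basis dual to \<open>m\<close>
  and \<open>n\<close>. Non-negative coordinates in the feet are therefore the same as non-negative
  values of \<open>lor m\<close> and \<open>lor n\<close>.\<close>

lemma shortest_arc_walls:
  "shortest_arc (wall UNIV n) (wall UNIV m) = {v \<in> span {n, m} \<inter> hyp3. lor n v \<ge> 0 \<and> lor m v \<ge> 0}"
  unfolding shortest_arc_walls_feet
proof (intro equalityI subsetI)
  fix v assume "v \<in> arc_or_ray foot S.foot"
  then obtain a b where "a \<ge> 0" "b \<ge> 0" and v: "v = a *\<^sub>R foot + b *\<^sub>R S.foot" "v \<in> hyp3"
    by (auto simp: arc_or_ray_def)
  moreover have "S.foot \<in> span {n, m}"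
    using S.foot(4) by (simp add: insert_commute)
  ultimately show "v \<in> {v \<in> span {n, m} \<inter> hyp3. lor n v \<ge> 0 \<and> lor m v \<ge> 0}"
    using foot S.foot width S.width by (auto intro!: span_add span_scale)
next
  fix v assume v: "v \<in> {v \<in> span {n, m} \<inter> hyp3. lor n v \<ge> 0 \<and> lor m v \<ge> 0}"
  then obtain a b where ab: "v = a *\<^sub>R n + b *\<^sub>R m"
    using in_span_pair by blast
  let ?c = "lor n m"
  have nv: "lor n v = a + b * ?c" and mv: "lor m v = a * ?c + b"
    using N.nn M.nn mn by (simp_all add: ab)
  have "(lor m v / width) *\<^sub>R foot + (lor n v / width) *\<^sub>R S.foot =
      ((lor m v * ?c - lor n v) / (width * width)) *\<^sub>R n + ((lor n v * ?c - lor m v) / (width * width)) *\<^sub>R m"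
    by (simp add: foot_def S.foot_def width_sym mn algebra_simps add_divide_distrib diff_divide_distrib)
  also have "lor m v * ?c - lor n v = a * (width * width)"
    unfolding nv mv width(2) by (simp add: algebra_simps power2_eq_square)
  also have "lor n v * ?c - lor m v = b * (width * width)"
    unfolding nv mv width(2) by (simp add: algebra_simps power2_eq_square)
  finally have "v = (lor m v / width) *\<^sub>R foot + (lor n v / width) *\<^sub>R S.foot"
    using ab width(1) by simp
  moreover have "lor m v / width \<ge> 0" "lor n v / width \<ge> 0"
    using v width by auto
  ultimately have "\<exists>a\<ge>0. \<exists>b\<ge>0. v = a *\<^sub>R foot + b *\<^sub>R S.foot"
    by blast
  then show "v \<in> arc_or_ray foot S.foot"
    using v by (simp add: arc_or_ray_def)
qed

end

section \<open>Signed distances to a horoball\<close>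

text \<open>With \<open>y = - lor v x\<close>, the vector \<open>y *\<^sub>R u - v\<close> is
  orthogonal to the light-like \<open>x\<close>, so its norm is non-negative. Expanded, this bounds
  \<open>- lor v u\<close> below by \<open>(y + 1 / y) / 2 = cosh (ln y)\<close>.\<close>

lemma cosh_ln_le_dH_horosphere:
  assumes v: "v \<in> hyp3" and x: "x \<in> pos_light" and u: "u \<in> horosphere x"
  shows "\<bar>ln (- lor v x)\<bar> \<le> dH v u"
proof -
  define y where "y = - lor v x"
  have y: "y > 0"
    using lor_hyp3_light[OF v x] by (simp add: y_def)
  have u': "u \<in> hyp3" "lor u x = -1"
    using u by (auto simp: horosphere_def)
  have "lor x x \<le> 0" "x \<noteq> 0" "lor x (y *\<^sub>R u - v) = 0"
    using u'(2) x by (auto simp: y_def pos_light_iff lor_commute[of x u] lor_commute[of x v])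
  then have "lor (y *\<^sub>R u - v) (y *\<^sub>R u - v) \<ge> 0"
    by (rule lor_orth_causal_nonneg)
  also have "lor (y *\<^sub>R u - v) (y *\<^sub>R u - v) = - (y * y) - 1 - 2 * y * lor v u"
    using u' v by (simp add: hyp3_def y_def[symmetric] lor_commute[of u v] algebra_simps)
  finally have "cosh (ln y) \<le> - lor v u"
    using y by (simp add: cosh_ln_real field_simps)
  then have "cosh \<bar>ln y\<bar> \<le> cosh (dH v u)"
    using u' v by (simp add: cosh_dH)
  then show ?thesis
    using dH_nonneg[OF v u'(1)] by (subst (asm) cosh_real_nonneg_le_iff) (auto simp: y_def)
qed

lemma INF_dH_horosphere:
  assumes v: "v \<in> hyp3" and x: "x \<in> pos_light"
  shows "(INF u \<in> horosphere x. dH v u) = \<bar>ln (- lor v x)\<bar>"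
proof (rule cInf_eq_minimum)
  define y where "y = - lor v x"
  have y: "y > 0"
    using lor_hyp3_light[OF v x] by (simp add: y_def)
  have vx: "lor v v = -1" "lor v x = -y" "lor x v = -y" "lor x x = 0"
    using v x by (auto simp: y_def hyp3_def pos_light_iff lor_commute)
  \<comment> \<open>The point of the horosphere on the geodesic from \<open>v\<close> with endpoint
    \<open>x\<close>: the coefficient of \<open>v\<close> is fixed by \<open>lor u x = -1\<close>,
    that of \<open>x\<close> by \<open>lor u u = -1\<close>.\<close>
  define u where "u = (1 / y) *\<^sub>R v + ((1 - 1 / (y * y)) / 2) *\<^sub>R x"
  have "lor u x = -1"
    using y vx by (simp add: u_def)
  moreover have "lor u u = -1"
    using y vx by (simp add: u_def field_simps)
  ultimately have u: "u \<in> horosphere x"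
    using x hyp3I_light[of u x] by (simp add: horosphere_def)
  have "- lor v u = cosh \<bar>ln y\<bar>"
    using y vx by (simp add: u_def cosh_ln_real field_simps)
  then have "dH v u = \<bar>ln y\<bar>"
    unfolding dH_def by (simp only: arcosh_cosh_real abs_ge_zero)
  then show "\<bar>ln (- lor v x)\<bar> \<in> dH v ` horosphere x"
    using u by (auto simp: y_def intro!: image_eqI[of _ _ u])
  show "\<bar>ln (- lor v x)\<bar> \<le> d" if "d \<in> dH v ` horosphere x" for d
    using that cosh_ln_le_dH_horosphere[OF v x] by blast
qed

text \<open>The horoball is \<open>- lor v x \<le> 1\<close>, so the sign of the logarithm is the
  sign in the definition.\<close>

lemma signed_dist_point_eq:
  assumes v: "v \<in> hyp3" and x: "x \<in> pos_light"
  shows "signed_dist_point x v = ln (- lor v x)"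
  using lor_hyp3_light[OF v x] v
  by (auto simp: signed_dist_point_def INF_dH_horosphere[OF v x] horoball_def)

text \<open>The minimum is attained at \<open>light_foot\<close>. For another point \<open>v\<close>
  of the plane, \<open>lor light_foot v = lor x v / lor n x\<close>, and this is at most -1.\<close>

lemma (in wall_light) signed_dist_plane_eq: "signed_dist_plane x (wall UNIV n) = ln (lor n x)"
  unfolding signed_dist_plane_def
proof (rule Least_equality)
  have "signed_dist_point x light_foot = ln (lor n x)"
    using signed_dist_point_eq[OF light_foot(1) x] light_foot(4) by simp
  then show "\<exists>v\<in>wall UNIV n. ln (lor n x) = signed_dist_point x v"
    using light_foot by (intro bexI[of _ light_foot]) (auto simp: wall_def)
next
  fix r assume "\<exists>v\<in>wall UNIV n. r = signed_dist_point x v"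
  then obtain v where v: "v \<in> hyp3" "lor n v = 0" "r = signed_dist_point x v"
    by (auto simp: wall_def)
  have "lor light_foot v = lor x v / lor n x"
    using v by (simp add: light_foot_def)
  then have "lor x v / lor n x \<le> -1"
    using lor_hyp3_le[OF light_foot(1) v(1)] by simp
  then have "lor n x \<le> - lor v x"
    using nx by (simp add: field_simps lor_commute)
  then show "ln (lor n x) \<le> r"
    using signed_dist_point_eq[OF v(1) x] v nx by simp
qed

section \<open>Geodesics parametrized by arclength\<close>

lemma isometry_real:
  fixes f :: "real \<Rightarrow> real"
  assumes "\<And>s t. \<bar>f s - f t\<bar> = \<bar>s - t\<bar>"
  obtains e c where "e = 1 \<or> e = -1" "\<And>s. f s = e * s + c"
proof -
  have "f s = (f 1 - f 0) * s + f 0" for s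
  proof -
    consider "f 1 - f 0 = 1" | "f 1 - f 0 = -1"
      using assms[of 1 0] by linarith
    then show ?thesis
      using assms[of s 0] assms[of s 1] by cases auto
  qed
  moreover have "f 1 - f 0 = 1 \<or> f 1 - f 0 = -1"
    using assms[of 1 0] by linarith
  ultimately show thesis
    using that by blast
qed

text \<open>The value \<open>- 1 / 2\<close> gives
  \<open>lor (gam s) (gam t) = - cosh (s - t)\<close>, so \<open>gam\<close> has unit speed.\<close>

locale null_pair =
  fixes A A' :: "real^4"
  assumes A: "A \<in> pos_light" and A': "A' \<in> pos_light" and AA': "lor A A' = - 1 / 2"
begin

definition "gam s = exp s *\<^sub>R A + exp (- s) *\<^sub>R A'"

lemma null: "lor A A = 0" "lor A' A' = 0" "lor A' A = - 1 / 2"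
  using A A' AA' by (auto simp: pos_light_iff lor_commute)

lemma lor_gam: "lor (gam s) (gam t) = - cosh (s - t)"
  using null AA' by (simp add: gam_def cosh_def exp_diff exp_minus) (simp add: field_simps)

lemma gam_in_hyp3: "gam s \<in> hyp3"
  using lor_gam[of s s] A A' by (simp add: hyp3_def gam_def pos_light_iff add_pos_pos)

lemma dH_gam: "dH (gam s) (gam t) = \<bar>s - t\<bar>"
proof -
  have "- lor (gam s) (gam t) = cosh \<bar>s - t\<bar>"
    by (simp add: lor_gam)
  then show ?thesis
    unfolding dH_def by (simp only: arcosh_cosh_real abs_ge_zero)
qed

lemma range_gam: "range gam = span {A, A'} \<inter> hyp3"
proof (intro equalityI subsetI)
  fix v assume "v \<in> range gam"
  then show "v \<in> span {A, A'} \<inter> hyp3"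
    using gam_in_hyp3 by (auto simp: in_span_pair gam_def)
next
  fix v assume v: "v \<in> span {A, A'} \<inter> hyp3"
  then obtain a b where ab: "v = a *\<^sub>R A + b *\<^sub>R A'"
    using in_span_pair by blast
  have "lor v A' < 0"
    using v A' lor_hyp3_light by blast
  then have a: "a > 0"
    using null AA' by (simp add: ab)
  have "lor v v = - (a * b)"
    using null AA' by (simp add: ab)
  then have "b = 1 / a"
    using v a by (simp add: hyp3_def field_simps)
  then have "v = gam (ln a)"
    using a by (simp add: gam_def ab exp_minus inverse_eq_divide)
  then show "v \<in> range gam"
    by blast
qed

lemma arclength_param_gam: "arclength_param gam (span {A, A'} \<inter> hyp3)"
  by (simp add: arclength_param_def range_gam dH_gam)

text \<open>Two arclength parametrizations differ by an isometry of the line, a reflection or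
  translation. Arbitrary parametrizations thus reduce to \<open>gam\<close>.\<close>

lemma arclength_param_eq:
  assumes "arclength_param g (span {A, A'} \<inter> hyp3)"
  obtains e c where "e = 1 \<or> e = -1" "\<And>s. g s = gam (e * s + c)"
proof -
  have "\<forall>s. \<exists>r. g s = gam r"
    using assms range_gam unfolding arclength_param_def by (metis rangeE rangeI)
  then obtain f where f: "\<And>s. g s = gam (f s)"
    by metis
  have "\<bar>f s - f t\<bar> = \<bar>s - t\<bar>" for s t
    using assms f dH_gam by (metis arclength_param_def)
  then obtain e c where "e = 1 \<or> e = -1" "\<And>s. f s = e * s + c"
    using isometry_real by blast
  with f that show thesis
    by simp
qed

lemma span_eq:
  assumes "A \<in> U" "A' \<in> U" "subspace U" "dim U = 2"
  shows "U = span {A, A'}"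
proof (rule span_eqI_dim[OF assms(3)])
  have "A' \<noteq> 0"
    using null by auto
  moreover have "A \<notin> span {A'}"
    using null AA' by (auto simp: in_span_singleton)
  ultimately show "dim (span {A, A'}) = dim U"
    using dim_span_pair assms(4) by metis
qed (use assms in auto)

end

section \<open>Minimizing the distance between two geodesics\<close>

definition dist_form :: "real \<Rightarrow> real \<Rightarrow> real \<Rightarrow> real \<Rightarrow> real \<Rightarrow> real \<Rightarrow> real" where
  "dist_form p q p' q' S T =
     p * exp (S + T) + q * exp (S - T) + p' * exp (T - S) + q' * exp (- S - T)"

text \<open>The two terms have constant product \<open>p * q\<close>, so their sum is least where
  they are equal, namely at \<open>u0\<close>. The third claim says that this is the only zero of
  the derivative.\<close>

lemma am_gm_exp:
  fixes p q :: real
  assumes "p > 0" "q > 0" "p * exp (2 * u0) = q"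
  shows "p * exp u + q * exp (- u) \<ge> 2 * sqrt (p * q)"
    "p * exp u0 + q * exp (- u0) = 2 * sqrt (p * q)"
    "p * exp u = q * exp (- u) \<longleftrightarrow> u = u0"
proof -
  have e: "exp u * exp (- u) = 1" for u :: real
    by (simp add: exp_minus)
  have "(p * exp u) * (q * exp (- u)) = p * q"
    using e[of u] by (simp add: algebra_simps)
  then have "sqrt (p * q) \<le> (p * exp u + q * exp (- u)) / 2"
    using arith_geo_mean_sqrt[of "p * exp u" "q * exp (- u)"] assms by (simp only:) simp
  then show "p * exp u + q * exp (- u) \<ge> 2 * sqrt (p * q)"
    by simp
  have q: "q * exp (- u0) = p * exp u0"
    using assms(3)[symmetric] by (simp add: exp_add[symmetric])
  have "p * q = (p * exp u0)\<^sup>2"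
    using assms(3)[symmetric] by (simp add: power2_eq_square exp_add[symmetric])
  then show "p * exp u0 + q * exp (- u0) = 2 * sqrt (p * q)"
    using assms(1) by (simp add: q)
  have "p * exp u = q * exp (- u) \<longleftrightarrow> p * exp u * exp u = q * exp (- u) * exp u"
    by simp
  also have "\<dots> \<longleftrightarrow> p * exp (2 * u) = p * exp (2 * u0)"
    unfolding assms(3) by (simp add: exp_add[symmetric] mult.assoc)
  finally show "p * exp u = q * exp (- u) \<longleftrightarrow> u = u0"
    using assms(1) by simp
qed

lemma dist_form_min:
  assumes pos: "p > 0" "q > 0" "p' > 0" "q' > 0"
    and z: "p * exp (2 * (S0 + T0)) = q'" "q * exp (2 * (S0 - T0)) = p'"
  shows "dist_form p q p' q' S0 T0 = 2 * sqrt (p * q') + 2 * sqrt (q * p')"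
    "dist_form p q p' q' S0 T0 \<le> dist_form p q p' q' S T"
proof -
  have split: "dist_form p q p' q' S T =
      (p * exp (S + T) + q' * exp (- (S + T))) + (q * exp (S - T) + p' * exp (- (S - T)))" for S T
    by (simp add: dist_form_def)
  show "dist_form p q p' q' S0 T0 = 2 * sqrt (p * q') + 2 * sqrt (q * p')"
    unfolding split using am_gm_exp(2)[OF pos(1,4) z(1)] am_gm_exp(2)[OF pos(2,3) z(2)] by simp
  then show "dist_form p q p' q' S0 T0 \<le> dist_form p q p' q' S T"
    using am_gm_exp(1)[OF pos(1,4) z(1), of "S + T"] am_gm_exp(1)[OF pos(2,3) z(2), of "S - T"]
    unfolding split[of S T] by simp
qed

text \<open>The signs \<open>e\<close>, \<open>f\<close> and shifts \<open>c\<close>,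
  \<open>d\<close> account for arbitrary arclength parametrizations.\<close>

lemma dist_form_critical:
  assumes pos: "p > 0" "q > 0" "p' > 0" "q' > 0"
    and z: "p * exp (2 * (S0 + T0)) = q'" "q * exp (2 * (S0 - T0)) = p'"
    and e: "e = 1 \<or> e = -1" and f: "f = 1 \<or> f = -1"
  shows "critical_point (\<lambda>(s, t). dist_form p q p' q' (e * s + c) (f * t + d)) (s, t)
    \<longleftrightarrow> e * s + c = S0 \<and> f * t + d = T0"
proof -
  let ?G = "\<lambda>(s, t). dist_form p q p' q' (e * s + c) (f * t + d)"
  define u where "u = (e * s + c) + (f * t + d)"
  define v where "v = (e * s + c) - (f * t + d)"
  define P where "P = p * exp u - q' * exp (- u)"
  define Q where "Q = q * exp v - p' * exp (- v)"
  \<comment> \<open>Here \<open>P\<close> and \<open>Q\<close> are the derivatives in the decoupled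
    variables \<open>u\<close> and \<open>v\<close>, and the chain rule gives the partial
    derivatives \<open>e * (P + Q)\<close> and \<open>f * (P - Q)\<close>.\<close>
  define L where "L = (\<lambda>z::real \<times> real. e * (P + Q) * fst z + f * (P - Q) * snd z)"
  have "((\<lambda>z. dist_form p q p' q' (e * fst z + c) (f * snd z + d)) has_derivative L) (at (s, t))"
    unfolding dist_form_def L_def P_def Q_def u_def v_def
    by (auto intro!: derivative_eq_intros ext simp: algebra_simps)
  then have der: "(?G has_derivative L) (at (s, t))"
    by (simp add: case_prod_beta')
  have "critical_point ?G (s, t) \<longleftrightarrow> L = (\<lambda>_. 0)"
    unfolding critical_point_def using der has_derivative_unique by metis
  also have "\<dots> \<longleftrightarrow> P + Q = 0 \<and> P - Q = 0"
  proof
    assume "L = (\<lambda>_. 0)"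
    then have "L (1, 0) = 0" "L (0, 1) = 0"
      by auto
    then show "P + Q = 0 \<and> P - Q = 0"
      using e f by (auto simp: L_def)
  qed (auto simp: L_def)
  also have "\<dots> \<longleftrightarrow> P = 0 \<and> Q = 0"
    by auto
  also have "\<dots> \<longleftrightarrow> u = S0 + T0 \<and> v = S0 - T0"
    using am_gm_exp(3)[OF pos(1,4) z(1)] am_gm_exp(3)[OF pos(2,3) z(2)]
    by (simp add: P_def Q_def)
  also have "\<dots> \<longleftrightarrow> e * s + c = S0 \<and> f * t + d = T0"
    by (auto simp: u_def v_def)
  finally show ?thesis .
qed

lemma dist_form_minimizer:
  assumes "p > 0" "q > 0" "p' > 0" "q' > (0::real)"
  obtains S0 T0 where "p * exp (2 * (S0 + T0)) = q'" "q * exp (2 * (S0 - T0)) = p'"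
proof -
  define U where "U = ln (q' / p) / 2"
  define V where "V = ln (p' / q) / 2"
  have "p * exp (2 * U) = q'" "q * exp (2 * V) = p'"
    using assms by (simp_all add: U_def V_def)
  then show thesis
    using that[of "(U + V) / 2" "(U - V) / 2"] by (simp add: field_simps)
qed

section \<open>End points of the edges\<close>

context wall_light
begin

text \<open>The factor makes \<open>lor n ray_end = 1 / 2\<close>. Then \<open>ray_start\<close> is
  the mirror image of \<open>ray_end\<close> in the plane, so the parameter 0 lies on the
  plane.\<close>

definition "ray_end = (1 / (2 * lor n x)) *\<^sub>R x"
definition "ray_start = (1 / (2 * lor n x)) *\<^sub>R x - n"

lemma lor_ray_ends:
  "lor v ray_end = lor v x / (2 * lor n x)" "lor v ray_start = lor v x / (2 * lor n x) - lor v n"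
  "lor ray_end v = lor x v / (2 * lor n x)" "lor ray_start v = lor x v / (2 * lor n x) - lor n v"
  by (simp_all add: ray_end_def ray_start_def)

sublocale ray: null_pair ray_end ray_start
proof
  show end_light: "ray_end \<in> pos_light"
    using x nx by (simp add: pos_light_iff lor_ray_ends) (simp add: ray_end_def)
  show "lor ray_end ray_start = - 1 / 2"
    using xx nx by (simp add: lor_ray_ends)
  then have neg: "lor ray_start ray_end < 0"
    by (simp add: lor_commute)
  have 0: "lor ray_start ray_start = 0"
    using xx nx nn by (simp add: lor_ray_ends)
  then show "ray_start \<in> pos_light"
    using causal_positiveI[OF _ neg] end_light by (simp add: pos_light_iff)
qed

lemma span_ray: "span {n, x} = span {ray_end, ray_start}"
proof (rule ray.span_eq)
  have "n \<in> span {n, x}" "x \<in> span {n, x}"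
    by (auto intro: span_base)
  then show "ray_end \<in> span {n, x}" "ray_start \<in> span {n, x}"
    by (auto simp: ray_end_def ray_start_def intro: span_diff span_scale)
qed (simp_all add: dim_span_pair[OF xx(3) n_not_span_x, unfolded dim_span])

lemma lor_ray_gam: "lor n (ray.gam t) = sinh t"
  using nx nn by (simp add: ray.gam_def lor_ray_ends sinh_def field_simps)

end

context wall_pair
begin

text \<open>\<open>ratio\<close> is \<open>exp \<ell>\<close> for the distance \<open>\<ell>\<close> of the two planes; \<open>n + r *\<^sub>R m\<close> is light-like
  exactly for \<open>r = ratio\<close> and \<open>r = 1 / ratio\<close>.\<close>
definition "ratio = width - lor n m"
definition "edge_end = - (1 / (2 * width)) *\<^sub>R (n + ratio *\<^sub>R m)"
definition "edge_start = - (1 / (2 * width)) *\<^sub>R (n + (1 / ratio) *\<^sub>R m)"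

lemma ratio: "ratio > 1" "ratio * ratio + 1 = - 2 * lor n m * ratio" "ratio - 1 / ratio = 2 * width"
    "ratio + 1 / ratio = - 2 * lor n m"
proof -
  show r: "ratio > 1"
    using nm width(1) by (simp add: ratio_def)
  show r2: "ratio * ratio + 1 = - 2 * lor n m * ratio"
    using width(2) by (simp add: ratio_def power2_eq_square algebra_simps)
  have "ratio + 1 / ratio = (ratio * ratio + 1) / ratio"
    using r by (simp add: field_simps)
  then show r3: "ratio + 1 / ratio = - 2 * lor n m"
    unfolding r2 using r by simp
  then show "ratio - 1 / ratio = 2 * width"
    unfolding ratio_def by linarith
qed

lemma lor_edge_ends:
  "lor edge_end v = - (lor n v + ratio * lor m v) / (2 * width)"
  "lor edge_start v = - (lor n v + lor m v / ratio) / (2 * width)"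
  by (simp_all add: edge_end_def edge_start_def add_divide_distrib diff_divide_distrib)

lemma lor_edge_walls:
  "lor n edge_end = ratio / 2" "lor m edge_end = - 1 / 2"
  "lor n edge_start = - 1 / (2 * ratio)" "lor m edge_start = 1 / 2"
proof -
  have c: "lor n m = - (ratio + 1 / ratio) / 2" and w: "width = (ratio - 1 / ratio) / 2"
    using ratio by auto
  have r: "ratio > 1" "ratio * ratio \<noteq> 1"
    using ratio(1) mult_strict_mono[of 1 ratio 1 ratio] by auto
  have "lor edge_end n = ratio / 2" "lor edge_end m = - 1 / 2"
    "lor edge_start n = - 1 / (2 * ratio)" "lor edge_start m = 1 / 2"
    unfolding lor_edge_ends N.nn M.nn mn c w using r by (simp_all add: field_simps)
  then show "lor n edge_end = ratio / 2" "lor m edge_end = - 1 / 2"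
    "lor n edge_start = - 1 / (2 * ratio)" "lor m edge_start = 1 / 2"
    by (simp_all only: lor_commute[of n edge_end] lor_commute[of n edge_start]
        lor_commute[of m edge_end] lor_commute[of m edge_start])
qed

sublocale edge: null_pair edge_end edge_start
proof
  have "ratio * lor m x > 0" "lor m x / ratio > 0"
    using M.nx ratio(1) by simp_all
  then have neg: "lor edge_end x < 0" "lor edge_start x < 0"
    unfolding lor_edge_ends using width(1) N.nx by (auto intro!: divide_neg_pos)
  have "lor edge_end edge_end = 0" "lor edge_start edge_start = 0"
    using ratio(1) by (simp_all add: lor_edge_ends lor_edge_walls)
  then show "edge_end \<in> pos_light" "edge_start \<in> pos_light"
    using causal_positiveI[OF _ neg(1)] causal_positiveI[OF _ neg(2)] N.x by (auto simp: pos_light_iff)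
  have "lor edge_end edge_start = - (- 1 / (2 * ratio) + ratio * (1 / 2)) / (2 * width)"
    by (simp only: lor_edge_ends lor_edge_walls)
  also have "- 1 / (2 * ratio) + ratio * (1 / 2) = (ratio - 1 / ratio) / 2"
    by (simp add: diff_divide_distrib)
  finally show "lor edge_end edge_start = - 1 / 2"
    using ratio(3) width(1) by simp
qed

lemma span_edge: "span {n, m} = span {edge_end, edge_start}"
proof (rule edge.span_eq)
  have "n \<in> span {n, m}" "m \<in> span {n, m}"
    by (auto intro: span_base)
  then show "edge_end \<in> span {n, m}" "edge_start \<in> span {n, m}"
    unfolding edge_end_def edge_start_def by (simp_all only: span_add span_scale)
qed (simp_all add: dim_span_pair[OF n_not_span_m(2,1), unfolded dim_span])

text \<open>The first value is \<open>sinh (s + ln ratio)\<close>. The parameter 0 is thus the foot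
  on the plane of \<open>m\<close>, \<open>- ln ratio\<close> is the foot on that of
  \<open>n\<close>, and the edge is the interval between them.\<close>

lemma lor_edge_gam:
  "lor n (edge.gam s) = (ratio * exp s - exp (- s) / ratio) / 2"
  "lor m (edge.gam s) = - sinh s"
  by (simp_all add: edge.gam_def lor_edge_walls sinh_def field_simps)

end

section \<open>The transversal\<close>

text \<open>Here \<open>r = exp \<ell>\<^sub>i\<^sub>j\<close>, and the products under the roots are those of opposite coefficients of
  the distance function, up to the factor \<open>1 / (2 w)\<^sup>2\<close>.\<close>
definition transversal_cosh :: "real \<Rightarrow> real \<Rightarrow> real \<Rightarrow> real \<Rightarrow> real \<Rightarrow> real \<Rightarrow> real" where
  "transversal_cosh x y a b c d =
    (let w = sqrt (x\<^sup>2 - 1); r = w + x; p = (c + r * d) / (2 * y); p' = (c + d / r) / (2 * y)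
     in (sqrt (p * (p' + a + b / r)) + sqrt ((p + a + r * b) * p')) / w)"

text \<open>The exchange turns \<open>c + r * d\<close> into \<open>r\<close> times
  \<open>c + d / r\<close>, and likewise for \<open>a\<close>, \<open>b\<close>. In each product one
  factor gains \<open>r\<close> and the other loses it, so the two roots change places.\<close>

lemma transversal_cosh_swap:
  assumes "x > 1"
  shows "transversal_cosh x y b a d c = transversal_cosh x y a b c d"
proof -
  define w where "w = sqrt (x\<^sup>2 - 1)"
  define r where "r = w + x"
  have "w \<ge> 0"
    using assms by (simp add: w_def power2_eq_square mult_ge1_I)
  then have r: "r > 0"
    using assms by (simp add: r_def)
  have swap: "(d + r * c) / (2 * y) * ((d + c / r) / (2 * y) + b + a / r) =
      ((c + r * d) / (2 * y) + a + r * b) * ((c + d / r) / (2 * y))"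
    "((d + r * c) / (2 * y) + b + r * a) * ((d + c / r) / (2 * y)) =
      (c + r * d) / (2 * y) * ((c + d / r) / (2 * y) + a + b / r)"
    using r by (cases "y = 0"; simp add: field_simps)+
  show ?thesis
    unfolding transversal_cosh_def Let_def w_def[symmetric] r_def[symmetric] swap
    by (simp only: add.commute)
qed

text \<open>Weak growth in all four inputs and strict growth in at least one covers the four
  monotonicity claims at once.\<close>

lemma transversal_cosh_mono:
  assumes "x > 1" "y > 0" "a > 0" "b > 0" "c > 0" "d > 0"
    and "a \<le> a'" "b \<le> b'" "c \<le> c'" "d \<le> d'" "(a, b, c, d) \<noteq> (a', b', c', d')"
  shows "transversal_cosh x y a b c d < transversal_cosh x y a' b' c' d'"
proof -
  define w where "w = sqrt (x\<^sup>2 - 1)"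
  define r where "r = w + x"
  have w: "w > 0"
    using assms(1) by (simp add: w_def power2_eq_square less_1_mult)
  then have r: "r > 0"
    using assms(1) by (simp add: r_def)
  define p where "p = (\<lambda>c d. (c + r * d) / (2 * y))"
  define p' where "p' = (\<lambda>c d. (c + d / r) / (2 * y))"
  define q where "q = (\<lambda>a b c d. p c d + a + r * b)"
  define q' where "q' = (\<lambda>a b c d. p' c d + a + b / r)"
  have mono: "r * b \<le> r * b'" "b / r \<le> b' / r" "r * d \<le> r * d'" "d / r \<le> d' / r"
    using assms r by (simp_all add: divide_right_mono)
  have strict: "b < b' \<Longrightarrow> r * b < r * b'" "b < b' \<Longrightarrow> b / r < b' / r"
      "d < d' \<Longrightarrow> r * d < r * d'" "d < d' \<Longrightarrow> d / r < d' / r"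
    using r by (simp_all add: divide_strict_right_mono)
  have pos: "p c d > 0" "p' c d > 0"
    using assms r by (auto simp: p_def p'_def intro!: divide_pos_pos add_pos_pos)
  have rb: "r * b > 0" "b / r > 0"
    using assms r by simp_all
  have le: "p c d \<le> p c' d'" "p' c d \<le> p' c' d'"
    using assms mono by (auto simp: p_def p'_def intro!: divide_right_mono add_mono)
  then have qle: "q a b c d \<le> q a' b' c' d'" "q' a b c d \<le> q' a' b' c' d'"
    using assms mono by (auto simp: q_def q'_def intro!: add_mono)
  have qpos: "q a b c d > 0" "q' a b c d > 0"
    using pos assms rb by (auto simp: q_def q'_def intro!: add_pos_pos)
  \<comment> \<open>The factors \<open>p\<close>, \<open>p'\<close> involve only \<open>c\<close>
    and \<open>d\<close> and may stay constant, but \<open>q\<close> and \<open>q'\<close> grow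
    strictly in each of the four variables. Each product contains one of them.\<close>
  have less: "q a b c d < q a' b' c' d' \<and> q' a b c d < q' a' b' c' d'"
  proof -
    consider "a < a'" | "b < b'" | "c < c'" | "d < d'"
      using assms(7-) by fastforce
    then show ?thesis
    proof cases
      case 1
      then show ?thesis
        using le mono by (auto simp: q_def q'_def intro: add_le_less_mono add_less_le_mono)
    next
      case 2
      then show ?thesis
        using le strict(1,2) assms(7) by (auto simp: q_def q'_def intro!: add_le_less_mono)
    next
      case 3
      then have "p c d < p c' d'" "p' c d < p' c' d'"
        using mono assms(2) by (auto simp: p_def p'_def intro!: divide_strict_right_mono add_less_le_mono)
      then show ?thesis
        using mono assms(7) by (auto simp: q_def q'_def intro!: add_less_le_mono)
    next
      case 4
      then have "p c d < p c' d'" "p' c d < p' c' d'"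
        using strict(3,4) assms(2,9) by (auto simp: p_def p'_def intro!: divide_strict_right_mono add_le_less_mono)
      then show ?thesis
        using mono assms(7) by (auto simp: q_def q'_def intro!: add_less_le_mono)
    qed
  qed
  have "p c d * q' a b c d < p c' d' * q' a' b' c' d'"
    by (rule mult_le_less_imp_less) (use le less pos qpos in auto)
  moreover have "q a b c d * p' c d < q a' b' c' d' * p' c' d'"
    by (rule mult_less_le_imp_less) (use le less pos qpos in auto)
  ultimately have "sqrt (p c d * q' a b c d) + sqrt (q a b c d * p' c d) <
      sqrt (p c' d' * q' a' b' c' d') + sqrt (q a' b' c' d' * p' c' d')"
    by (intro add_strict_mono real_sqrt_less_mono)
  then have "(sqrt (p c d * q' a b c d) + sqrt (q a b c d * p' c d)) / w <
      (sqrt (p c' d' * q' a' b' c' d') + sqrt (q a' b' c' d' * p' c' d')) / w"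
    using w by (rule divide_strict_right_mono)
  then show ?thesis
    by (simp add: transversal_cosh_def Let_def w_def r_def p_def p'_def q_def q'_def)
qed

text \<open>The planes of \<open>n\<close> and \<open>m\<close> carry the edge, that of
  \<open>k\<close> carries the ray toward \<open>x\<close>.\<close>

locale wall_triple = NM: wall_pair n m x + NK: wall_pair n k x + MK: wall_pair m k x for n m k x
begin

abbreviation "lam \<equiv> NM.edge.gam"
abbreviation "mu \<equiv> NK.M.ray.gam"

definition "cf1 = - lor NM.edge_end NK.M.ray_end"
definition "cf2 = - lor NM.edge_end NK.M.ray_start"
definition "cf3 = - lor NM.edge_start NK.M.ray_end"
definition "cf4 = - lor NM.edge_start NK.M.ray_start"

lemma cosh_dH_lam_mu: "cosh (dH (lam S) (mu T)) = dist_form cf1 cf2 cf3 cf4 S T"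
  using cosh_dH[OF NM.edge.gam_in_hyp3 NK.M.ray.gam_in_hyp3]
  by (simp add: dist_form_def NM.edge.gam_def NK.M.ray.gam_def cf1_def cf2_def cf3_def cf4_def
      exp_add exp_diff exp_minus algebra_simps divide_inverse)

lemma cf_eqs:
  "cf1 = (lor n x + NM.ratio * lor m x) / (2 * lor k x) / (2 * NM.width)"
  "cf2 = ((lor n x + NM.ratio * lor m x) / (2 * lor k x) - lor n k - NM.ratio * lor m k) / (2 * NM.width)"
  "cf3 = (lor n x + lor m x / NM.ratio) / (2 * lor k x) / (2 * NM.width)"
  "cf4 = ((lor n x + lor m x / NM.ratio) / (2 * lor k x) - lor n k - lor m k / NM.ratio) / (2 * NM.width)"
  by (simp_all add: cf1_def cf2_def cf3_def cf4_def NM.lor_edge_ends NK.M.lor_ray_ends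
      diff_divide_distrib add_divide_distrib algebra_simps)

text \<open>These comparisons locate the minimum: \<open>cf_less\<close> gives
  \<open>S0 \<le> 0\<close> and \<open>T0 \<ge> 0\<close>, and \<open>cf_less_ratio\<close> gives
  \<open>- ln ratio \<le> S0\<close>. They hold because \<open>ratio > 1\<close> and because
  \<open>ray_start\<close> contributes the additional positive terms in \<open>a\<close> and
  \<open>b\<close>.\<close>

lemma cf_pos: "cf1 > 0" "cf2 > 0" "cf3 > 0" "cf4 > 0"
  and cf_less: "cf3 < cf1" "cf4 < cf2" "cf1 < cf2" "cf3 < cf4"
  and cf_less_ratio: "cf1 \<le> cf3 * NM.ratio\<^sup>2" "cf2 \<le> cf4 * NM.ratio\<^sup>2"
proof -
  define r where "r = NM.ratio"
  define w where "w = 2 * NM.width"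
  define y where "y = 2 * lor k x"
  define c where "c = lor n x"
  define d where "d = lor m x"
  define a where "a = - lor n k"
  define b where "b = - lor m k"
  have pos: "r > 1" "w > 0" "y > 0" "c > 0" "d > 0" "a > 0" "b > 0"
    using NM.ratio(1) NM.width(1) NM.N.nx NM.M.nx NK.M.nx NK.nm MK.nm
    by (simp_all add: r_def w_def y_def c_def d_def a_def b_def)
  have r2: "r * r > r"
    using pos by simp
  have cfs: "cf1 = (c + r * d) / y / w" "cf2 = ((c + r * d) / y + (a + r * b)) / w"
     "cf3 = (c + d / r) / y / w" "cf4 = ((c + d / r) / y + (a + b / r)) / w"
    by (simp_all add: cf_eqs r_def w_def y_def c_def d_def a_def b_def)
  have P: "c + r * d > 0" "c + d / r > 0" "a + r * b > 0" "a + b / r > 0"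
    using pos by (auto intro!: add_pos_pos)
  have L: "d / r < r * d" "b / r < r * b"
  proof -
    have "d / r < d" "b / r < b" "d < r * d" "b < r * b"
      using pos by (simp_all add: field_simps)
    then show "d / r < r * d" "b / r < r * b"
      by linarith+
  qed
  show "cf1 > 0" "cf2 > 0" "cf3 > 0" "cf4 > 0"
    unfolding cfs using P pos by (auto intro!: divide_pos_pos add_pos_pos)
  have "(c + d / r) / y < (c + r * d) / y"
    using L pos by (intro divide_strict_right_mono) auto
  then show "cf3 < cf1" "cf4 < cf2"
    unfolding cfs using L pos by (intro divide_strict_right_mono[of _ _ w]; linarith)+
  show "cf1 < cf2" "cf3 < cf4"
    unfolding cfs using P pos by (intro divide_strict_right_mono[of _ _ w]; linarith)+
  \<comment> \<open>Term by term: \<open>r * d\<close> equals \<open>d / r * r\<^sup>2\<close>,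
    while \<open>c\<close> only grows under the factor \<open>r\<^sup>2\<close>.\<close>
  have "(c + r * d) \<le> (c + d / r) * r\<^sup>2" "(a + r * b) \<le> (a + b / r) * r\<^sup>2"
    using pos by (simp_all add: field_simps power2_eq_square)
      (metis less_1_mult less_eq_real_def mult.commute mult_le_cancel_left1 mult.right_neutral)+
  moreover from this have "(c + r * d) / y \<le> (c + d / r) / y * r\<^sup>2"
    using pos by (simp add: divide_right_mono)
  ultimately show "cf1 \<le> cf3 * NM.ratio\<^sup>2" "cf2 \<le> cf4 * NM.ratio\<^sup>2"
    unfolding cfs r_def[symmetric] using pos
    by (simp_all add: divide_right_mono distrib_right add_mono)
qed

definition "tcosh = transversal_cosh (- lor n m) (lor k x) (- lor n k) (- lor m k) (lor n x) (lor m x)"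

lemma tcosh_eq: "tcosh = 2 * sqrt (cf1 * cf4) + 2 * sqrt (cf2 * cf3)"
proof -
  let ?p = "(lor n x + NM.ratio * lor m x) / (2 * lor k x)"
  let ?p' = "(lor n x + lor m x / NM.ratio) / (2 * lor k x)"
  have tc: "tcosh = (sqrt (?p * (?p' - lor n k - lor m k / NM.ratio)) +
      sqrt ((?p - lor n k - NM.ratio * lor m k) * ?p')) / NM.width"
    by (simp add: tcosh_def transversal_cosh_def Let_def NM.ratio_def NM.width_def)
  have sq: "2 * sqrt (s / (2 * NM.width) * (t / (2 * NM.width))) = sqrt (s * t) / NM.width" for s t
  proof -
    have "s / (2 * NM.width) * (t / (2 * NM.width)) = (s * t) / (2 * NM.width)\<^sup>2"
      by (simp add: power2_eq_square)
    then have "sqrt (s / (2 * NM.width) * (t / (2 * NM.width))) = sqrt (s * t) / \<bar>2 * NM.width\<bar>"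
      by (simp only: real_sqrt_divide real_sqrt_abs)
    then show ?thesis
      using NM.width(1) by simp
  qed
  show ?thesis
    unfolding cf_eqs sq tc by (simp only: add_divide_distrib)
qed

lemma minimizer:
  obtains S0 T0 where
    "cf1 * exp (2 * (S0 + T0)) = cf4" "cf2 * exp (2 * (S0 - T0)) = cf3"
    "lam S0 \<in> shortest_arc (wall UNIV n) (wall UNIV m)" "mu T0 \<in> perp_ray_toward (wall UNIV k) x"
proof -
  obtain S0 T0 where z: "cf1 * exp (2 * (S0 + T0)) = cf4" "cf2 * exp (2 * (S0 - T0)) = cf3"
    using dist_form_minimizer[OF cf_pos] by blast
  define L where "L = ln NM.ratio"
  have L: "NM.ratio = exp L" "1 / NM.ratio = exp (- L)"
    using NM.ratio(1) by (simp_all add: L_def exp_minus inverse_eq_divide)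
  \<comment> \<open>The product of the two balance equations eliminates \<open>T0\<close>.\<close>
  have "(cf1 * cf2) * exp (4 * S0) = (cf1 * exp (2 * (S0 + T0))) * (cf2 * exp (2 * (S0 - T0)))"
    by (simp add: exp_add[symmetric] mult_ac)
  then have e4: "(cf1 * cf2) * exp (4 * S0) = cf3 * cf4"
    unfolding z by simp
  also have "\<dots> < (cf1 * cf2) * 1"
    using mult_strict_mono[OF cf_less(1,2)] cf_pos by simp
  finally have "exp (4 * S0) < 1"
    using cf_pos by (simp add: mult_less_cancel_left_pos)
  then have S0: "S0 \<le> 0"
    by simp
  \<comment> \<open>The same equation measured from the other foot of the edge, at
    \<open>- L\<close>.\<close>
  have "(cf1 * cf2) * exp (4 * (L + S0)) = (cf1 * cf2) * exp (4 * S0) * exp (4 * L)"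
    by (simp add: exp_add[symmetric] algebra_simps)
  also have "exp (4 * L) = NM.ratio\<^sup>2 * NM.ratio\<^sup>2"
    unfolding L(1) by (simp add: power2_eq_square exp_add[symmetric])
  also have "cf1 * cf2 * exp (4 * S0) * (NM.ratio\<^sup>2 * NM.ratio\<^sup>2) = (cf3 * NM.ratio\<^sup>2) * (cf4 * NM.ratio\<^sup>2)"
    unfolding e4 by simp
  also have "\<dots> \<ge> cf1 * cf2"
    using cf_less_ratio cf_pos by (intro mult_mono) auto
  finally have "exp (4 * (L + S0)) \<ge> 1"
    using cf_pos by (simp add: mult_le_cancel_left_pos)
  then have LS: "L + S0 \<ge> 0"
    by simp
  \<comment> \<open>The quotient of the balance equations, in multiplied form, eliminates
    \<open>S0\<close>.\<close>
  have "(cf1 * exp (2 * (S0 + T0))) * cf3 = cf4 * (cf2 * exp (2 * (S0 - T0)))"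
    using z by simp
  then have "(cf1 * exp (2 * (S0 + T0))) * cf3 * exp (2 * (T0 - S0)) =
      cf4 * (cf2 * exp (2 * (S0 - T0))) * exp (2 * (T0 - S0))"
    by simp
  then have "(cf1 * cf3) * exp (4 * T0) = cf2 * cf4"
    by (simp add: exp_add[symmetric] mult_ac)
  also have "\<dots> > (cf1 * cf3) * 1"
    using mult_strict_mono[OF cf_less(3,4)] cf_pos by simp
  finally have "exp (4 * T0) > 1"
    using cf_pos by (simp add: mult_less_cancel_left_pos)
  then have T0: "T0 \<ge> 0"
    by simp
  have "exp (L + S0) = NM.ratio * exp S0"
    by (simp only: L(1) exp_add)
  moreover have "exp (- (L + S0)) = exp (- S0) / NM.ratio"
  proof -
    have "exp (- (L + S0)) = exp (- L) * exp (- S0)"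
      by (simp add: exp_add[symmetric])
    then show ?thesis
      by (simp add: L(2)[symmetric])
  qed
  ultimately have "lor n (lam S0) = (exp (L + S0) - exp (- (L + S0))) / 2"
    by (simp only: NM.lor_edge_gam)
  moreover have "exp (- (L + S0)) \<le> exp (L + S0)"
    using LS by (simp only: exp_le_cancel_iff)
  ultimately have "lor n (lam S0) \<ge> 0"
    by (metis diff_ge_0_iff_ge divide_nonneg_nonneg zero_le_numeral)
  moreover have "lor m (lam S0) \<ge> 0"
    using S0 by (simp add: NM.lor_edge_gam)
  ultimately have "lam S0 \<in> shortest_arc (wall UNIV n) (wall UNIV m)"
    using NM.edge.range_gam unfolding NM.shortest_arc_walls NM.span_edge by blast
  moreover have "mu T0 \<in> perp_ray_toward (wall UNIV k) x"
    using NK.M.ray.range_gam NK.M.lor_ray_gam[of T0] T0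
    unfolding NK.M.perp_ray_toward_eq NK.M.span_ray by (auto simp: set_eq_iff)
  ultimately show thesis
    using that z by blast
qed

lemma transversal_exists:
  assumes g: "arclength_param g (common_perp (wall UNIV n) (wall UNIV m))"
    and h: "arclength_param h (perp_toward (wall UNIV k) x)"
  obtains s0 t0 where "\<And>z. critical_point (cosh_dist_fun g h) z \<longleftrightarrow> z = (s0, t0)"
    "\<And>s t. cosh_dist_fun g h (s0, t0) \<le> cosh_dist_fun g h (s, t)"
    "g s0 \<in> shortest_arc (wall UNIV n) (wall UNIV m)" "h t0 \<in> perp_ray_toward (wall UNIV k) x"
    "cosh_dist_fun g h (s0, t0) = tcosh"
proof -
  obtain e c where e: "e = 1 \<or> e = -1" and g_eq: "\<And>s. g s = lam (e * s + c)"
    using NM.edge.arclength_param_eq g unfolding NM.common_perp_eq NM.span_edge by blast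
  obtain f d where f: "f = 1 \<or> f = -1" and h_eq: "\<And>t. h t = mu (f * t + d)"
    using NK.M.ray.arclength_param_eq h unfolding NK.M.perp_toward_eq NK.M.span_ray by blast
  have D: "cosh_dist_fun g h = (\<lambda>(s, t). dist_form cf1 cf2 cf3 cf4 (e * s + c) (f * t + d))"
    by (simp add: cosh_dist_fun_def g_eq h_eq cosh_dH_lam_mu)
  obtain S0 T0 where z: "cf1 * exp (2 * (S0 + T0)) = cf4" "cf2 * exp (2 * (S0 - T0)) = cf3"
    and arc: "lam S0 \<in> shortest_arc (wall UNIV n) (wall UNIV m)"
    and ray: "mu T0 \<in> perp_ray_toward (wall UNIV k) x"
    by (rule minimizer)
  \<comment> \<open>The signs \<open>e\<close> and \<open>f\<close> are their own inverses, so this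
    undoes the reparametrization.\<close>
  define s0 where "s0 = e * (S0 - c)"
  define t0 where "t0 = f * (T0 - d)"
  have st: "e * s0 + c = S0" "f * t0 + d = T0"
    and st_iff: "e * s + c = S0 \<and> f * t + d = T0 \<longleftrightarrow> (s, t) = (s0, t0)" for s t
    using e f by (auto simp: s0_def t0_def)
  show thesis
  proof (rule that)
    show "critical_point (cosh_dist_fun g h) z \<longleftrightarrow> z = (s0, t0)" for z
      using dist_form_critical[OF cf_pos z e f, of c d "fst z" "snd z"]
      unfolding D st_iff by simp
    show "cosh_dist_fun g h (s0, t0) \<le> cosh_dist_fun g h (s, t)" for s t
      using dist_form_min(2)[OF cf_pos z] by (simp add: D st)
    show "g s0 \<in> shortest_arc (wall UNIV n) (wall UNIV m)" "h t0 \<in> perp_ray_toward (wall UNIV k) x"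
      using arc ray by (simp_all add: g_eq h_eq st)
    show "cosh_dist_fun g h (s0, t0) = tcosh"
      using dist_form_min(1)[OF cf_pos z] by (simp add: D st tcosh_eq)
  qed
qed

text \<open>The minimum over the whole geodesics is attained on the arc and the ray, so it is also
  the minimum over these subsets.\<close>

lemma cosh_transversal:
  "cosh (shortest_arc_length (shortest_arc (wall UNIV n) (wall UNIV m)) (perp_ray_toward (wall UNIV k) x)) = tcosh"
  "shortest_arc_length (shortest_arc (wall UNIV n) (wall UNIV m)) (perp_ray_toward (wall UNIV k) x) \<ge> 0"
proof -
  let ?A = "shortest_arc (wall UNIV n) (wall UNIV m)" and ?R = "perp_ray_toward (wall UNIV k) x"
  have g: "arclength_param lam (common_perp (wall UNIV n) (wall UNIV m))"
    using NM.edge.arclength_param_gam by (simp add: NM.common_perp_eq NM.span_edge)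
  have h: "arclength_param mu (perp_toward (wall UNIV k) x)"
    using NK.M.ray.arclength_param_gam by (simp add: NK.M.perp_toward_eq NK.M.span_ray)
  obtain s0 t0 where min: "\<And>s t. cosh_dist_fun lam mu (s0, t0) \<le> cosh_dist_fun lam mu (s, t)"
    and mem: "lam s0 \<in> ?A" "mu t0 \<in> ?R" and val: "cosh_dist_fun lam mu (s0, t0) = tcosh"
    using transversal_exists[OF g h] by metis
  have hyp: "lam s \<in> hyp3" "mu s \<in> hyp3" for s
    by (rule NM.edge.gam_in_hyp3, rule NK.M.ray.gam_in_hyp3)
  have "?A \<subseteq> range lam" "?R \<subseteq> range mu"
    unfolding NM.shortest_arc_walls NM.span_edge NM.edge.range_gam[symmetric]
      NK.M.perp_ray_toward_eq NK.M.span_ray NK.M.ray.range_gam[symmetric] by auto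
  moreover have "dH (lam s0) (mu t0) \<le> dH (lam s) (mu t)" for s t
    using min[of s t] hyp dH_nonneg by (simp add: cosh_dist_fun_def cosh_real_nonneg_le_iff)
  ultimately have "nearest_points ?A ?R (lam s0) (mu t0)"
    using mem unfolding nearest_points_def by blast
  then have len: "shortest_arc_length ?A ?R = dH (lam s0) (mu t0)"
    by (rule shortest_arc_length_eqI)
  show "cosh (shortest_arc_length ?A ?R) = tcosh"
    using val by (simp add: len cosh_dist_fun_def)
  show "shortest_arc_length ?A ?R \<ge> 0"
    using dH_nonneg hyp by (simp add: len)
qed

end

section \<open>Truncation planes\<close>

lemma is_planeE:
  assumes "is_plane Q"
  obtains V v where "subspace V" "dim V = 3" "v \<in> V" "lor v v < 0" "Q = V \<inter> hyp3"
  using assms by (auto simp: is_plane_def time_like_def)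

lemma is_plane_span:
  "dim S = 3 \<Longrightarrow> v \<in> span S \<Longrightarrow> lor v v < 0 \<Longrightarrow> is_plane (span S \<inter> hyp3)"
  unfolding is_plane_def time_like_def using dim_span subspace_span by metis

text \<open>A vector outside \<open>U\<close> orients the normal. The negative sign is chosen
  because points of the edges have non-positive coefficients at the normals of the given
  planes.\<close>

lemma signed_normal:
  assumes U: "subspace U" "p \<in> U" "lor p p < 0" and V: "subspace V" "U \<subseteq> V"
    and dim: "dim V = Suc (dim U)" and w: "w \<in> V" "w \<notin> U"
  obtains \<nu> where "\<nu> \<in> V" "lor \<nu> \<nu> = 1" "U = {v \<in> V. lor \<nu> v = 0}" "lor \<nu> w < 0"
proof -
  obtain \<nu> where \<nu>: "\<nu> \<in> V" "lor \<nu> \<nu> = 1" "U = {v \<in> V. lor \<nu> v = 0}"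
    using codim1_normal[OF assms(1-6)] by blast
  with w consider "lor \<nu> w < 0" | "lor (- \<nu>) w < 0"
    by force
  then show thesis
  proof cases
    case 2
    have "- \<nu> \<in> V" "lor (- \<nu>) (- \<nu>) = 1" "U = {v \<in> V. lor (- \<nu>) v = 0}"
      using \<nu> V by (auto simp: subspace_neg)
    with 2 that show thesis
      by blast
  qed (use \<nu> that in blast)
qed

text \<open>A wall bounds exactly two halves, so a requirement met by one and violated by the other
  determines it.\<close>

lemma the_half:
  assumes "subspace V" "V \<inter> hyp3 \<noteq> {}" "\<nu> \<in> V" "lor \<nu> \<nu> = 1"
    and "R (half V \<nu>)" "\<not> R (half V (- \<nu>))"
  shows "(THE K. half_of (V \<inter> hyp3) (wall V \<nu>) K \<and> R K) = half V \<nu>"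
  unfolding half_of_iff[OF assms(1-4)] using assms(5,6) by (intro the_equality) blast+

lemma in_half: "v \<in> half V \<nu> \<longleftrightarrow> v \<in> V \<and> v \<in> hyp3 \<and> lor \<nu> v \<ge> 0"
  by (auto simp: half_def)

context wall_pair
begin

lemma dim_span_x: "dim {x, n, m} = 3"
  using x_not_span dim_span_pair[OF n_not_span_m(2,1)] by (simp add: dim_insert)

lemma n_not_span_m_x: "n \<notin> span {m, x}"
proof
  assume "n \<in> span {m, x}"
  then obtain a b where ab: "n = a *\<^sub>R m + b *\<^sub>R x"
    using in_span_pair by blast
  show False
  proof (cases "b = 0")
    case True
    then have "n \<in> span {m}"
      using ab by (auto simp: in_span_singleton)
    with n_not_span_m show False by simp
  next
    case False
    then have "x = (1 / b) *\<^sub>R n + (- a / b) *\<^sub>R m"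
      by (simp add: ab algebra_simps)
    with x_not_span in_span_pair show False
      by blast
  qed
qed

lemma timelike_span_x: "n + m \<in> span {x, n, m}"
  using timelike_sum(1) span_mono[of "{n, m}" "{x, n, m}"] by blast

text \<open>The conditions put \<open>x\<close>, \<open>n\<close> and \<open>m\<close> into the
  three-dimensional span of the plane, and these vectors are independent. This is the existence and
  uniqueness of a truncating plane.\<close>

lemma perp_plane_iff:
  "is_plane Q \<and> planes_perp Q (wall UNIV n) \<and> planes_perp Q (wall UNIV m) \<and> x \<in> ideal_boundary Q
    \<longleftrightarrow> Q = span {x, n, m} \<inter> hyp3"
proof
  assume Q: "is_plane Q \<and> planes_perp Q (wall UNIV n) \<and> planes_perp Q (wall UNIV m) \<and> x \<in> ideal_boundary Q"
  then obtain V v where V: "subspace V" "dim V = 3" "v \<in> V" "lor v v < 0" "Q = V \<inter> hyp3"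
    using is_planeE by blast
  have "n \<in> V" "m \<in> V" "x \<in> V"
    using Q planes_perp_wall_iff[OF V(1-4)] N.nn M.nn span_hyp3[OF V(1,3,4)]
    by (auto simp: V(5) ideal_boundary_def)
  then have "V = span {x, n, m}"
    using V dim_span_x by (intro span_eqI_dim) auto
  then show "Q = span {x, n, m} \<inter> hyp3"
    using V by simp
next
  assume Q: "Q = span {x, n, m} \<inter> hyp3"
  have d: "dim (span {x, n, m}) = 3"
    using dim_span_x by simp
  have "x \<in> span {x, n, m}" "n \<in> span {x, n, m}" "m \<in> span {x, n, m}"
    by (auto intro: span_base)
  then show "is_plane Q \<and> planes_perp Q (wall UNIV n) \<and> planes_perp Q (wall UNIV m) \<and> x \<in> ideal_boundary Q"
    unfolding Q ideal_boundary_def span_hyp3[OF subspace_span timelike_span_x timelike_sum(2)]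
    using planes_perp_wall_iff[OF subspace_span d timelike_span_x timelike_sum(2)] N.nn M.nn N.x
      is_plane_span[OF dim_span_x timelike_span_x timelike_sum(2)] by simp
qed

end

context wall_triple
begin

text \<open>Geometrically, of three disjoint planes perpendicular to one geodesic the middle one
  would separate the others. In coordinates, the norm of \<open>k\<close> makes one coefficient
  negative, then both are, and \<open>a < X * b < b\<close> contradicts
  \<open>b < X * a < a\<close>.\<close>

lemma k_not_span: "k \<notin> span {n, m}"
proof
  assume "k \<in> span {n, m}"
  then obtain a b where k: "k = a *\<^sub>R n + b *\<^sub>R m"
    using in_span_pair by blast
  define X where "X = - lor n m"
  have X: "X > 1"
    using NM.nm by (simp add: X_def)
  have nk: "lor n k = a - X * b" and mk: "lor m k = b - X * a"
    using NM.N.nn NM.M.nn NM.mn by (simp_all add: k X_def)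
  have "a * lor n k + b * lor m k = lor k k"
    by (subst (3) k) simp
  then have 1: "a * lor n k + b * lor m k = 1"
    using NK.M.nn by simp
  have "a < X * b" "b < X * a"
    using NK.nm MK.nm nk mk by simp_all
  moreover have "a < 0 \<or> b < 0"
  proof (rule ccontr)
    assume "\<not> ?thesis"
    then have "a * lor n k \<le> 0" "b * lor m k \<le> 0"
      using NK.nm MK.nm by (auto intro!: mult_nonneg_nonpos)
    with 1 show False by simp
  qed
  ultimately have neg: "a < 0" "b < 0"
    using X by (smt (verit) mult_nonneg_nonneg mult_pos_neg)+
  then have "X * a < a" "X * b < b"
    using X by (simp_all add: mult_less_cancel_right1)
  with \<open>a < X * b\<close> \<open>b < X * a\<close> show False
    by linarith
qed

lemma dim_span_normals: "dim {k, n, m} = 3"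
  using k_not_span dim_span_pair[OF NM.n_not_span_m(2,1)] by (simp add: dim_insert)

lemma timelike_span_normals: "n + m \<in> span {k, n, m}"
  using NM.timelike_sum(1) span_mono[of "{n, m}" "{k, n, m}"] by blast

lemma perp_plane4_iff:
  "is_plane Q \<and> planes_perp Q (wall UNIV n) \<and> planes_perp Q (wall UNIV m) \<and> planes_perp Q (wall UNIV k)
    \<longleftrightarrow> Q = span {k, n, m} \<inter> hyp3"
proof
  assume Q: "is_plane Q \<and> planes_perp Q (wall UNIV n) \<and> planes_perp Q (wall UNIV m) \<and> planes_perp Q (wall UNIV k)"
  then obtain V v where V: "subspace V" "dim V = 3" "v \<in> V" "lor v v < 0" "Q = V \<inter> hyp3"
    using is_planeE by blast
  have "n \<in> V" "m \<in> V" "k \<in> V"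
    using Q planes_perp_wall_iff[OF V(1-4)] NM.N.nn NM.M.nn NK.M.nn
    by (auto simp: V(5))
  then have "V = span {k, n, m}"
    using V dim_span_normals by (intro span_eqI_dim) auto
  then show "Q = span {k, n, m} \<inter> hyp3"
    using V by simp
next
  assume Q: "Q = span {k, n, m} \<inter> hyp3"
  have d: "dim (span {k, n, m}) = 3"
    using dim_span_normals by simp
  have "k \<in> span {k, n, m}" "n \<in> span {k, n, m}" "m \<in> span {k, n, m}"
    by (auto intro: span_base)
  then show "is_plane Q \<and> planes_perp Q (wall UNIV n) \<and> planes_perp Q (wall UNIV m) \<and> planes_perp Q (wall UNIV k)"
    unfolding Q
    using planes_perp_wall_iff[OF subspace_span d timelike_span_normals NM.timelike_sum(2)]
      NM.N.nn NM.M.nn NK.M.nn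
      is_plane_span[OF dim_span_normals timelike_span_normals NM.timelike_sum(2)] by simp
qed

text \<open>In a relation among the four vectors, \<open>x\<close> and \<open>k\<close> both occur,
  since neither lies in \<open>span {n, m}\<close>; hence each can be solved for. This makes
  degeneracy symmetric in the planes.\<close>

lemma coplanar_iff: "k \<in> span {x, n, m} \<longleftrightarrow> x \<in> span {k, n, m}"
proof
  assume "k \<in> span {x, n, m}"
  then obtain a b c where k: "k = a *\<^sub>R x + b *\<^sub>R n + c *\<^sub>R m"
    using in_span_triple by blast
  have "a \<noteq> 0"
  proof
    assume "a = 0"
    then have "k \<in> span {n, m}"
      using k by (auto simp: in_span_pair)
    with k_not_span show False by simp
  qed
  then have "x = (1 / a) *\<^sub>R k + (- b / a) *\<^sub>R n + (- c / a) *\<^sub>R m"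
    by (simp add: k algebra_simps)
  then show "x \<in> span {k, n, m}"
    using in_span_triple by blast
next
  assume "x \<in> span {k, n, m}"
  then obtain a b c where x: "x = a *\<^sub>R k + b *\<^sub>R n + c *\<^sub>R m"
    using in_span_triple by blast
  have "a \<noteq> 0"
  proof
    assume "a = 0"
    then have "x \<in> span {n, m}"
      using x by (auto simp: in_span_pair)
    with NM.x_not_span show False by simp
  qed
  then have "k = (1 / a) *\<^sub>R x + (- b / a) *\<^sub>R n + (- c / a) *\<^sub>R m"
    by (simp add: x algebra_simps)
  then show "k \<in> span {x, n, m}"
    using in_span_triple by blast
qed

text \<open>Two positive coefficients would make \<open>c\<close> negative by
  \<open>lor x x = 0\<close>, and then \<open>lor k x\<close> negative. If none were positive,
  \<open>lor x x\<close> would be negative. Applied to every order of the normals, this leaves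
  exactly one positive coefficient.\<close>

lemma coplanar_coefficients:
  assumes xs: "x = a *\<^sub>R n + b *\<^sub>R m + c *\<^sub>R k"
  shows "c \<noteq> 0" "\<not> (a > 0 \<and> b > 0)" "a > 0 \<or> b > 0 \<or> c > 0"
proof -
  have "lor x x = a * lor n x + b * lor m x + c * lor k x"
    by (subst (1) xs) simp
  then have 0: "a * lor n x + b * lor m x + c * lor k x = 0"
    using NM.N.xx by simp
  show c0: "c \<noteq> 0"
  proof
    assume "c = 0"
    then have "x \<in> span {n, m}"
      using xs by (auto simp: in_span_pair)
    with NM.x_not_span show False by simp
  qed
  show "\<not> (a > 0 \<and> b > 0)"
  proof
    assume ab: "a > 0 \<and> b > 0"
    then have "c * lor k x < 0"
      using 0 NM.N.nx NM.M.nx by (smt (verit) mult_pos_pos)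
    then have c: "c < 0"
      using NK.M.nx by (simp add: mult_less_0_iff)
    have "lor k x = a * lor n k + b * lor m k + c"
      using NK.M.nn by (subst xs) (simp add: lor_commute)
    moreover have "a * lor n k < 0" "b * lor m k < 0"
      using ab NK.nm MK.nm by (auto intro: mult_pos_neg)
    ultimately show False
      using c NK.M.nx by linarith
  qed
  show "a > 0 \<or> b > 0 \<or> c > 0"
  proof (rule ccontr)
    assume "\<not> ?thesis"
    then have "a * lor n x \<le> 0" "b * lor m x \<le> 0" "c * lor k x < 0"
      using c0 NM.N.nx NM.M.nx NK.M.nx by (auto intro!: mult_nonpos_nonneg mult_neg_pos)
    with 0 show False
      by linarith
  qed
qed

end

text \<open>A geodesic \<open>\<nu> = 0\<close> of the plane \<open>W\<close> that stays in the open half-space of \<open>k\<close> has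
  the geodesic \<open>wall W k\<close> on the side opposite to \<open>k\<close>: move \<open>v\<close> along \<open>\<nu>\<close> to
  \<open>\<nu> = 0\<close> and compare the values of \<open>lor k\<close>.\<close>
lemma wall_opposite_side:
  assumes W: "subspace W" and \<nu>: "\<nu> \<in> W" "lor \<nu> \<nu> = 1"
    and line: "\<And>u. u \<in> W \<Longrightarrow> u \<in> hyp3 \<Longrightarrow> lor \<nu> u = 0 \<Longrightarrow> lor k u > 0"
    and neg: "lor \<nu> k < 0"
    and v: "v \<in> W" "v \<in> hyp3" "lor k v = 0"
  shows "lor \<nu> v > 0"
proof -
  define u where "u = v - lor \<nu> v *\<^sub>R \<nu>"
  have vv: "lor v v = -1"
    using v by (simp add: hyp3_def)
  have uu: "lor u u < 0" "lor \<nu> u = 0"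
    using lor_orth_unit_timelike[OF \<nu>(2), of v] vv by (simp_all add: u_def)
  have "lor u v = -1 - lor \<nu> v * lor \<nu> v"
    using vv by (simp add: u_def)
  then have "lor u v < 0"
    by (smt (verit) zero_le_square)
  then have "u$1 > 0"
    using causal_positiveI[of u v] uu v by (simp add: hyp3_def)
  then have "(1 / sqrt (- lor u u)) *\<^sub>R u \<in> hyp3"
    using normalize_timelike uu by blast
  moreover have "u \<in> W"
    using W \<nu> v by (simp add: u_def subspace_diff subspace_scale)
  ultimately have "lor k ((1 / sqrt (- lor u u)) *\<^sub>R u) > 0"
    by (intro line) (simp_all add: uu W subspace_scale)
  then have "lor k u > 0"
    using uu by (simp add: zero_less_divide_iff)
  then have "lor \<nu> v * lor \<nu> k < 0"
    using v by (simp add: u_def lor_commute[of k \<nu>])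
  then show ?thesis
    using neg by (simp add: mult_less_0_iff)
qed

section \<open>Partially truncated tetrahedra\<close>

lemma permD:
  assumes "{a, b, c} = {1, 2, 3::nat}"
  shows "a \<noteq> b" "a \<noteq> c" "b \<noteq> c" "a \<in> {1, 2, 3}" "b \<in> {1, 2, 3}" "c \<in> {1, 2, 3}"
proof -
  have "card {a, b, c} = 3"
    unfolding assms by simp
  then show "a \<noteq> b" "a \<noteq> c" "b \<noteq> c"
    by (auto simp: card_insert_if split: if_splits)
qed (use assms in blast)+

text \<open>The assumption \<open>triple\<close> holds for every order of the indices, so each
  statement is proved for one labelling and instantiated for the others.\<close>

locale tetrahedron =
  fixes P H :: "nat \<Rightarrow> (real^4) set" and n :: "nat \<Rightarrow> real^4" and x :: "real^4"
  assumes P: "i \<in> {1, 2, 3} \<Longrightarrow> P i = wall UNIV (n i)"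
    and H: "i \<in> {1, 2, 3} \<Longrightarrow> H i = half UNIV (n i)"
    and triple: "{i, j, k} = {1, 2, 3} \<Longrightarrow> wall_triple (n i) (n j) (n k) x"
begin

lemma trunc_plane_eq:
  assumes p: "{i, j, k} = {1, 2, 3}"
  shows "trunc_plane P x i = span {x, n j, n k} \<inter> hyp3"
proof -
  interpret wall_triple "n j" "n k" "n i" x
    using p by (intro triple) auto
  have "(\<forall>l\<in>{1, 2, 3}. l \<noteq> i \<longrightarrow> planes_perp Q (P l)) \<longleftrightarrow>
      planes_perp Q (wall UNIV (n j)) \<and> planes_perp Q (wall UNIV (n k))" for Q
    unfolding p[symmetric] using permD[OF p] P by auto
  then show ?thesis
    unfolding trunc_plane_def using NM.perp_plane_iff by simp
qed

lemma trunc_plane4_eq: "trunc_plane4 P = span (n ` {1, 2, 3}) \<inter> hyp3"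
proof -
  interpret wall_triple "n 1" "n 2" "n 3" x
    by (intro triple) auto
  show ?thesis
    unfolding trunc_plane4_def using perp_plane4_iff P by (simp add: insert_commute)
qed

lemma perm_span: "{i, j, k} = {1, 2, 3} \<Longrightarrow> span {n i, n j, n k} = span (n ` {1, 2, 3})"
  by (metis image_empty image_insert)

definition "degenerate \<longleftrightarrow> x \<in> span (n ` {1, 2, 3})"

lemma degenerate_perm: "{i, j, k} = {1, 2, 3} \<Longrightarrow> n i \<in> span {x, n j, n k} \<longleftrightarrow> degenerate"
proof -
  assume p: "{i, j, k} = {1, 2, 3}"
  interpret wall_triple "n j" "n k" "n i" x
    using p by (intro triple) auto
  show ?thesis
    using coplanar_iff perm_span[OF p] by (simp add: degenerate_def)
qed

lemma degenerate_iff: "planes_perp (trunc_plane P x 1) (P 1) \<longleftrightarrow> degenerate"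
proof -
  interpret wall_triple "n 2" "n 3" "n 1" x
    by (intro triple) auto
  have d: "dim (span {x, n 2, n 3}) = 3"
    using NM.dim_span_x by simp
  show ?thesis
    using planes_perp_wall_iff[OF subspace_span d NM.timelike_span_x NM.timelike_sum(2) NK.M.nn]
      degenerate_perm[of 1 2 3] P trunc_plane_eq[of 1 2 3] by simp
qed

text \<open>On the edges at \<open>P i\<close> the functional \<open>\<nu>\<close> sees only the
  term in \<open>n i\<close>, whose coefficient is negative there.\<close>

lemma trunc_half_eq:
  assumes p: "{i, j, k} = {1, 2, 3}" and nc: "\<not> degenerate"
  obtains \<nu> where "trunc_half P x i = half UNIV \<nu>" "lor \<nu> x = 0" "lor \<nu> (n j) = 0" "lor \<nu> (n k) = 0"
    "lor \<nu> (n i) < 0"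
proof -
  interpret wall_triple "n j" "n k" "n i" x
    using p by (intro triple) auto
  let ?W = "span {x, n j, n k}"
  have "n i \<notin> ?W"
    using degenerate_perm[OF p] nc by simp
  then obtain \<nu> where \<nu>: "lor \<nu> \<nu> = 1" "?W = {v. lor \<nu> v = 0}" "lor \<nu> (n i) < 0"
    using signed_normal[OF subspace_span NM.timelike_span_x NM.timelike_sum(2) subspace_UNIV, of "n i"]
      NM.dim_span_x by auto
  have W: "?W \<inter> hyp3 = wall UNIV \<nu>"
    unfolding \<nu>(2) wall_def by auto
  have "x \<in> ?W" "n j \<in> ?W" "n k \<in> ?W"
    by (auto intro: span_base)
  then have 0: "lor \<nu> x = 0" "lor \<nu> (n j) = 0" "lor \<nu> (n k) = 0"
    unfolding \<nu>(2) by auto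
  have R: "(\<forall>l\<in>{1, 2, 3}. l \<noteq> i \<longrightarrow> shortest_arc (P l) (P i) \<subseteq> K) \<and> perp_ray_toward (P i) x \<subseteq> K \<longleftrightarrow>
      shortest_arc (wall UNIV (n j)) (wall UNIV (n i)) \<subseteq> K \<and>
      shortest_arc (wall UNIV (n k)) (wall UNIV (n i)) \<subseteq> K \<and> perp_ray_toward (wall UNIV (n i)) x \<subseteq> K" for K
    unfolding p[symmetric] using permD[OF p] P by auto
  have "trunc_half P x i = half UNIV \<nu>"
    unfolding trunc_half_def trunc_plane_eq[OF p] R W
  proof (rule the_half[OF subspace_UNIV hyp3_nonempty UNIV_I \<nu>(1), simplified])
    have arc: "shortest_arc (wall UNIV (n l)) (wall UNIV (n i)) \<subseteq> half UNIV \<nu>"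
      if l: "wall_pair (n l) (n i) x" "lor \<nu> (n l) = 0" for l
    proof
      interpret wall_pair "n l" "n i" x by fact
      fix v assume "v \<in> shortest_arc (wall UNIV (n l)) (wall UNIV (n i))"
      then have "v \<in> span {n l, n i}" "v \<in> hyp3"
        unfolding shortest_arc_walls by auto
      then obtain e f where "f > 0" "v = - (e *\<^sub>R n l + f *\<^sub>R n i)"
        using common_perp_point by blast
      then show "v \<in> half UNIV \<nu>"
        using \<open>v \<in> hyp3\<close> l \<nu>(3) by (simp add: in_half mult_nonneg_nonpos)
    qed
    have ray: "perp_ray_toward (wall UNIV (n i)) x \<subseteq> half UNIV \<nu>"
    proof
      fix v assume "v \<in> perp_ray_toward (wall UNIV (n i)) x"
      then have v: "v \<in> span {n i, x}" "v \<in> hyp3"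
        unfolding NK.M.perp_ray_toward_eq by auto
      then obtain e f where "f > 0" "v = e *\<^sub>R x - f *\<^sub>R n i"
        using NK.M.perp_toward_point by blast
      then show "v \<in> half UNIV \<nu>"
        using v 0 \<nu>(3) by (simp add: in_half mult_nonneg_nonpos)
    qed
    show "shortest_arc (wall UNIV (n j)) (wall UNIV (n i)) \<subseteq> half UNIV \<nu> \<and>
        shortest_arc (wall UNIV (n k)) (wall UNIV (n i)) \<subseteq> half UNIV \<nu> \<and>
        perp_ray_toward (wall UNIV (n i)) x \<subseteq> half UNIV \<nu>"
      using arc[OF NK.wall_pair_axioms 0(2)] arc[OF MK.wall_pair_axioms 0(3)] ray by simp
    \<comment> \<open>The starting point of the ray is strictly positive, which rules out the
      opposite half.\<close>
    have "NK.M.light_foot \<in> perp_ray_toward (wall UNIV (n i)) x"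
      using NK.M.light_foot by (simp add: NK.M.perp_ray_toward_eq)
    moreover have "lor \<nu> NK.M.light_foot > 0"
      using 0 \<nu>(3) by (simp add: NK.M.light_foot_def)
    ultimately show "\<not> (shortest_arc (wall UNIV (n j)) (wall UNIV (n i)) \<subseteq> half UNIV (- \<nu>) \<and>
        shortest_arc (wall UNIV (n k)) (wall UNIV (n i)) \<subseteq> half UNIV (- \<nu>) \<and>
        perp_ray_toward (wall UNIV (n i)) x \<subseteq> half UNIV (- \<nu>))"
      by (auto simp: in_half dest!: subsetD)
  qed
  then show thesis
    using that 0 \<nu>(3) by blast
qed

lemma trunc_half4_eq:
  assumes nc: "\<not> degenerate"
  obtains \<nu> where "trunc_half4 P x = half UNIV \<nu>" "lor \<nu> x > 0" "\<And>l. l \<in> {1, 2, 3} \<Longrightarrow> lor \<nu> (n l) = 0"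
proof -
  interpret wall_triple "n 2" "n 3" "n 1" x
    by (intro triple) auto
  let ?W = "span (n ` {1, 2, 3})"
  have tl: "n 2 + n 3 \<in> ?W" and d: "dim ?W = 3"
    using timelike_span_normals dim_span_normals by simp_all
  have "- x \<notin> ?W"
    using nc span_neg[of "- x" "n ` {1, 2, 3}"] by (auto simp: degenerate_def)
  \<comment> \<open>Orientation by \<open>- x\<close>, so that \<open>x\<close> itself is on the
    positive side.\<close>
  then obtain \<nu> where \<nu>: "lor \<nu> \<nu> = 1" "?W = {v. lor \<nu> v = 0}" "lor \<nu> (- x) < 0"
    using signed_normal[OF subspace_span tl NM.timelike_sum(2) subspace_UNIV, of "- x"] d by auto
  have W: "?W \<inter> hyp3 = wall UNIV \<nu>"
    unfolding \<nu>(2) wall_def by auto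
  have 0: "lor \<nu> (n l) = 0" if "l \<in> {1, 2, 3}" for l
    using span_base[of "n l" "n ` {1, 2, 3}"] that unfolding \<nu>(2) by auto
  have pos: "lor \<nu> v > 0" if l: "l \<in> {1, 2, 3}" and v: "v \<in> perp_toward (P l) x" for l v
  proof -
    interpret L: wall_light "n l" x
      using l NM.N.wall_light_axioms NM.M.wall_light_axioms NK.M.wall_light_axioms by auto
    have "v \<in> span {n l, x}" "v \<in> hyp3"
      using v unfolding P[OF l] L.perp_toward_eq by auto
    then obtain e f where "e > 0" "v = e *\<^sub>R x - f *\<^sub>R n l"
      using L.perp_toward_point by blast
    then show ?thesis
      using 0 l \<nu>(3) by simp
  qed
  have hyp: "perp_toward (P l) x \<subseteq> hyp3" "perp_toward (P l) x \<noteq> {}" if l: "l \<in> {1, 2, 3}" for l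
  proof -
    interpret L: wall_light "n l" x
      using l NM.N.wall_light_axioms NM.M.wall_light_axioms NK.M.wall_light_axioms by auto
    show "perp_toward (P l) x \<subseteq> hyp3" "perp_toward (P l) x \<noteq> {}"
      using P[OF l] L.light_foot(1,3) by (auto simp: L.perp_toward_eq)
  qed
  have "trunc_half4 P x = half UNIV \<nu>"
    unfolding trunc_half4_def trunc_plane4_eq W
  proof (rule the_half[OF subspace_UNIV hyp3_nonempty UNIV_I \<nu>(1), simplified Int_UNIV_left])
    show "\<forall>j\<in>{1, 2, 3}. perp_toward (P j) x \<subseteq> half UNIV \<nu>"
    proof (intro ballI subsetI)
      fix l v assume l: "l \<in> {1, 2, 3}" and v: "v \<in> perp_toward (P l) x"
      then show "v \<in> half UNIV \<nu>"
        using pos[OF l v] hyp(1)[OF l] by (auto simp only: in_half)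
    qed
    obtain v where v: "v \<in> perp_toward (P 1) x"
      using hyp[of 1] by auto
    then have "v \<notin> half UNIV (- \<nu>)"
      using pos[of 1 v] by (simp add: in_half)
    then show "\<not> (\<forall>j\<in>{1, 2, 3}. perp_toward (P j) x \<subseteq> half UNIV (- \<nu>))"
      using v by blast
  qed
  then show thesis
    using that 0 \<nu>(3) by simp
qed

lemma trunc_half_cone:
  assumes nc: "\<not> degenerate" and v: "v \<in> hyp3" "v = e *\<^sub>R x - (\<Sum>l\<in>{1, 2, 3}. f l *\<^sub>R n l)"
    and f: "\<And>l. l \<in> {1, 2, 3} \<Longrightarrow> f l \<ge> 0" and i: "i \<in> {1, 2, 3}"
  shows "v \<in> trunc_half P x i"
proof -
  obtain j k where p: "{i, j, k} = {1, 2, 3}"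
    using i by (auto intro: that[of 2 3] that[of 1 3] that[of 1 2])
  obtain \<nu> where \<nu>: "trunc_half P x i = half UNIV \<nu>" "lor \<nu> x = 0" "lor \<nu> (n j) = 0"
      "lor \<nu> (n k) = 0" "lor \<nu> (n i) < 0"
    using trunc_half_eq[OF p nc] by metis
  have "v = e *\<^sub>R x - (f i *\<^sub>R n i + (f j *\<^sub>R n j + f k *\<^sub>R n k))"
    unfolding v(2) p[symmetric] using permD[OF p] by simp
  then have "lor \<nu> v = - (f i * lor \<nu> (n i))"
    by (simp add: \<nu>)
  moreover have "f i * lor \<nu> (n i) \<le> 0"
    using f[OF i] \<nu>(5) by (simp add: mult_nonneg_nonpos)
  ultimately show ?thesis
    using v(1) by (simp add: \<nu>(1) in_half)
qed

lemma trunc_half4_cone: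
  assumes nc: "\<not> degenerate" and v: "v \<in> hyp3" "v = e *\<^sub>R x - (\<Sum>l\<in>{1, 2, 3}. f l *\<^sub>R n l)" and e: "e \<ge> 0"
  shows "v \<in> trunc_half4 P x"
proof -
  obtain \<nu> where \<nu>: "trunc_half4 P x = half UNIV \<nu>" "lor \<nu> x > 0" "\<And>l. l \<in> {1, 2, 3} \<Longrightarrow> lor \<nu> (n l) = 0"
    using trunc_half4_eq[OF nc] by metis
  have "lor \<nu> v = e * lor \<nu> x"
    unfolding v(2) using \<nu>(3) by simp
  then show ?thesis
    using v(1) e \<nu>(2) by (simp add: \<nu>(1) in_half)
qed

section \<open>The degenerate case, inside the plane that contains the tetrahedron\<close>

definition "W = span (n ` {1, 2, 3})"

lemma W: "subspace W" "dim W = 3" "W \<inter> hyp3 \<noteq> {}" "i \<in> {1, 2, 3} \<Longrightarrow> n i \<in> W"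
proof -
  interpret wall_triple "n 2" "n 3" "n 1" x
    by (intro triple) auto
  show "subspace W" "i \<in> {1, 2, 3} \<Longrightarrow> n i \<in> W"
    by (auto simp: W_def intro: span_base)
  have tl: "n 2 + n 3 \<in> W" and d: "dim W = 3"
    using timelike_span_normals dim_span_normals by (simp_all add: W_def)
  show "dim W = 3" by (rule d)
  show "W \<inter> hyp3 \<noteq> {}"
    by (rule timelike_imp_hyp3_nonempty[OF \<open>subspace W\<close> tl NM.timelike_sum(2)])
qed

lemma trunc_plane_degenerate:
  assumes degenerate
  shows "trunc_plane P x 1 = W \<inter> hyp3"
proof -
  interpret wall_triple "n 2" "n 3" "n 1" x
    by (intro triple) auto
  have "{x, n 2, n 3} \<subseteq> W"
    using assms W(4) by (auto simp: degenerate_def W_def)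
  then have "W = span {x, n 2, n 3}"
    using W(1,2) NM.dim_span_x by (intro span_eqI_dim) auto
  then show ?thesis
    using trunc_plane_eq[of 1 2 3] by simp
qed

text \<open>The normals of the three planes pair negatively, so the common perpendicular of
  \<open>P a\<close> and \<open>P b\<close> lies in the open positive side of \<open>n c\<close>.
  Then \<open>wall_opposite_side\<close> puts \<open>P c\<close> on the positive side of
  \<open>\<nu>\<close>.\<close>

lemma edge_normal:
  assumes p: "{a, b, c} = {1, 2, 3}"
  obtains \<nu> where "\<nu> \<in> W" "lor \<nu> \<nu> = 1" "common_perp (P a) (P b) = wall W \<nu>"
    "lor \<nu> (n a) = 0" "lor \<nu> (n b) = 0" "lor \<nu> (n c) < 0"
    "\<And>v. v \<in> P c \<inter> (W \<inter> hyp3) \<Longrightarrow> lor \<nu> v > 0"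
proof -
  interpret wall_triple "n a" "n b" "n c" x
    using p by (rule triple)
  have abc: "n a \<in> W" "n b \<in> W" "n c \<in> W"
    using W(4) permD[OF p] by blast+
  have sub: "span {n a, n b} \<subseteq> W"
    using abc W(1) by (intro span_minimal) auto
  have "dim W = Suc (dim (span {n a, n b}))"
    using dim_span_pair[OF NM.n_not_span_m(2,1)] W(2) by simp
  then obtain \<nu> where \<nu>: "\<nu> \<in> W" "lor \<nu> \<nu> = 1" "span {n a, n b} = {v \<in> W. lor \<nu> v = 0}" "lor \<nu> (n c) < 0"
    using signed_normal[OF subspace_span NM.timelike_sum W(1) sub _ abc(3) k_not_span] by blast
  have line: "common_perp (P a) (P b) = wall W \<nu>"
    unfolding P[OF permD(4)[OF p]] P[OF permD(5)[OF p]] NM.common_perp_eq \<nu>(3)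
    by (auto simp: wall_def)
  have "lor (n c) u > 0" if u: "u \<in> W" "u \<in> hyp3" "lor \<nu> u = 0" for u
  proof -
    have "u \<in> span {n a, n b}"
      using u by (simp add: \<nu>(3))
    then obtain e f where "e > 0" "f > 0" "u = - (e *\<^sub>R n a + f *\<^sub>R n b)"
      using NM.common_perp_point u(2) by blast
    moreover from this have "e * lor (n a) (n c) < 0" "f * lor (n b) (n c) < 0"
      using NK.nm MK.nm by (auto intro: mult_pos_neg)
    ultimately show ?thesis
      by (simp add: lor_commute[of "n c"])
  qed
  then have "lor \<nu> v > 0" if "v \<in> P c \<inter> (W \<inter> hyp3)" for v
    using wall_opposite_side[OF W(1) \<nu>(1,2) _ \<nu>(4), of v] that P[OF permD(6)[OF p]]
    by (auto simp: wall_def)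
  moreover have "n a \<in> span {n a, n b}" "n b \<in> span {n a, n b}"
    by (auto intro: span_base)
  ultimately show thesis
    using that \<nu> line by blast
qed

text \<open>Only the sign of \<open>\<nu>\<close> at \<open>n b\<close> can be prescribed. The sign
  at \<open>n c\<close> depends on the coefficients of \<open>x\<close>, so the last conclusion is
  conditional on it.\<close>

lemma ray_normal:
  assumes dg: degenerate and p: "{a, b, c} = {1, 2, 3}"
  obtains \<nu> where "\<nu> \<in> W" "lor \<nu> \<nu> = 1" "perp_toward (P a) x = wall W \<nu>"
    "lor \<nu> (n a) = 0" "lor \<nu> x = 0" "lor \<nu> (n b) < 0"
    "\<And>v l. l \<in> {b, c} \<Longrightarrow> lor \<nu> (n l) < 0 \<Longrightarrow> v \<in> P l \<inter> (W \<inter> hyp3) \<Longrightarrow> lor \<nu> v > 0"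
proof -
  interpret wall_triple "n a" "n b" "n c" x
    using p by (rule triple)
  have abc: "n a \<in> W" "n b \<in> W" "x \<in> W"
    using W(4) permD[OF p] dg by (auto simp: W_def degenerate_def)
  have sub: "span {n a, x} \<subseteq> W"
    using abc W(1) by (intro span_minimal) auto
  have tl: "NM.N.light_foot \<in> span {n a, x}" "lor NM.N.light_foot NM.N.light_foot < 0"
    using NM.N.light_foot by (auto simp: hyp3_def)
  have "dim W = Suc (dim (span {n a, x}))"
    using dim_span_pair[OF NM.N.xx(3) NM.N.n_not_span_x] W(2) by simp
  moreover have "n b \<notin> span {n a, x}"
    using NM.S.n_not_span_m_x by simp
  ultimately obtain \<nu> where \<nu>: "\<nu> \<in> W" "lor \<nu> \<nu> = 1" "span {n a, x} = {v \<in> W. lor \<nu> v = 0}" "lor \<nu> (n b) < 0"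
    using signed_normal[OF subspace_span tl W(1) sub _ abc(2)] by blast
  have line: "perp_toward (P a) x = wall W \<nu>"
    unfolding P[OF permD(4)[OF p]] NM.N.perp_toward_eq \<nu>(3) by (auto simp: wall_def)
  have l: "lor (n l) u > 0" if u: "u \<in> W" "u \<in> hyp3" "lor \<nu> u = 0" and l: "l \<in> {b, c}" for u l
  proof -
    have "u \<in> span {n a, x}"
      using u by (simp add: \<nu>(3))
    then obtain e f where ef: "e > 0" "f > 0" "u = e *\<^sub>R x - f *\<^sub>R n a"
      using NM.N.perp_toward_point u(2) by blast
    have "lor (n l) (n a) < 0" "lor (n l) x > 0"
      using l NM.nm NK.nm NM.M.nx NK.M.nx by (auto simp: lor_commute[of _ "n a"])
    then have "f * lor (n l) (n a) < 0" "e * lor (n l) x > 0"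
      using ef by (auto intro: mult_pos_neg)
    then show ?thesis
      by (simp add: ef)
  qed
  then have "lor \<nu> v > 0" if "l \<in> {b, c}" "lor \<nu> (n l) < 0" "v \<in> P l \<inter> (W \<inter> hyp3)" for v l
    using wall_opposite_side[OF W(1) \<nu>(1,2) _ that(2), of v] that P[of l] permD[OF p]
    by (auto simp: wall_def)
  moreover have "n a \<in> span {n a, x}" "x \<in> span {n a, x}"
    by (auto intro: span_base)
  ultimately show thesis
    using that \<nu> line by blast
qed

lemma wall_in_W_nonempty: "i \<in> {1, 2, 3} \<Longrightarrow> P i \<inter> (W \<inter> hyp3) \<noteq> {}"
proof -
  assume i: "i \<in> {1, 2, 3}"
  obtain j k where p: "{i, j, k} = {1, 2, 3}"
    using i by (auto intro: that[of 2 3] that[of 1 3] that[of 1 2])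
  interpret wall_triple "n i" "n j" "n k" x
    using p by (rule triple)
  obtain q where "q \<in> wall W (n i)"
    using hyp3_point_on_wall[OF W(1,3) W(4)[OF i] NM.N.nn] by blast
  then show ?thesis
    using P[OF i] by (auto simp: wall_def)
qed

text \<open>Since \<open>\<nu>\<close> vanishes at \<open>n a\<close> and \<open>n b\<close>,
  \<open>lor \<nu> x\<close> is \<open>\<xi> c * lor \<nu> (n c)\<close>. A negative
  \<open>\<xi> c\<close> thus puts \<open>x\<close> on the same side as \<open>P c\<close>, as the
  definition of the half-plane demands.\<close>

lemma side_half_eq:
  assumes dg: degenerate and p: "{a, b, c} = {1, 2, 3}"
    and xi: "x = (\<Sum>l\<in>{1, 2, 3}. \<xi> l *\<^sub>R n l)" "\<xi> c < 0"
  obtains \<nu> where "side_half P x (W \<inter> hyp3) a b c = half W \<nu>"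
    "lor \<nu> x \<ge> 0" "\<And>l. l \<in> {1, 2, 3} \<Longrightarrow> lor \<nu> (n l) \<le> 0"
proof -
  obtain \<nu> where \<nu>: "\<nu> \<in> W" "lor \<nu> \<nu> = 1" "common_perp (P a) (P b) = wall W \<nu>"
      "lor \<nu> (n a) = 0" "lor \<nu> (n b) = 0" "lor \<nu> (n c) < 0"
      "\<And>v. v \<in> P c \<inter> (W \<inter> hyp3) \<Longrightarrow> lor \<nu> v > 0"
    using edge_normal[OF p] by metis
  obtain v where v: "v \<in> P c \<inter> (W \<inter> hyp3)"
    using wall_in_W_nonempty[OF permD(6)[OF p]] by blast
  have "x = \<xi> a *\<^sub>R n a + (\<xi> b *\<^sub>R n b + \<xi> c *\<^sub>R n c)"
    unfolding xi(1) p[symmetric] using permD[OF p] by simp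
  then have "lor \<nu> x = \<xi> c * lor \<nu> (n c)"
    using \<nu>(4,5) by simp
  then have x0: "lor \<nu> x \<ge> 0"
    using xi(2) \<nu>(6) by (simp add: mult_nonpos_nonpos)
  interpret wall_triple "n a" "n b" "n c" x
    using p by (rule triple)
  have xW: "x \<in> W" "x \<in> pos_light"
    using dg NM.N.x by (auto simp: W_def degenerate_def)
  have "side_half P x (W \<inter> hyp3) a b c = half W \<nu>"
    unfolding side_half_def \<nu>(3)
  proof (rule the_half[OF W(1,3) \<nu>(1,2)])
    show "P c \<inter> (W \<inter> hyp3) \<subseteq> half W \<nu> \<and>
        x \<in> half_ideal_boundary (W \<inter> hyp3) (wall W \<nu>) (half W \<nu>)"
      using \<nu>(7) x0 xW unfolding half_ideal_boundary_half[OF W(1,3) \<nu>(1,2)]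
      by (fastforce simp: in_half)
    have "v \<notin> half W (- \<nu>)"
      using \<nu>(7)[OF v] by (simp add: in_half)
    then show "\<not> (P c \<inter> (W \<inter> hyp3) \<subseteq> half W (- \<nu>) \<and>
        x \<in> half_ideal_boundary (W \<inter> hyp3) (wall W \<nu>) (half W (- \<nu>)))"
      using v by blast
  qed
  moreover have "lor \<nu> (n l) \<le> 0" if "l \<in> {1, 2, 3}" for l
    using that \<nu>(4-6) unfolding p[symmetric] by auto
  ultimately show thesis
    using that x0 by blast
qed

text \<open>Evaluating \<open>\<nu>\<close> at \<open>x\<close> gives
  \<open>\<xi> b * lor \<nu> (n b) + \<xi> c * lor \<nu> (n c) = 0\<close>. Opposite signs of the
  coefficients make both values negative, so \<open>P b\<close> and \<open>P c\<close> lie on one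
  side.\<close>

lemma side_half4_eq:
  assumes dg: degenerate and p: "{a, b, c} = {1, 2, 3}"
    and xi: "x = (\<Sum>l\<in>{1, 2, 3}. \<xi> l *\<^sub>R n l)" "\<xi> b * \<xi> c < 0"
  obtains \<nu> where "side_half4 P x (W \<inter> hyp3) a b c = half W \<nu>"
    "lor \<nu> x \<ge> 0" "\<And>l. l \<in> {1, 2, 3} \<Longrightarrow> lor \<nu> (n l) \<le> 0"
proof -
  obtain \<nu> where \<nu>: "\<nu> \<in> W" "lor \<nu> \<nu> = 1" "perp_toward (P a) x = wall W \<nu>"
      "lor \<nu> (n a) = 0" "lor \<nu> x = 0" "lor \<nu> (n b) < 0"
      "\<And>v l. l \<in> {b, c} \<Longrightarrow> lor \<nu> (n l) < 0 \<Longrightarrow> v \<in> P l \<inter> (W \<inter> hyp3) \<Longrightarrow> lor \<nu> v > 0"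
    using ray_normal[OF dg p] by metis
  have "x = \<xi> a *\<^sub>R n a + (\<xi> b *\<^sub>R n b + \<xi> c *\<^sub>R n c)"
    unfolding xi(1) p[symmetric] using permD[OF p] by simp
  then have "lor \<nu> x = \<xi> b * lor \<nu> (n b) + \<xi> c * lor \<nu> (n c)"
    using \<nu>(4) by simp
  then have eq: "\<xi> c * lor \<nu> (n c) = - (\<xi> b * lor \<nu> (n b))"
    using \<nu>(5) by simp
  have "\<xi> b * \<xi> b > 0"
    using xi(2) by (auto simp: mult_less_0_iff zero_less_mult_iff)
  then have "(\<xi> b * \<xi> b) * lor \<nu> (n b) < 0"
    using \<nu>(6) by (rule mult_pos_neg)
  then have "(\<xi> b * \<xi> c) * lor \<nu> (n c) > 0"
    by (simp add: mult.assoc eq)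
  then have nc: "lor \<nu> (n c) < 0"
    using xi(2) mult_nonpos_nonneg[of "\<xi> b * \<xi> c" "lor \<nu> (n c)"] by linarith
  obtain v where v: "v \<in> P b \<inter> (W \<inter> hyp3)"
    using wall_in_W_nonempty[OF permD(5)[OF p]] by blast
  have "side_half4 P x (W \<inter> hyp3) a b c = half W \<nu>"
    unfolding side_half4_def \<nu>(3)
  proof (rule the_half[OF W(1,3) \<nu>(1,2)])
    show "P b \<inter> (W \<inter> hyp3) \<subseteq> half W \<nu> \<and> P c \<inter> (W \<inter> hyp3) \<subseteq> half W \<nu>"
      using \<nu>(7)[of b] \<nu>(7)[of c] \<nu>(6) nc by (fastforce simp: in_half)
    have "v \<notin> half W (- \<nu>)"
      using \<nu>(7)[of b, OF _ \<nu>(6) v] by (simp add: in_half)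
    then show "\<not> (P b \<inter> (W \<inter> hyp3) \<subseteq> half W (- \<nu>) \<and> P c \<inter> (W \<inter> hyp3) \<subseteq> half W (- \<nu>))"
      using v by blast
  qed
  moreover have "lor \<nu> (n l) \<le> 0" if "l \<in> {1, 2, 3}" for l
    using that \<nu>(4,6) nc unfolding p[symmetric] by auto
  ultimately show thesis
    using that \<nu>(5) by simp
qed

text \<open>The counterpart of \<open>side_half_eq\<close>: a positive \<open>\<xi> c\<close> makes
  \<open>lor \<nu> x\<close> negative, opposite to \<open>P c\<close>.\<close>

lemma diagonal_separates_if:
  assumes dg: degenerate and p: "{a, b, c} = {1, 2, 3}"
    and xi: "x = (\<Sum>l\<in>{1, 2, 3}. \<xi> l *\<^sub>R n l)" "\<xi> c > 0"
  shows "diagonal_separates P x (W \<inter> hyp3) a c b"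
proof -
  obtain \<nu> where \<nu>: "\<nu> \<in> W" "lor \<nu> \<nu> = 1" "common_perp (P a) (P b) = wall W \<nu>"
      "lor \<nu> (n a) = 0" "lor \<nu> (n b) = 0" "lor \<nu> (n c) < 0"
      "\<And>v. v \<in> P c \<inter> (W \<inter> hyp3) \<Longrightarrow> lor \<nu> v > 0"
    using edge_normal[OF p] by metis
  have m\<nu>: "- \<nu> \<in> W" "lor (- \<nu>) (- \<nu>) = 1"
    using \<nu>(1,2) W(1) by (simp_all add: subspace_neg)
  obtain v where v: "v \<in> P c \<inter> (W \<inter> hyp3)"
    using wall_in_W_nonempty[OF permD(6)[OF p]] by blast
  have "x = \<xi> a *\<^sub>R n a + (\<xi> b *\<^sub>R n b + \<xi> c *\<^sub>R n c)"
    unfolding xi(1) p[symmetric] using permD[OF p] by simp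
  then have "lor \<nu> x = \<xi> c * lor \<nu> (n c)"
    using \<nu>(4,5) by simp
  then have x0: "lor (- \<nu>) x \<ge> 0"
    using xi(2) \<nu>(6) by (simp add: mult_nonneg_nonpos)
  interpret wall_triple "n a" "n b" "n c" x
    using p by (rule triple)
  have xW: "x \<in> W" "x \<in> pos_light"
    using dg NM.N.x by (auto simp: W_def degenerate_def)
  have sub: "P c \<inter> (W \<inter> hyp3) \<subseteq> half W \<nu>"
    using \<nu>(7) by (fastforce simp: in_half)
  moreover have "v \<notin> half W (- \<nu>)"
    using \<nu>(7)[OF v] by (simp add: in_half)
  then have "half W \<nu> \<noteq> half W (- \<nu>)"
    using v sub by blast
  moreover have "x \<in> half_ideal_boundary (W \<inter> hyp3) (wall W \<nu>) (half W (- \<nu>))"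
    using x0 xW half_ideal_boundary_half[OF W(1,3) m\<nu>] by simp
  ultimately show ?thesis
    unfolding diagonal_separates_def \<nu>(3) half_of_iff[OF W(1,3) \<nu>(1,2)] by blast
qed

lemma degenerate_coefficients:
  assumes dg: degenerate
  obtains \<xi> p q r where "{p, q, r} = {1, 2, 3}" "x = (\<Sum>l\<in>{1, 2, 3}. \<xi> l *\<^sub>R n l)"
    "\<xi> p < 0" "\<xi> q > 0" "\<xi> r < 0"
proof -
  obtain a b c where abc: "x = a *\<^sub>R n 1 + b *\<^sub>R n 2 + c *\<^sub>R n 3"
    using dg in_span_triple[of x "n 1" "n 2" "n 3"] by (auto simp: degenerate_def)
  define \<xi> where "\<xi> l = (if l = 1 then a else if l = 2 then b else c)" for l :: nat
  have xi: "x = (\<Sum>l\<in>{1, 2, 3}. \<xi> l *\<^sub>R n l)"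
    by (subst abc) (simp add: \<xi>_def)
  have xis: "x = \<xi> i *\<^sub>R n i + \<xi> j *\<^sub>R n j + \<xi> k *\<^sub>R n k" if p: "{i, j, k} = {1, 2, 3}" for i j k
    by (subst xi, unfold p[symmetric]) (use permD[OF p] in simp)
  have coeffs: "\<xi> k \<noteq> 0" "\<not> (\<xi> i > 0 \<and> \<xi> j > 0)" "\<xi> i > 0 \<or> \<xi> j > 0 \<or> \<xi> k > 0"
    if "{i, j, k} = {1, 2, 3}" for i j k
    using wall_triple.coplanar_coefficients[OF triple[OF that] xis[OF that]] by auto
  have perms: "{2, 3, 1} = {1, 2, 3::nat}" "{1, 3, 2} = {1, 2, 3::nat}" "{2, 1, 3} = {1, 2, 3::nat}"
    by auto
  note c = coeffs[OF refl] coeffs[OF perms(1)] coeffs[OF perms(2)]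
  consider "\<xi> 1 > 0" | "\<xi> 2 > 0" | "\<xi> 3 > 0"
    using c by blast
  then show thesis
  proof cases
    case 1
    then show thesis
      using c by (intro that[OF perms(3) xi]) auto
  next
    case 2
    then show thesis
      using c by (intro that[OF refl xi]) auto
  next
    case 3
    then show thesis
      using c by (intro that[OF perms(2) xi]) auto
  qed
qed

lemma lor_cone_nonneg:
  assumes "v = e *\<^sub>R x - (\<Sum>l\<in>{1, 2, 3}. f l *\<^sub>R n l)" "e \<ge> 0" "\<And>l. l \<in> {1, 2, 3} \<Longrightarrow> f l \<ge> 0"
    and "lor \<nu> x \<ge> 0" "\<And>l. l \<in> {1, 2, 3} \<Longrightarrow> lor \<nu> (n l) \<le> 0"
  shows "lor \<nu> v \<ge> 0"
proof -
  have "lor \<nu> v = e * lor \<nu> x - (f 1 * lor \<nu> (n 1) + (f 2 * lor \<nu> (n 2) + f 3 * lor \<nu> (n 3)))"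
    by (simp add: assms(1))
  moreover have "f l * lor \<nu> (n l) \<le> 0" if "l \<in> {1, 2, 3}" for l
    using assms(3,5)[OF that] by (rule mult_nonneg_nonpos)
  then have "f 1 * lor \<nu> (n 1) \<le> 0" "f 2 * lor \<nu> (n 2) \<le> 0" "f 3 * lor \<nu> (n 3) \<le> 0"
    by simp_all
  moreover have "e * lor \<nu> x \<ge> 0"
    using assms by simp
  ultimately show ?thesis
    by linarith
qed

lemma cone_in_truncated_tet:
  assumes v: "v \<in> hyp3" "v = e *\<^sub>R x - (\<Sum>l\<in>{1, 2, 3}. f l *\<^sub>R n l)"
    and e: "e \<ge> 0" and f: "\<And>l. l \<in> {1, 2, 3} \<Longrightarrow> f l \<ge> 0"
    and vH: "\<And>l. l \<in> {1, 2, 3} \<Longrightarrow> lor (n l) v \<ge> 0"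
  shows "v \<in> truncated_tet P H x"
proof -
  have vH': "v \<in> (\<Inter>i\<in>{1, 2, 3}. H i)"
  proof
    fix l :: nat assume "l \<in> {1, 2, 3}"
    then show "v \<in> H l"
      using H v(1) vH by (simp add: in_half)
  qed
  show ?thesis
  proof (cases degenerate)
    case False
    then have "\<not> planes_perp (trunc_plane P x 1) (P 1)"
      using degenerate_iff by blast
    then show ?thesis
      unfolding truncated_tet_def
      using vH' trunc_half_cone[OF False v f] trunc_half4_cone[OF False v e] by auto
  next
    case True
    obtain \<xi> p q r where p: "{p, q, r} = {1, 2, 3}" and xi: "x = (\<Sum>l\<in>{1, 2, 3}. \<xi> l *\<^sub>R n l)"
      and sgn: "\<xi> p < 0" "\<xi> q > 0" "\<xi> r < 0"
      by (rule degenerate_coefficients[OF True])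
    have perms: "{q, r, p} = {1, 2, 3}" "{r, p, q} = {1, 2, 3}" "{p, r, q} = {1, 2, 3}"
      using p by (auto simp: insert_commute)
    have vW: "v \<in> W"
      unfolding v(2) using W(1,4) True
      by (intro subspace_diff subspace_sum subspace_scale) (auto simp: W_def degenerate_def)
    have inW: "v \<in> half W \<nu>" if "lor \<nu> x \<ge> 0" "\<And>l. l \<in> {1, 2, 3} \<Longrightarrow> lor \<nu> (n l) \<le> 0" for \<nu>
      using lor_cone_nonneg[OF v(2) e f that] vW v(1) by (simp add: in_half)
    \<comment> \<open>With \<open>q\<close> the only positive index, these products and the signs at
      \<open>p\<close> and \<open>r\<close> are the conditions for the four half-planes of the
      definition.\<close>
    have "\<xi> p * \<xi> q < 0" "\<xi> q * \<xi> r < 0"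
      using sgn by (simp_all add: mult_neg_pos mult_pos_neg)
    then have "v \<in> side_half P x (W \<inter> hyp3) p q r" "v \<in> side_half P x (W \<inter> hyp3) q r p"
      "v \<in> side_half4 P x (W \<inter> hyp3) r p q" "v \<in> side_half4 P x (W \<inter> hyp3) p q r"
      using side_half_eq[OF True p xi sgn(3)] side_half_eq[OF True perms(1) xi sgn(1)]
        side_half4_eq[OF True perms(2) xi] side_half4_eq[OF True p xi] inW
      by metis+
    moreover have "diagonal_separates P x (W \<inter> hyp3) p q r"
      by (rule diagonal_separates_if[OF True perms(3) xi sgn(2)])
    ultimately have "v \<in> degenerate_tet P H x (W \<inter> hyp3)"
      unfolding degenerate_tet_def using p vW v(1) vH' by blast
    then show ?thesis
      using True degenerate_iff trunc_plane_degenerate[OF True] by (simp add: truncated_tet_def)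
  qed
qed

text \<open>An arc point has coefficient 0 at \<open>x\<close> and two positive coefficients, a ray
  point has one at \<open>x\<close> and one at \<open>n k\<close>. Membership in the remaining
  \<open>H l\<close> follows because distinct normals pair negatively with each other and positively
  with \<open>x\<close>.\<close>

lemma edges_in_truncated_tet:
  assumes p: "{i, j, k} = {1, 2, 3}"
  shows "shortest_arc (P i) (P j) \<subseteq> truncated_tet P H x" "perp_ray_toward (P k) x \<subseteq> truncated_tet P H x"
proof -
  interpret wall_triple "n i" "n j" "n k" x
    using p by (rule triple)
  note Ps = P[OF permD(4)[OF p]] P[OF permD(5)[OF p]] P[OF permD(6)[OF p]]
  note d = permD(1-3)[OF p]
  show "shortest_arc (P i) (P j) \<subseteq> truncated_tet P H x"
  proof
    fix v assume "v \<in> shortest_arc (P i) (P j)"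
    then have v: "v \<in> span {n i, n j}" "v \<in> hyp3" "lor (n i) v \<ge> 0" "lor (n j) v \<ge> 0"
      unfolding Ps NM.shortest_arc_walls by auto
    obtain e f where ef: "e > 0" "f > 0" "v = - (e *\<^sub>R n i + f *\<^sub>R n j)"
      using NM.common_perp_point[OF v(1,2)] by blast
    have "e * lor (n i) (n k) < 0" "f * lor (n j) (n k) < 0"
      using ef NK.nm MK.nm by (auto intro: mult_pos_neg)
    then have vk: "lor (n k) v \<ge> 0"
      by (simp add: ef lor_commute[of "n k"])
    show "v \<in> truncated_tet P H x"
    proof (rule cone_in_truncated_tet[where e = 0 and f = "\<lambda>l. if l = i then e else if l = j then f else 0"])
      show "v = 0 *\<^sub>R x - (\<Sum>l\<in>{1, 2, 3}. (if l = i then e else if l = j then f else 0) *\<^sub>R n l)"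
        unfolding p[symmetric] using d by (simp add: ef(3))
      show "lor (n l) v \<ge> 0" if "l \<in> {1, 2, 3}" for l
        using that v vk unfolding p[symmetric] by auto
    qed (use v ef in auto)
  qed
  show "perp_ray_toward (P k) x \<subseteq> truncated_tet P H x"
  proof
    fix v assume "v \<in> perp_ray_toward (P k) x"
    then have v: "v \<in> span {n k, x}" "v \<in> hyp3" "lor (n k) v \<ge> 0"
      unfolding Ps NK.M.perp_ray_toward_eq by auto
    obtain e f where ef: "e > 0" "f > 0" "v = e *\<^sub>R x - f *\<^sub>R n k"
      using NK.M.perp_toward_point[OF v(1,2)] by blast
    have "f * lor (n i) (n k) < 0" "f * lor (n j) (n k) < 0" "e * lor (n i) x > 0" "e * lor (n j) x > 0"
      using ef NK.nm MK.nm NM.N.nx NM.M.nx by (auto intro: mult_pos_neg)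
    then have vij: "lor (n i) v \<ge> 0" "lor (n j) v \<ge> 0"
      by (simp_all add: ef)
    show "v \<in> truncated_tet P H x"
    proof (rule cone_in_truncated_tet[where e = e and f = "\<lambda>l. if l = k then f else 0"])
      show "v = e *\<^sub>R x - (\<Sum>l\<in>{1, 2, 3}. (if l = k then f else 0) *\<^sub>R n l)"
        unfolding p[symmetric] using d by (simp add: ef(3))
      show "lor (n l) v \<ge> 0" if "l \<in> {1, 2, 3}" for l
        using that v vij unfolding p[symmetric] by auto
    qed (use v ef in auto)
  qed
qed

end

section \<open>From planes and half-spaces to signs of pairings of unit normals\<close>

lemma light_imp_pos_light:
  assumes "lor z z = 0" "z \<noteq> 0"
  obtains c where "c *\<^sub>R z \<in> pos_light"
proof -
  have "z$1 \<noteq> 0"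
  proof
    assume "z$1 = 0"
    then have "z = 0"
      using assms(1) by (auto simp: lor_self vec4_eq_0_iff add_nonneg_eq_0_iff)
    with assms show False by simp
  qed
  then show thesis
    using assms(1) that[of "z$1"] by (simp add: pos_light_iff zero_less_mult_iff) linarith
qed

text \<open>With \<open>c = lor n m\<close>, the case \<open>c * c < 1\<close> yields a common
  point, and \<open>c * c = 1\<close> yields equal planes or a common light-like direction
  \<open>n - c *\<^sub>R m\<close>, that is, parallel planes.\<close>

lemma lor_normals_disjoint:
  assumes n: "lor n n = 1" and m: "lor m m = 1"
    and disj: "wall UNIV n \<inter> wall UNIV m = {}"
    and np: "\<not> parallel_planes (wall UNIV n) (wall UNIV m)"
  shows "(lor n m)\<^sup>2 > 1"
proof (rule ccontr)
  define c where "c = lor n m"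
  have mn: "lor m n = c" "lor n m = c"
    by (simp_all add: c_def lor_commute)
  assume "\<not> ?thesis"
  then consider "c * c < 1" | "c * c = 1"
    by (fastforce simp: c_def power2_eq_square)
  then show False
  proof cases
    case 1
    obtain p where p: "p \<in> wall UNIV n"
      using wall_UNIV_nonempty[OF n] by blast
    then have p': "lor n p = 0" "lor p n = 0" "lor p p = -1"
      by (auto simp: wall_def hyp3_def lor_commute)
    \<comment> \<open>Chosen to make \<open>v\<close> orthogonal to both normals.\<close>
    define b where "b = lor m p / (1 - c * c)"
    define v where "v = p - b *\<^sub>R (m - c *\<^sub>R n)"
    have b: "b * (1 - c * c) = lor m p"
      using 1 by (simp add: b_def)
    have nv: "lor n v = 0" and mv: "lor m v = 0"
      using n m mn p' b by (simp_all add: v_def algebra_simps)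
    have "lor v v = lor p v"
      using nv mv by (subst (1) v_def) simp
    also have "\<dots> = -1 - b * lor m p"
      using p' by (simp add: v_def lor_commute)
    also have "b * lor m p = (b * b) * (1 - c * c)"
      using b by (simp add: mult.assoc)
    finally have "lor v v = -1 - (b * b) * (1 - c * c)" .
    moreover have "(b * b) * (1 - c * c) \<ge> 0"
      using mult_nonneg_nonneg[OF zero_le_square[of b], of "1 - c * c"] 1 by simp
    ultimately have "lor v v < 0"
      by linarith
    then obtain k where "k *\<^sub>R v \<in> hyp3"
      using timelike_multiple_in_hyp3 by blast
    then have "k *\<^sub>R v \<in> wall UNIV n \<inter> wall UNIV m"
      using nv mv by (simp add: wall_def)
    with disj show False by blast
  next
    case 2
    define z where "z = n - c *\<^sub>R m"
    have z: "lor n z = 0" "lor m z = 0"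
      using n m mn 2 by (simp_all add: z_def)
    then have zz: "lor z z = 0"
      by (subst (1) z_def) simp
    show False
    proof (cases "z = 0")
      case True
      then have "n = c *\<^sub>R m"
        by (simp add: z_def)
      moreover have "c \<noteq> 0"
        using 2 by auto
      ultimately have "wall UNIV n = wall UNIV m"
        by (simp add: wall_def)
      with disj wall_UNIV_nonempty[OF n] show False by simp
    next
      case False
      then obtain k where "k *\<^sub>R z \<in> pos_light"
        using light_imp_pos_light zz by blast
      then have "k *\<^sub>R z \<in> ideal_boundary (wall UNIV n) \<inter> ideal_boundary (wall UNIV m)"
        using z by (simp add: ideal_boundary_def span_wall_UNIV n m)
      with np disj show False
        by (auto simp: parallel_planes_def)
    qed
  qed
qed

text \<open>It remains to exclude \<open>c > 1\<close>. The feet of the common perpendicular are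
  multiples of \<open>n - c *\<^sub>R m\<close> and \<open>m - c *\<^sub>R n\<close>. The inclusions
  in the half-spaces make both factors negative, and then the feet would pair positively.\<close>

lemma lor_normals_less:
  assumes n: "lor n n = 1" and m: "lor m m = 1"
    and disj: "wall UNIV n \<inter> wall UNIV m = {}"
    and np: "\<not> parallel_planes (wall UNIV n) (wall UNIV m)"
    and sub: "wall UNIV m \<subseteq> half UNIV n" "wall UNIV n \<subseteq> half UNIV m"
  shows "lor n m < -1"
proof (rule ccontr)
  define c where "c = lor n m"
  have mn: "lor m n = c" "lor n m = c"
    by (simp_all add: c_def lor_commute)
  have c2: "c * c > 1"
    using lor_normals_disjoint[OF n m disj np] by (simp add: c_def power2_eq_square)
  assume "\<not> ?thesis"
  then have "c \<ge> -1"
    by (simp add: c_def)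
  have c: "c > 0"
  proof (rule ccontr)
    assume "\<not> c > 0"
    then have "(- c) * (- c) \<le> 1 * 1"
      using \<open>c \<ge> -1\<close> by (intro mult_mono) auto
    with c2 show False by simp
  qed
  have "lor (n - c *\<^sub>R m) (n - c *\<^sub>R m) < 0" "lor (m - c *\<^sub>R n) (m - c *\<^sub>R n) < 0"
    using n m mn c2 by simp_all
  then obtain k l where k: "k *\<^sub>R (n - c *\<^sub>R m) \<in> hyp3" and l: "l *\<^sub>R (m - c *\<^sub>R n) \<in> hyp3"
      and "k \<noteq> 0" "l \<noteq> 0"
    using timelike_multiple_in_hyp3 by metis
  have "k *\<^sub>R (n - c *\<^sub>R m) \<in> wall UNIV m" "l *\<^sub>R (m - c *\<^sub>R n) \<in> wall UNIV n"
    using k l n m mn by (simp_all add: wall_def)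
  then have "lor n (k *\<^sub>R (n - c *\<^sub>R m)) \<ge> 0" "lor m (l *\<^sub>R (m - c *\<^sub>R n)) \<ge> 0"
    using sub in_half by blast+
  then have "k * (1 - c * c) \<ge> 0" "l * (1 - c * c) \<ge> 0"
    using n m mn by simp_all
  then have kl: "k < 0" "l < 0"
    using c2 \<open>k \<noteq> 0\<close> \<open>l \<noteq> 0\<close> by (auto simp: zero_le_mult_iff)
  have "lor (k *\<^sub>R (n - c *\<^sub>R m)) (l *\<^sub>R (m - c *\<^sub>R n)) = (k * l) * (c * (c * c - 1))"
    using n m mn by (simp add: algebra_simps)
  moreover have "(k * l) * (c * (c * c - 1)) > 0"
    using kl c c2 by (simp add: mult_neg_neg)
  ultimately show False
    using lor_hyp3_le[OF k l] by linarith
qed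

text \<open>The unit normal of each plane is oriented by its half-space. The ideal boundary of the
  half-space gives \<open>lor m x \<ge> 0\<close>, and equality is excluded because \<open>x\<close>
  is not in the ideal boundary of the plane.\<close>

lemma admissible_imp_tetrahedron:
  assumes adm: "admissible P H x"
  obtains n where "tetrahedron P H n x"
proof -
  have x: "x \<in> pos_light"
    using adm by (simp add: admissible_def)
  have "\<exists>m. lor m m = 1 \<and> P i = wall UNIV m \<and> H i = half UNIV m \<and> lor m x > 0" if i: "i \<in> {1, 2, 3}" for i
  proof -
    have a: "is_plane (P i)" "half_of hyp3 (P i) (H i)" "x \<notin> ideal_boundary (P i)"
      "x \<in> half_ideal_boundary hyp3 (P i) (H i)"
      using adm i unfolding admissible_def by blast+
    obtain m0 where m0: "lor m0 m0 = 1" "P i = wall UNIV m0"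
      using is_plane_imp_wall a(1) by blast
    have "H i = half UNIV m0 \<or> H i = half UNIV (- m0)"
      using a(2) half_of_iff[OF subspace_UNIV hyp3_nonempty UNIV_I m0(1)] by (simp add: m0(2))
    then obtain m where m: "lor m m = 1" "P i = wall UNIV m" "H i = half UNIV m"
      using m0 that[of m0] that[of "- m0"] by auto
    have "lor m x \<ge> 0"
      using a(4) half_ideal_boundary_half[OF subspace_UNIV hyp3_nonempty UNIV_I m(1)] by (simp add: m(2,3))
    moreover have "lor m x \<noteq> 0"
      using a(3) x by (simp add: m(2) ideal_boundary_def span_wall_UNIV[OF m(1)])
    ultimately have "lor m x > 0"
      by simp
    with m show ?thesis
      by blast
  qed
  then obtain n where n: "\<And>i. i \<in> {1, 2, 3} \<Longrightarrow>
      lor (n i) (n i) = 1 \<and> P i = wall UNIV (n i) \<and> H i = half UNIV (n i) \<and> lor (n i) x > 0"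
    by metis
  have apart: "\<forall>i\<in>{1, 2, 3}. \<forall>j\<in>{1, 2, 3}. i \<noteq> j \<longrightarrow> P i \<inter> P j = {} \<and> \<not> parallel_planes (P i) (P j)"
    using adm unfolding admissible_def by (elim conjE)
  have sub: "P j \<subseteq> H i" if "i \<in> {1, 2, 3}" "j \<in> {1, 2, 3}" "i \<noteq> j" for i j
    using adm that unfolding admissible_def by (elim conjE) metis
  have pair: "wall_pair (n i) (n j) x" if ij: "i \<in> {1, 2, 3}" "j \<in> {1, 2, 3}" "i \<noteq> j" for i j
  proof -
    have "P i \<inter> P j = {}" "\<not> parallel_planes (P i) (P j)" "P j \<subseteq> H i" "P i \<subseteq> H j"
      using apart[rule_format, OF ij] sub[OF ij] sub[OF ij(2,1) ij(3)[symmetric]] by simp_all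
    then have "lor (n i) (n j) < -1"
      using n[OF ij(1)] n[OF ij(2)] by (intro lor_normals_less) simp_all
    then show ?thesis
      using n[OF ij(1)] n[OF ij(2)] x by unfold_locales auto
  qed
  have "tetrahedron P H n x"
  proof (rule tetrahedron.intro)
    show "wall_triple (n i) (n j) (n k) x" if p: "{i, j, k} = {1, 2, 3}" for i j k
      unfolding wall_triple_def using pair permD[OF p] by simp
  qed (use n in auto)
  then show thesis
    by (rule that)
qed

section \<open>The transversal length as a function of its arguments\<close>

context tetrahedron
begin

lemma T1_args_eq:
  assumes p: "{i, j, k} = {1, 2, 3}"
  shows "T1_args P x i j k = (- lor (n i) (n j), lor (n k) x, - lor (n i) (n k), - lor (n j) (n k),
    lor (n i) x, lor (n j) x)"
proof -
  interpret wall_triple "n i" "n j" "n k" x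
    using p by (rule triple)
  show ?thesis
    using NM.cosh_shortest_arc_length_walls NK.cosh_shortest_arc_length_walls
      MK.cosh_shortest_arc_length_walls NM.N.signed_dist_plane_eq NM.M.signed_dist_plane_eq
      NK.M.signed_dist_plane_eq NM.N.nx NM.M.nx NK.M.nx
    by (simp only: T1_args_def P[OF permD(4)[OF p]] P[OF permD(5)[OF p]] P[OF permD(6)[OF p]] exp_ln)
qed

lemma T1_args_pos:
  assumes p: "{i, j, k} = {1, 2, 3}" and eq: "T1_args P x i j k = (u, y, a, b, c, d)"
  shows "u > 1" "y > 0" "a > 0" "b > 0" "c > 0" "d > 0"
proof -
  interpret wall_triple "n i" "n j" "n k" x
    using p by (rule triple)
  show "u > 1" "y > 0" "a > 0" "b > 0" "c > 0" "d > 0"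
    using eq NM.nm NK.nm MK.nm NM.N.nx NM.M.nx NK.M.nx unfolding T1_args_eq[OF p] by auto
qed

lemma cosh_transversal_length:
  assumes p: "{i, j, k} = {1, 2, 3}" and eq: "T1_args P x i j k = (u, y, a, b, c, d)"
  shows "cosh (transversal_length P x i j k) = transversal_cosh u y a b c d"
    "transversal_length P x i j k \<ge> 0"
proof -
  interpret wall_triple "n i" "n j" "n k" x
    using p by (rule triple)
  note Ps = P[OF permD(4)[OF p]] P[OF permD(5)[OF p]] P[OF permD(6)[OF p]]
  show "cosh (transversal_length P x i j k) = transversal_cosh u y a b c d"
    using eq cosh_transversal(1) unfolding T1_args_eq[OF p] transversal_length_def Ps
    by (simp add: tcosh_def)
  show "transversal_length P x i j k \<ge> 0"
    using cosh_transversal(2) unfolding transversal_length_def Ps .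
qed

lemma shortest_arc_length_sym:
  assumes "i \<in> {1, 2, 3}" "j \<in> {1, 2, 3}" "i \<noteq> j"
  shows "shortest_arc_length (P i) (P j) = shortest_arc_length (P j) (P i)"
proof -
  obtain k where p: "{i, j, k} = {1, 2, 3}"
    using assms by (auto intro: that[of 1] that[of 2] that[of 3])
  interpret wall_triple "n i" "n j" "n k" x
    using p by (rule triple)
  show ?thesis
    using NM.shortest_arc_length_walls NM.S.shortest_arc_length_walls NM.mn P[OF assms(1)] P[OF assms(2)]
    by simp
qed

lemma transversal_of_params:
  assumes p: "{i, j, k} = {1, 2, 3}" and eq: "T1_args P x i j k = (u, y, a, b, c, d)"
    and params: "edge_params P x i j k lam mu"
  obtains s0 t0 where "\<And>z. critical_point (cosh_dist_fun lam mu) z \<longleftrightarrow> z = (s0, t0)"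
    "\<And>s t. cosh_dist_fun lam mu (s0, t0) \<le> cosh_dist_fun lam mu (s, t)"
    "lam s0 \<in> truncated_tet P H x" "mu t0 \<in> truncated_tet P H x"
    "cosh_dist_fun lam mu (s0, t0) = transversal_cosh u y a b c d"
proof -
  interpret wall_triple "n i" "n j" "n k" x
    using p by (rule triple)
  note Ps = P[OF permD(4)[OF p]] P[OF permD(5)[OF p]] P[OF permD(6)[OF p]]
  have "arclength_param lam (common_perp (wall UNIV (n i)) (wall UNIV (n j)))"
    "arclength_param mu (perp_toward (wall UNIV (n k)) x)"
    using params unfolding edge_params_def Ps by auto
  then obtain s0 t0 where z: "\<And>z. critical_point (cosh_dist_fun lam mu) z \<longleftrightarrow> z = (s0, t0)"
    "\<And>s t. cosh_dist_fun lam mu (s0, t0) \<le> cosh_dist_fun lam mu (s, t)"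
    "lam s0 \<in> shortest_arc (wall UNIV (n i)) (wall UNIV (n j))"
    "mu t0 \<in> perp_ray_toward (wall UNIV (n k)) x" "cosh_dist_fun lam mu (s0, t0) = tcosh"
    by (rule transversal_exists) blast
  have "tcosh = transversal_cosh u y a b c d"
    using eq unfolding T1_args_eq[OF p] by (simp add: tcosh_def)
  then show thesis
    using that[OF z(1,2)] z(3-5) edges_in_truncated_tet[OF p] unfolding Ps by (simp add: subset_iff)
qed

end

lemma admissible_permute:
  assumes adm: "admissible P H x" and \<pi>: "\<pi> ` {1, 2, 3} \<subseteq> {1, 2, 3}" "inj_on \<pi> {1, 2, 3}"
  shows "admissible (P \<circ> \<pi>) (H \<circ> \<pi>) x"
proof -
  have "\<pi> i \<in> {1, 2, 3}" if "i \<in> {1, 2, 3}" for i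
    using \<pi>(1) that by blast
  moreover have "\<pi> i \<noteq> \<pi> j" if "i \<in> {1, 2, 3}" "j \<in> {1, 2, 3}" "i \<noteq> j" for i j
    using \<pi>(2) that by (auto dest: inj_onD)
  ultimately show ?thesis
    using adm unfolding admissible_def comp_def by meson
qed

text \<open>The indices must satisfy \<open>i < j\<close> and cannot be exchanged themselves;
  instead the planes and half-spaces are relabelled by the transposition of \<open>i\<close> and
  \<open>j\<close>.\<close>

lemma T1_domain_swap:
  assumes "(u, y, a, b, c, d) \<in> T1_domain"
  shows "(u, y, b, a, d, c) \<in> T1_domain"
proof -
  obtain P H x i j k where args: "T1_args P x i j k = (u, y, a, b, c, d)"
    and adm: "admissible P H x" and opp: "opposite_indices i j k"
    using assms unfolding T1_domain_def by (smt (verit) mem_Collect_eq)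
  obtain n where "tetrahedron P H n x"
    using admissible_imp_tetrahedron[OF adm] by blast
  then interpret tetrahedron P H n x .
  have p: "{i, j, k} = {1, 2, 3}"
    using opp by (simp add: opposite_indices_def)
  note d = permD[OF p]
  define \<pi> where "\<pi> l = (if l = i then j else if l = j then i else l)" for l
  have "\<pi> ` {1, 2, 3} \<subseteq> {1, 2, 3}" "inj_on \<pi> {1, 2, 3}"
    unfolding p[symmetric] using d(1-3) by (auto simp: \<pi>_def inj_on_def)
  then have adm': "admissible (P \<circ> \<pi>) (H \<circ> \<pi>) x"
    by (rule admissible_permute[OF adm])
  have "T1_args (P \<circ> \<pi>) x i j k = (u, y, b, a, d, c)"
    using args shortest_arc_length_sym[OF d(4,5,1)] d(1-3) by (simp add: T1_args_def \<pi>_def)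
  then show ?thesis
    unfolding T1_domain_def using adm' opp by (smt (verit) mem_Collect_eq)
qed

text \<open>The last bound holds because on the domain the formula is the hyperbolic cosine of an
  actual length. It places the values where \<open>arcosh\<close> is strictly increasing.\<close>

lemma T1_domain_bounds:
  assumes "(u, y, a, b, c, d) \<in> T1_domain"
  shows "u > 1" "y > 0" "a > 0" "b > 0" "c > 0" "d > 0" "transversal_cosh u y a b c d \<ge> 1"
proof -
  obtain P H x i j k where args: "T1_args P x i j k = (u, y, a, b, c, d)"
    and adm: "admissible P H x" and opp: "opposite_indices i j k"
    using assms unfolding T1_domain_def by (smt (verit) mem_Collect_eq)
  obtain n where "tetrahedron P H n x"
    using admissible_imp_tetrahedron[OF adm] by blast
  then interpret tetrahedron P H n x .
  have p: "{i, j, k} = {1, 2, 3}"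
    using opp by (simp add: opposite_indices_def)
  show "u > 1" "y > 0" "a > 0" "b > 0" "c > 0" "d > 0"
    by (rule T1_args_pos[OF p args])+
  show "transversal_cosh u y a b c d \<ge> 1"
    using cosh_transversal_length(1)[OF p args] cosh_real_ge_1 by metis
qed

definition transversal_fun :: "real \<times> real \<times> real \<times> real \<times> real \<times> real \<Rightarrow> real" where
  "transversal_fun = (\<lambda>(x, y, a, b, c, d). arcosh (transversal_cosh x y a b c d))"

lemma transversal_fun_less:
  assumes "(x, y, a, b, c, d) \<in> T1_domain" "(x, y, a', b', c', d') \<in> T1_domain"
    and "a \<le> a'" "b \<le> b'" "c \<le> c'" "d \<le> d'" "(a, b, c, d) \<noteq> (a', b', c', d')"
  shows "transversal_fun (x, y, a, b, c, d) < transversal_fun (x, y, a', b', c', d')"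
  using transversal_cosh_mono[OF T1_domain_bounds(1-6)[OF assms(1)] assms(3-7)]
    T1_domain_bounds(7)[OF assms(1)] T1_domain_bounds(7)[OF assms(2)]
  by (simp add: transversal_fun_def)

lemma transversal_length_eq:
  assumes adm: "admissible P H x" and opp: "opposite_indices i j k"
  shows "transversal_length P x i j k = transversal_fun (T1_args P x i j k)"
proof -
  obtain n where "tetrahedron P H n x"
    using admissible_imp_tetrahedron[OF adm] by blast
  then interpret tetrahedron P H n x .
  have p: "{i, j, k} = {1, 2, 3}"
    using opp by (simp add: opposite_indices_def)
  obtain u y a b c d where args: "T1_args P x i j k = (u, y, a, b, c, d)"
    by (cases "T1_args P x i j k") auto
  show ?thesis
    using cosh_transversal_length[OF p args] arcosh_cosh_real[of "transversal_length P x i j k"]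
    by (simp add: args transversal_fun_def)
qed

text \<open>\<open>M\<close> depends only on the indices and takes its arguments in one fixed order.
  The three cases sort them, and symmetry of the length reorders pairs such as \<open>P 3\<close>,
  \<open>P 2\<close>.\<close>

lemma transversal_cosh_of_lengths:
  assumes "opposite_indices i j k"
  obtains M :: "real \<Rightarrow> real \<Rightarrow> real \<Rightarrow> real \<Rightarrow> real \<Rightarrow> real \<Rightarrow> real" where
    "\<And>P H x u y a b c d. admissible P H x \<Longrightarrow> T1_args P x i j k = (u, y, a, b, c, d) \<Longrightarrow>
      transversal_cosh u y a b c d =
        M (shortest_arc_length (P 1) (P 2)) (shortest_arc_length (P 1) (P 3))
          (shortest_arc_length (P 2) (P 3))
          (signed_dist_plane x (P 1)) (signed_dist_plane x (P 2)) (signed_dist_plane x (P 3))"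
proof -
  have p: "{i, j, k} = {1, 2, 3}" "i < j"
    using assms by (auto simp: opposite_indices_def)
  have sym: "shortest_arc_length (P 3) (P 2) = shortest_arc_length (P 2) (P 3)"
    "shortest_arc_length (P 2) (P 1) = shortest_arc_length (P 1) (P 2)"
    "shortest_arc_length (P 3) (P 1) = shortest_arc_length (P 1) (P 3)"
    if adm: "admissible P H x" for P H and x :: "real^4"
  proof -
    obtain n where "tetrahedron P H n x"
      using admissible_imp_tetrahedron[OF adm] by blast
    then interpret tetrahedron P H n x .
    show "shortest_arc_length (P 3) (P 2) = shortest_arc_length (P 2) (P 3)"
      "shortest_arc_length (P 2) (P 1) = shortest_arc_length (P 1) (P 2)"
      "shortest_arc_length (P 3) (P 1) = shortest_arc_length (P 1) (P 3)"
      by (rule shortest_arc_length_sym; simp)+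
  qed
  consider "i = 1" "j = 2" "k = 3" | "i = 1" "j = 3" "k = 2" | "i = 2" "j = 3" "k = 1"
    using permD[OF p(1)] p(2) by auto
  then show thesis
  proof cases
    case 1
    show thesis
      by (rule that[of "\<lambda>l12 l13 l23 h1 h2 h3. transversal_cosh (cosh l12) (exp h3) (cosh l13) (cosh l23) (exp h1) (exp h2)"])
        (use 1 in \<open>auto simp: T1_args_def\<close>)
  next
    case 2
    show thesis
      by (rule that[of "\<lambda>l12 l13 l23 h1 h2 h3. transversal_cosh (cosh l13) (exp h2) (cosh l12) (cosh l23) (exp h1) (exp h3)"])
        (use 2 sym in \<open>auto simp: T1_args_def\<close>)
  next
    case 3
    show thesis
      by (rule that[of "\<lambda>l12 l13 l23 h1 h2 h3. transversal_cosh (cosh l23) (exp h1) (cosh l12) (cosh l13) (exp h2) (exp h3)"])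
        (use 3 sym in \<open>auto simp: T1_args_def\<close>)
  qed
qed

theorem lemma4p3:
  shows
   "(\<forall>(P :: nat \<Rightarrow> (real^4) set) H x i j k lam mu.
       admissible P H x \<longrightarrow> opposite_indices i j k \<longrightarrow> edge_params P x i j k lam mu \<longrightarrow>
       (\<exists>s0 t0.
          (\<forall>z. critical_point (cosh_dist_fun lam mu) z \<longleftrightarrow> z = (s0, t0)) \<and>
          (\<forall>s t. cosh_dist_fun lam mu (s0, t0) \<le> cosh_dist_fun lam mu (s, t)) \<and>
          lam s0 \<in> truncated_tet P H x \<and> mu t0 \<in> truncated_tet P H x \<and>
          cosh_dist_fun lam mu (s0, t0) = cosh (transversal_length P x i j k)))
    \<and>
    (\<forall>i j k. opposite_indices i j k \<longrightarrow>
       (\<exists>M :: real \<Rightarrow> real \<Rightarrow> real \<Rightarrow> real \<Rightarrow> real \<Rightarrow> real \<Rightarrow> real.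
          \<forall>(P :: nat \<Rightarrow> (real^4) set) H x lam mu s0 t0.
            admissible P H x \<longrightarrow> edge_params P x i j k lam mu \<longrightarrow>
            critical_point (cosh_dist_fun lam mu) (s0, t0) \<longrightarrow>
            cosh_dist_fun lam mu (s0, t0) =
              M (shortest_arc_length (P 1) (P 2)) (shortest_arc_length (P 1) (P 3))
                (shortest_arc_length (P 2) (P 3))
                (signed_dist_plane x (P 1)) (signed_dist_plane x (P 2))
                (signed_dist_plane x (P 3))))
    \<and>
    (\<exists>T1 :: real \<times> real \<times> real \<times> real \<times> real \<times> real \<Rightarrow> real.
       (\<forall>(P :: nat \<Rightarrow> (real^4) set) H x i j k.
          admissible P H x \<longrightarrow> opposite_indices i j k \<longrightarrow>
          transversal_length P x i j k = T1 (T1_args P x i j k)) \<and>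
       (\<forall>x y a b c d. (x, y, a, b, c, d) \<in> T1_domain \<longrightarrow>
          (x, y, b, a, d, c) \<in> T1_domain \<and> T1 (x, y, b, a, d, c) = T1 (x, y, a, b, c, d)) \<and>
       (\<forall>x y a b c d a'. (x, y, a, b, c, d) \<in> T1_domain \<longrightarrow> (x, y, a', b, c, d) \<in> T1_domain \<longrightarrow>
          a < a' \<longrightarrow> T1 (x, y, a, b, c, d) < T1 (x, y, a', b, c, d)) \<and>
       (\<forall>x y a b c d b'. (x, y, a, b, c, d) \<in> T1_domain \<longrightarrow> (x, y, a, b', c, d) \<in> T1_domain \<longrightarrow>
          b < b' \<longrightarrow> T1 (x, y, a, b, c, d) < T1 (x, y, a, b', c, d)) \<and>
       (\<forall>x y a b c d c'. (x, y, a, b, c, d) \<in> T1_domain \<longrightarrow> (x, y, a, b, c', d) \<in> T1_domain \<longrightarrow>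
          c < c' \<longrightarrow> T1 (x, y, a, b, c, d) < T1 (x, y, a, b, c', d)) \<and>
       (\<forall>x y a b c d d'. (x, y, a, b, c, d) \<in> T1_domain \<longrightarrow> (x, y, a, b, c, d') \<in> T1_domain \<longrightarrow>
          d < d' \<longrightarrow> T1 (x, y, a, b, c, d) < T1 (x, y, a, b, c, d')))"
proof (intro conjI)
  show "\<forall>(P :: nat \<Rightarrow> (real^4) set) H x i j k lam mu.
       admissible P H x \<longrightarrow> opposite_indices i j k \<longrightarrow> edge_params P x i j k lam mu \<longrightarrow>
       (\<exists>s0 t0.
          (\<forall>z. critical_point (cosh_dist_fun lam mu) z \<longleftrightarrow> z = (s0, t0)) \<and>
          (\<forall>s t. cosh_dist_fun lam mu (s0, t0) \<le> cosh_dist_fun lam mu (s, t)) \<and>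
          lam s0 \<in> truncated_tet P H x \<and> mu t0 \<in> truncated_tet P H x \<and>
          cosh_dist_fun lam mu (s0, t0) = cosh (transversal_length P x i j k))"
  proof (intro allI impI)
    fix P H :: "nat \<Rightarrow> (real^4) set" and x i j k lam mu
    assume adm: "admissible P H x" and opp: "opposite_indices i j k"
      and params: "edge_params P x i j k lam mu"
    obtain n where "tetrahedron P H n x"
      using admissible_imp_tetrahedron[OF adm] by blast
    then interpret tetrahedron P H n x .
    have p: "{i, j, k} = {1, 2, 3}"
      using opp by (simp add: opposite_indices_def)
    obtain u y a b c d where args: "T1_args P x i j k = (u, y, a, b, c, d)"
      by (cases "T1_args P x i j k") auto
    show "\<exists>s0 t0.
          (\<forall>z. critical_point (cosh_dist_fun lam mu) z \<longleftrightarrow> z = (s0, t0)) \<and>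
          (\<forall>s t. cosh_dist_fun lam mu (s0, t0) \<le> cosh_dist_fun lam mu (s, t)) \<and>
          lam s0 \<in> truncated_tet P H x \<and> mu t0 \<in> truncated_tet P H x \<and>
          cosh_dist_fun lam mu (s0, t0) = cosh (transversal_length P x i j k)"
      unfolding cosh_transversal_length(1)[OF p args]
      by (rule transversal_of_params[OF p args params]) blast
  qed
next
  show "\<forall>i j k. opposite_indices i j k \<longrightarrow>
       (\<exists>M :: real \<Rightarrow> real \<Rightarrow> real \<Rightarrow> real \<Rightarrow> real \<Rightarrow> real \<Rightarrow> real.
          \<forall>(P :: nat \<Rightarrow> (real^4) set) H x lam mu s0 t0.
            admissible P H x \<longrightarrow> edge_params P x i j k lam mu \<longrightarrow>
            critical_point (cosh_dist_fun lam mu) (s0, t0) \<longrightarrow>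
            cosh_dist_fun lam mu (s0, t0) =
              M (shortest_arc_length (P 1) (P 2)) (shortest_arc_length (P 1) (P 3))
                (shortest_arc_length (P 2) (P 3))
                (signed_dist_plane x (P 1)) (signed_dist_plane x (P 2))
                (signed_dist_plane x (P 3)))"
  proof (intro allI impI)
    fix i j k
    assume opp: "opposite_indices i j k"
    have p: "{i, j, k} = {1, 2, 3}"
      using opp by (simp add: opposite_indices_def)
    show "\<exists>M :: real \<Rightarrow> real \<Rightarrow> real \<Rightarrow> real \<Rightarrow> real \<Rightarrow> real \<Rightarrow> real.
          \<forall>(P :: nat \<Rightarrow> (real^4) set) H x lam mu s0 t0.
            admissible P H x \<longrightarrow> edge_params P x i j k lam mu \<longrightarrow>
            critical_point (cosh_dist_fun lam mu) (s0, t0) \<longrightarrow>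
            cosh_dist_fun lam mu (s0, t0) =
              M (shortest_arc_length (P 1) (P 2)) (shortest_arc_length (P 1) (P 3))
                (shortest_arc_length (P 2) (P 3))
                (signed_dist_plane x (P 1)) (signed_dist_plane x (P 2))
                (signed_dist_plane x (P 3))"
    proof (rule transversal_cosh_of_lengths[OF opp])
      fix M :: "real \<Rightarrow> real \<Rightarrow> real \<Rightarrow> real \<Rightarrow> real \<Rightarrow> real \<Rightarrow> real"
      assume M: "\<And>P H x u y a b c d. admissible P H x \<Longrightarrow> T1_args P x i j k = (u, y, a, b, c, d) \<Longrightarrow>
        transversal_cosh u y a b c d =
          M (shortest_arc_length (P 1) (P 2)) (shortest_arc_length (P 1) (P 3))
            (shortest_arc_length (P 2) (P 3))
            (signed_dist_plane x (P 1)) (signed_dist_plane x (P 2)) (signed_dist_plane x (P 3))"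
      show ?thesis
      proof (intro exI[of _ M] allI impI)
        fix P H :: "nat \<Rightarrow> (real^4) set" and x lam mu s0 t0
        assume adm: "admissible P H x" and params: "edge_params P x i j k lam mu"
          and crit: "critical_point (cosh_dist_fun lam mu) (s0, t0)"
        obtain n where "tetrahedron P H n x"
          using admissible_imp_tetrahedron[OF adm] by blast
        then interpret tetrahedron P H n x .
        obtain u y a b c d where args: "T1_args P x i j k = (u, y, a, b, c, d)"
          by (cases "T1_args P x i j k") auto
        obtain s1 t1 where "\<And>z. critical_point (cosh_dist_fun lam mu) z \<longleftrightarrow> z = (s1, t1)"
          "cosh_dist_fun lam mu (s1, t1) = transversal_cosh u y a b c d"
          by (rule transversal_of_params[OF p args params]) blast
        \<comment> \<open>Uniqueness of the critical point identifies \<open>(s0, t0)\<close> with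
          the point where the value is known.\<close>
        with crit M[OF adm args] show "cosh_dist_fun lam mu (s0, t0) =
                M (shortest_arc_length (P 1) (P 2)) (shortest_arc_length (P 1) (P 3))
                  (shortest_arc_length (P 2) (P 3))
                  (signed_dist_plane x (P 1)) (signed_dist_plane x (P 2))
                  (signed_dist_plane x (P 3))"
          by simp
      qed
    qed
  qed
next
  show "\<exists>T1 :: real \<times> real \<times> real \<times> real \<times> real \<times> real \<Rightarrow> real.
       (\<forall>(P :: nat \<Rightarrow> (real^4) set) H x i j k.
          admissible P H x \<longrightarrow> opposite_indices i j k \<longrightarrow>
          transversal_length P x i j k = T1 (T1_args P x i j k)) \<and>
       (\<forall>x y a b c d. (x, y, a, b, c, d) \<in> T1_domain \<longrightarrow>
          (x, y, b, a, d, c) \<in> T1_domain \<and> T1 (x, y, b, a, d, c) = T1 (x, y, a, b, c, d)) \<and>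
       (\<forall>x y a b c d a'. (x, y, a, b, c, d) \<in> T1_domain \<longrightarrow> (x, y, a', b, c, d) \<in> T1_domain \<longrightarrow>
          a < a' \<longrightarrow> T1 (x, y, a, b, c, d) < T1 (x, y, a', b, c, d)) \<and>
       (\<forall>x y a b c d b'. (x, y, a, b, c, d) \<in> T1_domain \<longrightarrow> (x, y, a, b', c, d) \<in> T1_domain \<longrightarrow>
          b < b' \<longrightarrow> T1 (x, y, a, b, c, d) < T1 (x, y, a, b', c, d)) \<and>
       (\<forall>x y a b c d c'. (x, y, a, b, c, d) \<in> T1_domain \<longrightarrow> (x, y, a, b, c', d) \<in> T1_domain \<longrightarrow>
          c < c' \<longrightarrow> T1 (x, y, a, b, c, d) < T1 (x, y, a, b, c', d)) \<and>
       (\<forall>x y a b c d d'. (x, y, a, b, c, d) \<in> T1_domain \<longrightarrow> (x, y, a, b, c, d') \<in> T1_domain \<longrightarrow>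
          d < d' \<longrightarrow> T1 (x, y, a, b, c, d) < T1 (x, y, a, b, c, d'))"
  proof (intro exI[of _ transversal_fun] conjI allI impI)
    fix x y a b c d
    assume dom: "(x, y, a, b, c, d) \<in> T1_domain"
    then show "(x, y, b, a, d, c) \<in> T1_domain"
      by (rule T1_domain_swap)
    show "transversal_fun (x, y, b, a, d, c) = transversal_fun (x, y, a, b, c, d)"
      using transversal_cosh_swap[OF T1_domain_bounds(1)[OF dom]] by (simp add: transversal_fun_def)
  qed (auto intro: transversal_length_eq transversal_fun_less)
qed

end
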